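(* Let $(M,g,\mathcal Q)$ be an arbitrary 8-dimensional almost quaternion-Hermitian manifold equipped with a cubic discriminant $K$. Suppose there is a linear connection $D$ on $M$ such that: 1. the holonomy group of $D$ is a subgroup of $SO(4)_{ir}\subset Sp(2)Sp(1)$; 2. the torsion tensor $T$ of $D$ is related to some tensor field $d$ by the equation $g(T(x,y),z)=d(x,y,z)-d(y,x,z)$ for all vector fields $x,y,z$ on $M$, where $d$ satisfies, for $s=1,2,3$, the two properties 2.1. $d(x,y,z)=d(x,I_sy,I_sz)$; 2.2. $\sum_{a=1}^8d(x,h_a,\mathcal E_sh_a)=0$, where $I_s$ and $\mathcal E_s$ are local generators of $\mathcal Q$ and $Bsp(1)_{ir}$, respectively, and $\{h_a\}$ is a local $g$-orthonormal frame. Then $(M,g,\mathcal Q)$ must be quaternion-Kähler. Furthermore, $D$ is equal to the canonical connection $\overset{c}{\nabla}$, and $d$ is identical to the tensor field $$t(x,y,z)=\frac1{120}\sum_{a,b,c=1}^8\Big((\nabla_xK)(y,h_a,h_b,h_c)K(z,h_a,h_b,h_c)-(\nabla_xK)(z,h_a,h_b,h_c)K(y,h_a,h_b,h_c)\Big),$$ where $\nabla$ is the Levi-Civita connection of $g$.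
   Context: An almost quaternion-Hermitian 8-manifold $(M,g,\mathcal Q)$ is an 8-dimensional manifold $M$ with a Riemannian metric $g$ and a rank-3 subbundle $\mathcal Q\subset \mathrm{End}(TM)$ locally spanned by $I_1,I_2,I_3$ with $I_1I_2=-I_2I_1=I_3$, $I_s^2=-\mathrm{Id}$, $g(I_sx,I_sy)=g(x,y)$. It is quaternion-Kähler if the 4-form $\Omega=\sum_s\omega_s\wedge\omega_s$, $\omega_s(x,y)=g(I_sx,y)$, is parallel for the Levi-Civita connection $\nabla$. For $p\in M$: $Bsp(2)_p$ is the Lie algebra of skew-symmetric endomorphisms of $T_pM$ commuting with all elements of $\mathcal Q_p$. $\mathfrak R^{Sp(2)}_p$ is the space of all $K\in\Lambda^2T_p^*M\otimes\Lambda^2T_p^*M$ with $K(x,y,z,w)+K(y,z,x,w)+K(z,x,y,w)=0$ and $K(x,y,I_sz,I_sw)=K(x,y,z,w)$, $s=1,2,3$. For such $K$, $\mathcal T_K\in \mathrm{End}(Bsp(2)_p)$ is given by $g(\mathcal T_K(A)x,y)=\frac12\sum_{a=1}^8K(x,y,h_a,Ah_a)$, $\{h_a\}$ any orthonormal basis of $T_pM$. $\mathcal C_p$ is the set of $K\in\mathfrak R_p^{Sp(2)}$ such that $(2\mathcal T_K-7\,\mathrm{Id})(2\mathcal T_K+3\,\mathrm{Id})=0$ and $[\mathcal T_KA,\mathcal T_KB]-\mathcal T_K[\mathcal T_KA,B]=\frac32(\mathcal T_K[A,B]-[A,\mathcal T_KB])$ for all $A,B\in Bsp(2)_p$. A cubic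 discriminant on $M$ is a smooth tensor field $K$ with $K_p\in\mathcal C_p$ for every $p$. At each $p$, $Sp(2)Sp(1)=\{A\in SO(T_pM): A\mathcal Q_pA^{-1}\subset\mathcal Q_p\}$, and $SO(4)_{ir}$ is the stabilizer of $K_p$ in it. That the holonomy of $D$ is contained in $SO(4)_{ir}$ means $D_xg=0$, $D_x\mathcal Q\subset\mathcal Q$ and $D_xK=0$ for all $x\in TM$. $Bsp(1)_{ir}\subset Bsp(2)$ is the rank-3 bundle of Lie algebras isomorphic to $sp(1)$ whose fibre at $p$ is the $\frac72$-eigenspace of $\mathcal T_{K_p}$; $\mathcal E_1,\mathcal E_2,\mathcal E_3$ denote local sections spanning it with $[\mathcal E_i,\mathcal E_j]=\mathcal E_k$ for positive permutations $(ijk)$ of $(123)$. On a quaternion-Kähler $(M,g,\mathcal Q)$ with cubic discriminant $K$, the canonical connection is $\overset{c}{\nabla}_xy=\nabla_xy+\sum_{a=1}^8t(x,y,h_a)h_a$, with $t$ as in the claim and $\{h_a\}$ any local $g$-orthonormal frame.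
   Formalization: The tensor field d is additionally assumed skew in its last two arguments, d(x,y,z) = -d(x,z,y); without this the claim fails (conformal change of flat R^8 with d(x,y,z) = df(x)g(y,z)), and the conclusion d = t forces it. *)

theory Defs
  imports "HOL-Analysis.Analysis"
begin

section \<open>Smooth 8-manifolds\<close>

primrec Ck_on :: "nat \<Rightarrow> 'a::real_normed_vector set \<Rightarrow> ('a \<Rightarrow> 'b::real_normed_vector) \<Rightarrow> bool" where
  "Ck_on 0 S f \<longleftrightarrow> continuous_on S f"
| "Ck_on (Suc k) S f \<longleftrightarrow> (\<forall>x\<in>S. f differentiable (at x)) \<and>
     (\<forall>v. Ck_on k S (\<lambda>x. frechet_derivative f (at x) v))"

text \<open>Meant for open subsets \<open>S\<close> of a finite-dimensional space.\<close>
definition smooth_on :: "'a::real_normed_vector set \<Rightarrow> ('a \<Rightarrow> 'b::real_normed_vector) \<Rightarrow> bool" where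
  "smooth_on S f \<longleftrightarrow> (\<forall>k. Ck_on k S f)"

type_synonym vec = "real^8"
type_synonym endo = "real^8^8"

text \<open>A chart is a pair \<open>(U, \<phi>)\<close>; only the restriction of \<open>\<phi>\<close> to \<open>U\<close> matters.\<close>
type_synonym 'm chart = "'m set \<times> ('m \<Rightarrow> vec)"

abbreviation dom_of :: "'m chart \<Rightarrow> 'm set" where
  "dom_of c \<equiv> fst c"

abbreviation map_of_chart :: "'m chart \<Rightarrow> 'm \<Rightarrow> vec" where
  "map_of_chart c \<equiv> snd c"

definition inv_chart :: "'m chart \<Rightarrow> vec \<Rightarrow> 'm" where
  "inv_chart c = inv_into (dom_of c) (map_of_chart c)"

definition is_chart :: "'m::topological_space chart \<Rightarrow> bool" where
  "is_chart c \<longleftrightarrow> open (dom_of c) \<and> open (map_of_chart c ` dom_of c) \<and>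
     homeomorphism (dom_of c) (map_of_chart c ` dom_of c) (map_of_chart c) (inv_chart c)"

definition smooth_atlas :: "'m::topological_space chart set \<Rightarrow> bool" where
  "smooth_atlas \<A> \<longleftrightarrow> (\<forall>c\<in>\<A>. is_chart c) \<and> (\<Union>c\<in>\<A>. dom_of c) = UNIV \<and>
     (\<forall>c\<in>\<A>. \<forall>c'\<in>\<A>. smooth_on (map_of_chart c ` (dom_of c \<inter> dom_of c')) (map_of_chart c' \<circ> inv_chart c))"

text \<open>The tangent space at \<open>p\<close> is the vector space \<open>vec\<close>, a tangent vector being given by its
  components in one fixed chart around \<open>p\<close>, namely \<open>chart_at \<A> p\<close>. Its components in any other
  chart are obtained with the differential of the coordinate change, \<open>transition\<close>. Endomorphisms
  of the tangent space are matrices.\<close>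
definition chart_at :: "'m chart set \<Rightarrow> 'm \<Rightarrow> 'm chart" where
  "chart_at \<A> p = (SOME c. c \<in> \<A> \<and> p \<in> dom_of c)"

definition transition :: "'m chart \<Rightarrow> 'm chart \<Rightarrow> 'm \<Rightarrow> vec \<Rightarrow> vec" where
  "transition c c' p v = frechet_derivative (map_of_chart c' \<circ> inv_chart c) (at (map_of_chart c p)) v"

definition smooth_fun :: "'m chart set \<Rightarrow> 'm set \<Rightarrow> ('m \<Rightarrow> real) \<Rightarrow> bool" where
  "smooth_fun \<A> U f \<longleftrightarrow> (\<forall>c\<in>\<A>. smooth_on (map_of_chart c ` (U \<inter> dom_of c)) (f \<circ> inv_chart c))"

definition components :: "'m chart set \<Rightarrow> 'm chart \<Rightarrow> ('m \<Rightarrow> vec) \<Rightarrow> vec \<Rightarrow> vec" where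
  "components \<A> c X u = transition (chart_at \<A> (inv_chart c u)) c (inv_chart c u) (X (inv_chart c u))"

definition smooth_field :: "'m chart set \<Rightarrow> 'm set \<Rightarrow> ('m \<Rightarrow> vec) \<Rightarrow> bool" where
  "smooth_field \<A> U X \<longleftrightarrow> (\<forall>c\<in>\<A>. smooth_on (map_of_chart c ` (U \<inter> dom_of c)) (components \<A> c X))"

definition smooth_endo :: "'m::topological_space chart set \<Rightarrow> 'm set \<Rightarrow> ('m \<Rightarrow> endo) \<Rightarrow> bool" where
  "smooth_endo \<A> U J \<longleftrightarrow> (\<forall>V X. open V \<and> V \<subseteq> U \<and> smooth_field \<A> V X \<longrightarrow>
     smooth_field \<A> V (\<lambda>q. J q *v X q))"

text \<open>Covariant tensor fields are smooth iff they are smooth on smooth local vector fields.\<close>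
definition tensor2_field :: "'m::topological_space chart set \<Rightarrow> ('m \<Rightarrow> vec \<Rightarrow> vec \<Rightarrow> real) \<Rightarrow> bool" where
  "tensor2_field \<A> g \<longleftrightarrow>
     (\<forall>p x y. linear (\<lambda>v. g p v y) \<and> linear (\<lambda>v. g p x v)) \<and>
     (\<forall>U X Y. open U \<and> smooth_field \<A> U X \<and> smooth_field \<A> U Y \<longrightarrow>
        smooth_fun \<A> U (\<lambda>q. g q (X q) (Y q)))"

definition tensor3_field :: "'m::topological_space chart set \<Rightarrow> ('m \<Rightarrow> vec \<Rightarrow> vec \<Rightarrow> vec \<Rightarrow> real) \<Rightarrow> bool" where
  "tensor3_field \<A> d \<longleftrightarrow>
     (\<forall>p x y z. linear (\<lambda>v. d p v y z) \<and> linear (\<lambda>v. d p x v z) \<and> linear (\<lambda>v. d p x y v)) \<and>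
     (\<forall>U X Y Z. open U \<and> smooth_field \<A> U X \<and> smooth_field \<A> U Y \<and> smooth_field \<A> U Z \<longrightarrow>
        smooth_fun \<A> U (\<lambda>q. d q (X q) (Y q) (Z q)))"

definition multilinear4 :: "(vec \<Rightarrow> vec \<Rightarrow> vec \<Rightarrow> vec \<Rightarrow> real) \<Rightarrow> bool" where
  "multilinear4 K \<longleftrightarrow> (\<forall>x y z w. linear (\<lambda>v. K v y z w) \<and> linear (\<lambda>v. K x v z w) \<and>
     linear (\<lambda>v. K x y v w) \<and> linear (\<lambda>v. K x y z v))"

definition tensor4_field :: "'m::topological_space chart set \<Rightarrow> ('m \<Rightarrow> vec \<Rightarrow> vec \<Rightarrow> vec \<Rightarrow> vec \<Rightarrow> real) \<Rightarrow> bool" where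
  "tensor4_field \<A> K \<longleftrightarrow> (\<forall>p. multilinear4 (K p)) \<and>
     (\<forall>U X Y Z W. open U \<and> smooth_field \<A> U X \<and> smooth_field \<A> U Y \<and> smooth_field \<A> U Z \<and>
        smooth_field \<A> U W \<longrightarrow> smooth_fun \<A> U (\<lambda>q. K q (X q) (Y q) (Z q) (W q)))"

definition dir_deriv :: "'m chart set \<Rightarrow> 'm \<Rightarrow> vec \<Rightarrow> ('m \<Rightarrow> real) \<Rightarrow> real" where
  "dir_deriv \<A> p x f = frechet_derivative (f \<circ> inv_chart (chart_at \<A> p)) (at (map_of_chart (chart_at \<A> p) p)) x"

definition lie_bracket :: "'m chart set \<Rightarrow> ('m \<Rightarrow> vec) \<Rightarrow> ('m \<Rightarrow> vec) \<Rightarrow> 'm \<Rightarrow> vec" where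
  "lie_bracket \<A> X Y p = (let c = chart_at \<A> p; u = map_of_chart c p in
     frechet_derivative (components \<A> c Y) (at u) (X p)
     - frechet_derivative (components \<A> c X) (at u) (Y p))"

section \<open>Linear connections\<close>

text \<open>A connection is an operator \<open>D p x Y\<close>, where \<open>x\<close> is a tangent vector at \<open>p\<close> and \<open>Y\<close> is a vector
  field that is smooth near \<open>p\<close>; its values on other fields \<open>Y\<close> carry no meaning.\<close>
type_synonym 'm connection = "'m \<Rightarrow> vec \<Rightarrow> ('m \<Rightarrow> vec) \<Rightarrow> vec"

definition linear_connection :: "'m::topological_space chart set \<Rightarrow> 'm connection \<Rightarrow> bool" where
  "linear_connection \<A> D \<longleftrightarrow> (\<forall>U. open U \<longrightarrow>
     (\<forall>Y. smooth_field \<A> U Y \<longrightarrow> (\<forall>p\<in>U. linear (\<lambda>x. D p x Y))) \<and>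
     (\<forall>Y Z. smooth_field \<A> U Y \<and> smooth_field \<A> U Z \<longrightarrow>
        (\<forall>p\<in>U. \<forall>x. D p x (\<lambda>q. Y q + Z q) = D p x Y + D p x Z)) \<and>
     (\<forall>f Y. smooth_fun \<A> U f \<and> smooth_field \<A> U Y \<longrightarrow>
        (\<forall>p\<in>U. \<forall>x. D p x (\<lambda>q. f q *\<^sub>R Y q) = dir_deriv \<A> p x f *\<^sub>R Y p + f p *\<^sub>R D p x Y)) \<and>
     (\<forall>Y Z. smooth_field \<A> U Y \<and> (\<forall>q\<in>U. Y q = Z q) \<longrightarrow> (\<forall>p\<in>U. \<forall>x. D p x Y = D p x Z)) \<and>
     (\<forall>X Y. smooth_field \<A> U X \<and> smooth_field \<A> U Y \<longrightarrow> smooth_field \<A> U (\<lambda>q. D q (X q) Y)))"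

definition same_connection :: "'m::topological_space chart set \<Rightarrow> 'm connection \<Rightarrow> 'm connection \<Rightarrow> bool" where
  "same_connection \<A> D D' \<longleftrightarrow> (\<forall>U Y. open U \<and> smooth_field \<A> U Y \<longrightarrow>
     (\<forall>p\<in>U. \<forall>x. D p x Y = D' p x Y))"

definition torsion :: "'m chart set \<Rightarrow> 'm connection \<Rightarrow> ('m \<Rightarrow> vec) \<Rightarrow> ('m \<Rightarrow> vec) \<Rightarrow> 'm \<Rightarrow> vec" where
  "torsion \<A> D X Y p = D p (X p) Y - D p (Y p) X - lie_bracket \<A> X Y p"

text \<open>Extension of a tangent vector \<open>y\<close> at \<open>p\<close> to the coordinate field with constant components in
  \<open>chart_at \<A> p\<close>. The covariant derivatives of tensor fields below do not depend on the choice of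
  the extension.\<close>
definition extend :: "'m chart set \<Rightarrow> 'm \<Rightarrow> vec \<Rightarrow> 'm \<Rightarrow> vec" where
  "extend \<A> p y q = transition (chart_at \<A> p) (chart_at \<A> q) q y"

definition cov_deriv2 :: "'m chart set \<Rightarrow> 'm connection \<Rightarrow> ('m \<Rightarrow> vec \<Rightarrow> vec \<Rightarrow> real) \<Rightarrow>
    'm \<Rightarrow> vec \<Rightarrow> vec \<Rightarrow> vec \<Rightarrow> real" where
  "cov_deriv2 \<A> D g p x y z =
     dir_deriv \<A> p x (\<lambda>q. g q (extend \<A> p y q) (extend \<A> p z q))
     - g p (D p x (extend \<A> p y)) z - g p y (D p x (extend \<A> p z))"

definition cov_deriv4 :: "'m chart set \<Rightarrow> 'm connection \<Rightarrow> ('m \<Rightarrow> vec \<Rightarrow> vec \<Rightarrow> vec \<Rightarrow> vec \<Rightarrow> real) \<Rightarrow>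
    'm \<Rightarrow> vec \<Rightarrow> vec \<Rightarrow> vec \<Rightarrow> vec \<Rightarrow> vec \<Rightarrow> real" where
  "cov_deriv4 \<A> D K p x y z v w =
     dir_deriv \<A> p x (\<lambda>q. K q (extend \<A> p y q) (extend \<A> p z q) (extend \<A> p v q) (extend \<A> p w q))
     - K p (D p x (extend \<A> p y)) z v w - K p y (D p x (extend \<A> p z)) v w
     - K p y z (D p x (extend \<A> p v)) w - K p y z v (D p x (extend \<A> p w))"

definition cov_deriv_endo :: "'m chart set \<Rightarrow> 'm connection \<Rightarrow> ('m \<Rightarrow> endo) \<Rightarrow> 'm \<Rightarrow> vec \<Rightarrow> endo" where
  "cov_deriv_endo \<A> D J p x =
     matrix (\<lambda>y. D p x (\<lambda>q. J q *v extend \<A> p y q) - J p *v D p x (extend \<A> p y))"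

definition riemannian_metric :: "'m::topological_space chart set \<Rightarrow> ('m \<Rightarrow> vec \<Rightarrow> vec \<Rightarrow> real) \<Rightarrow> bool" where
  "riemannian_metric \<A> g \<longleftrightarrow> tensor2_field \<A> g \<and>
     (\<forall>p x y. g p x y = g p y x) \<and> (\<forall>p x. x \<noteq> 0 \<longrightarrow> g p x x > 0)"

definition is_levi_civita :: "'m::topological_space chart set \<Rightarrow> ('m \<Rightarrow> vec \<Rightarrow> vec \<Rightarrow> real) \<Rightarrow> 'm connection \<Rightarrow> bool" where
  "is_levi_civita \<A> g N \<longleftrightarrow> linear_connection \<A> N \<and>
     (\<forall>p x y z. cov_deriv2 \<A> N g p x y z = 0) \<and>
     (\<forall>U X Y. open U \<and> smooth_field \<A> U X \<and> smooth_field \<A> U Y \<longrightarrow> (\<forall>p\<in>U. torsion \<A> N X Y p = 0))"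

text \<open>By the fundamental theorem of Riemannian geometry the Levi-Civita connection exists and is
  unique up to \<open>same_connection\<close>, hence a choice operator and not a definite description.\<close>
definition levi_civita :: "'m::topological_space chart set \<Rightarrow> ('m \<Rightarrow> vec \<Rightarrow> vec \<Rightarrow> real) \<Rightarrow> 'm connection" where
  "levi_civita \<A> g = (SOME N. is_levi_civita \<A> g N)"

section \<open>Quaternionic structures and cubic discriminants\<close>

text \<open>Indices \<open>s = 1, 2, 3\<close> are the elements of the three-element type \<open>3\<close> (where \<open>3 = 0\<close>), and
  frames of a tangent space are indexed by the eight-element type \<open>8\<close>.\<close>

definition quaternionic_basis :: "(vec \<Rightarrow> vec \<Rightarrow> real) \<Rightarrow> endo set \<Rightarrow> (3 \<Rightarrow> endo) \<Rightarrow> bool" where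
  "quaternionic_basis g Q I \<longleftrightarrow> Q = span (range I) \<and>
     I 1 ** I 2 = I 3 \<and> I 2 ** I 1 = - I 3 \<and>
     (\<forall>s. I s ** I s = - mat 1) \<and> (\<forall>s x y. g (I s *v x) (I s *v y) = g x y)"

definition almost_quaternion_hermitian ::
    "'m::topological_space chart set \<Rightarrow> ('m \<Rightarrow> vec \<Rightarrow> vec \<Rightarrow> real) \<Rightarrow> ('m \<Rightarrow> endo set) \<Rightarrow> bool" where
  "almost_quaternion_hermitian \<A> g Q \<longleftrightarrow> riemannian_metric \<A> g \<and>
     (\<forall>p. \<exists>U I. open U \<and> p \<in> U \<and> (\<forall>s. smooth_endo \<A> U (I s)) \<and>
        (\<forall>q\<in>U. quaternionic_basis (g q) (Q q) (\<lambda>s. I s q)))"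

definition wedge22 :: "(vec \<Rightarrow> vec \<Rightarrow> real) \<Rightarrow> (vec \<Rightarrow> vec \<Rightarrow> real) \<Rightarrow> vec \<Rightarrow> vec \<Rightarrow> vec \<Rightarrow> vec \<Rightarrow> real" where
  "wedge22 \<alpha> \<beta> x y z w = \<alpha> x y * \<beta> z w - \<alpha> x z * \<beta> y w + \<alpha> x w * \<beta> y z
     + \<alpha> y z * \<beta> x w - \<alpha> y w * \<beta> x z + \<alpha> z w * \<beta> x y"

text \<open>The 4-form is the same for all quaternionic bases of \<open>Q\<close>.\<close>
definition fundamental_4form :: "(vec \<Rightarrow> vec \<Rightarrow> real) \<Rightarrow> endo set \<Rightarrow> vec \<Rightarrow> vec \<Rightarrow> vec \<Rightarrow> vec \<Rightarrow> real" where
  "fundamental_4form g Q x y z w = (let I = (SOME I. quaternionic_basis g Q I) in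
     \<Sum>s\<in>UNIV. wedge22 (\<lambda>u v. g (I s *v u) v) (\<lambda>u v. g (I s *v u) v) x y z w)"

definition quaternion_kaehler ::
    "'m::topological_space chart set \<Rightarrow> ('m \<Rightarrow> vec \<Rightarrow> vec \<Rightarrow> real) \<Rightarrow> ('m \<Rightarrow> endo set) \<Rightarrow> bool" where
  "quaternion_kaehler \<A> g Q \<longleftrightarrow> almost_quaternion_hermitian \<A> g Q \<and>
     (\<forall>p x y z v w. cov_deriv4 \<A> (levi_civita \<A> g) (\<lambda>q. fundamental_4form (g q) (Q q)) p x y z v w = 0)"

definition orthonormal_frame :: "(vec \<Rightarrow> vec \<Rightarrow> real) \<Rightarrow> (8 \<Rightarrow> vec) \<Rightarrow> bool" where
  "orthonormal_frame g h \<longleftrightarrow> (\<forall>a b. g (h a) (h b) = (if a = b then 1 else 0))"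

text \<open>Used only in sums that take the same value for every orthonormal frame.\<close>
definition frame :: "(vec \<Rightarrow> vec \<Rightarrow> real) \<Rightarrow> 8 \<Rightarrow> vec" where
  "frame g = (SOME h. orthonormal_frame g h)"

definition bracket :: "endo \<Rightarrow> endo \<Rightarrow> endo" where
  "bracket A B = A ** B - B ** A"

definition Bsp2 :: "(vec \<Rightarrow> vec \<Rightarrow> real) \<Rightarrow> endo set \<Rightarrow> endo set" where
  "Bsp2 g Q = {A. (\<forall>x y. g (A *v x) y = - g x (A *v y)) \<and> (\<forall>J\<in>Q. A ** J = J ** A)}"

definition RSp2 :: "(vec \<Rightarrow> vec \<Rightarrow> real) \<Rightarrow> endo set \<Rightarrow> (vec \<Rightarrow> vec \<Rightarrow> vec \<Rightarrow> vec \<Rightarrow> real) set" where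
  "RSp2 g Q = {K. multilinear4 K \<and>
     (\<forall>x y z w. K x y z w = - K y x z w \<and> K x y z w = - K x y w z) \<and>
     (\<forall>x y z w. K x y z w + K y z x w + K z x y w = 0) \<and>
     (\<forall>I s x y z w. quaternionic_basis g Q I \<longrightarrow> K x y (I s *v z) (I s *v w) = K x y z w)}"

text \<open>Expanding \<open>TK g K A x\<close> in the frame gives \<open>g (TK g K A x) y = 1/2 \<Sum>\<^sub>a K x y (h a) (A (h a))\<close>.\<close>
definition TK :: "(vec \<Rightarrow> vec \<Rightarrow> real) \<Rightarrow> (vec \<Rightarrow> vec \<Rightarrow> vec \<Rightarrow> vec \<Rightarrow> real) \<Rightarrow> endo \<Rightarrow> endo" where
  "TK g K A = (let h = frame g in
     matrix (\<lambda>x. \<Sum>b\<in>UNIV. (1/2 * (\<Sum>a\<in>UNIV. K x (h b) (h a) (A *v h a))) *\<^sub>R h b))"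

definition cubic_discriminants_at ::
    "(vec \<Rightarrow> vec \<Rightarrow> real) \<Rightarrow> endo set \<Rightarrow> (vec \<Rightarrow> vec \<Rightarrow> vec \<Rightarrow> vec \<Rightarrow> real) set" where
  "cubic_discriminants_at g Q = {K \<in> RSp2 g Q. let T = TK g K in
     (\<forall>A\<in>Bsp2 g Q. let B = 2 *\<^sub>R T A + 3 *\<^sub>R A in 2 *\<^sub>R T B - 7 *\<^sub>R B = 0) \<and>
     (\<forall>A\<in>Bsp2 g Q. \<forall>B\<in>Bsp2 g Q.
        bracket (T A) (T B) - T (bracket (T A) B) =
        (3/2) *\<^sub>R (T (bracket A B) - bracket A (T B)))}"

definition cubic_discriminant :: "'m::topological_space chart set \<Rightarrow> ('m \<Rightarrow> vec \<Rightarrow> vec \<Rightarrow> real) \<Rightarrow>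
    ('m \<Rightarrow> endo set) \<Rightarrow> ('m \<Rightarrow> vec \<Rightarrow> vec \<Rightarrow> vec \<Rightarrow> vec \<Rightarrow> real) \<Rightarrow> bool" where
  "cubic_discriminant \<A> g Q K \<longleftrightarrow> tensor4_field \<A> K \<and> (\<forall>p. K p \<in> cubic_discriminants_at (g p) (Q p))"

definition Bsp1_ir :: "(vec \<Rightarrow> vec \<Rightarrow> real) \<Rightarrow> endo set \<Rightarrow> (vec \<Rightarrow> vec \<Rightarrow> vec \<Rightarrow> vec \<Rightarrow> real) \<Rightarrow> endo set" where
  "Bsp1_ir g Q K = {A \<in> Bsp2 g Q. TK g K A = (7/2) *\<^sub>R A}"

definition sp1_generators :: "(vec \<Rightarrow> vec \<Rightarrow> real) \<Rightarrow> endo set \<Rightarrow> (vec \<Rightarrow> vec \<Rightarrow> vec \<Rightarrow> vec \<Rightarrow> real) \<Rightarrow>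
    (3 \<Rightarrow> endo) \<Rightarrow> bool" where
  "sp1_generators g Q K E \<longleftrightarrow> span (range E) = Bsp1_ir g Q K \<and>
     bracket (E 1) (E 2) = E 3 \<and> bracket (E 2) (E 3) = E 1 \<and> bracket (E 3) (E 1) = E 2"

definition holonomy_in_SO4_ir :: "'m::topological_space chart set \<Rightarrow> ('m \<Rightarrow> vec \<Rightarrow> vec \<Rightarrow> real) \<Rightarrow>
    ('m \<Rightarrow> endo set) \<Rightarrow> ('m \<Rightarrow> vec \<Rightarrow> vec \<Rightarrow> vec \<Rightarrow> vec \<Rightarrow> real) \<Rightarrow> 'm connection \<Rightarrow> bool" where
  "holonomy_in_SO4_ir \<A> g Q K D \<longleftrightarrow>
     (\<forall>p x y z. cov_deriv2 \<A> D g p x y z = 0) \<and>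
     (\<forall>U J. open U \<and> smooth_endo \<A> U J \<and> (\<forall>q\<in>U. J q \<in> Q q) \<longrightarrow>
        (\<forall>p\<in>U. \<forall>x. cov_deriv_endo \<A> D J p x \<in> Q p)) \<and>
     (\<forall>p x y z v w. cov_deriv4 \<A> D K p x y z v w = 0)"

definition t_tensor :: "'m::topological_space chart set \<Rightarrow> ('m \<Rightarrow> vec \<Rightarrow> vec \<Rightarrow> real) \<Rightarrow>
    ('m \<Rightarrow> vec \<Rightarrow> vec \<Rightarrow> vec \<Rightarrow> vec \<Rightarrow> real) \<Rightarrow> 'm \<Rightarrow> vec \<Rightarrow> vec \<Rightarrow> vec \<Rightarrow> real" where
  "t_tensor \<A> g K p x y z = (let h = frame (g p); DK = cov_deriv4 \<A> (levi_civita \<A> g) K p in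
     1/120 * (\<Sum>a\<in>UNIV. \<Sum>b\<in>UNIV. \<Sum>c\<in>UNIV.
       DK x y (h a) (h b) (h c) * K p z (h a) (h b) (h c)
       - DK x z (h a) (h b) (h c) * K p y (h a) (h b) (h c)))"

definition canonical_connection :: "'m::topological_space chart set \<Rightarrow> ('m \<Rightarrow> vec \<Rightarrow> vec \<Rightarrow> real) \<Rightarrow>
    ('m \<Rightarrow> vec \<Rightarrow> vec \<Rightarrow> vec \<Rightarrow> vec \<Rightarrow> real) \<Rightarrow> 'm connection" where
  "canonical_connection \<A> g K p x Y = levi_civita \<A> g p x Y
     + (\<Sum>a\<in>UNIV. t_tensor \<A> g K p x (Y p) (frame (g p) a) *\<^sub>R frame (g p) a)"

end

theory Submission
  imports Defs
begin

text \<open>The connection \<open>D - d\<close> is metric and torsion-free, so it is the Levi-Civita connection (whose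
  existence is thereby obtained from \<open>D\<close>). Since \<open>d x\<close> commutes with the quaternionic
  structure, \<open>D - d\<close> preserves it too, which makes the 4-form parallel; and \<open>\<nabla> K\<close> is the action
  of \<open>d\<close> on \<open>K\<close>. It remains to recover \<open>d x\<close>, an element \<open>A\<close> of \<open>Bsp2\<close> orthogonal to the
  7/2-eigenspace \<open>V\<close> of \<open>T\<close>, from its action on \<open>K\<close>. The quadratic equation for \<open>T\<close> gives
  \<open>K = 10 \<Sum>e \<otimes> e - 3 \<pi>\<close> for an orthonormal basis of \<open>V\<close>, where \<open>\<pi>\<close> is \<open>Sp(2)\<close>-invariant. The Bianchi
  identity for \<open>K\<close> then yields \<open>\<Sum>e e = -3/8\<close>, whence \<open>dim V = 3\<close>, and shows that the Casimir
  operator \<open>\<Sum>[e, [e, A]]\<close> is \<open>-6/5\<close> on the complement of \<open>V\<close> and \<open>-1/5\<close> on \<open>V\<close>. The latter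
  makes the subalgebra \<open>V\<close> non-abelian, so that it has generators with the relations of \<open>sp(1)\<close> and
  the orthogonality hypothesis on \<open>d\<close> is not vacuous; the former gives the constant 1/120.\<close>

section \<open>Algebra of a tangent space\<close>

text \<open>The conditions on a discriminant do not mention the dimension of \<open>V\<close>, while
  \<open>d_orthogonal\<close> speaks only of triples with the \<open>sp(1)\<close> relations; this
  is why such a triple has to be constructed. The argument can start because \<open>T\<close> and
  \<open>K\<close> determine each other: the quadratic equation leaves \<open>V\<close> as the only
  unknown in \<open>K\<close>, and the Bianchi identity becomes an equation for an orthonormal basis
  of \<open>V\<close>. The constant 120 is 10 times (7 + 3) times 6/5: 10 is the coefficient in
  \<open>K\<close>, 7 and -3 are twice the eigenvalues of \<open>T\<close>, and 6/5 comes from the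
  Casimir operator. On the manifold the obstacle is that a tangent vector at \<open>p\<close> is
  written in \<open>chart_at \<A> p\<close>, a chart that may jump from point to point. Derivatives
  are therefore taken in the chart of the base point, and operators are reduced to coordinate fields
  by tensoriality. Objects obtained by choice are handled in different ways: the Levi-Civita
  connection by uniqueness, the basis inside the 4-form by independence of the basis, and
  \<open>frame\<close> by working in that very frame.\<close>

lemma exists_orthonormal_frame:
  fixes g :: "vec \<Rightarrow> vec \<Rightarrow> real"
  assumes lin_l: "\<And>y. linear (\<lambda>x. g x y)" and lin_r: "\<And>x. linear (\<lambda>y. g x y)"
    and sym: "\<And>x y. g x y = g y x" and pos: "\<And>x. x \<noteq> 0 \<Longrightarrow> g x x > 0"
  shows "\<exists>h. orthonormal_frame g h"
proof -
  have "\<exists>h. \<forall>a\<in>S. \<forall>b\<in>S. g (h a) (h b) = (if a = b then 1 else 0)" for S :: "8 set"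
  proof (induction S rule: finite_induct[OF finite])
    case 1
    then show ?case by simp
  next
    case (2 c S)
    then obtain h where h: "\<And>a b. a \<in> S \<Longrightarrow> b \<in> S \<Longrightarrow> g (h a) (h b) = (if a = b then 1 else 0)" by blast
    \<comment> \<open>Gram-Schmidt: as \<open>c\<close> is not in \<open>S\<close>, fewer than eight
      vectors are in use, so some \<open>v\<close> lies outside their span; \<open>v\<close> minus
      its components is then normalised.\<close>
    have "dim (span (h ` S)) \<le> card (h ` S)" by (simp add: dim_le_card' finite_imageI)
    also have "\<dots> \<le> card S" by (simp add: card_image_le)
    also have "\<dots> < card (insert c S)" using 2 by simp
    also have "\<dots> \<le> card (UNIV :: 8 set)" by (intro card_mono) auto
    also have "\<dots> = dim (UNIV :: vec set)" by simp
    finally obtain v where v: "v \<notin> span (h ` S)" by (metis UNIV_eq_I less_irrefl)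
    define w where "w = v - (\<Sum>a\<in>S. g v (h a) *\<^sub>R h a)"
    have "w \<noteq> 0"
    proof
      assume "w = 0"
      then have "v = (\<Sum>a\<in>S. g v (h a) *\<^sub>R h a)" unfolding w_def by simp
      then show False using v
        by (metis (mono_tags, lifting) image_eqI span_base span_scale span_sum)
    qed
    then have w0: "g w w > 0" by (rule pos)
    have wh: "g w (h b) = 0" if "b \<in> S" for b
    proof -
      interpret l: linear "\<lambda>x. g x (h b)" by (rule lin_l)
      have "g w (h b) = g v (h b) - (\<Sum>a\<in>S. g v (h a) * g (h a) (h b))"
        unfolding w_def by (simp add: l.diff l.sum l.scale)
      also have "(\<Sum>a\<in>S. g v (h a) * g (h a) (h b)) = (\<Sum>a\<in>S. if a = b then g v (h b) else 0)"
        using h that by (intro sum.cong) auto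
      also have "\<dots> = g v (h b)" using that by simp
      finally show ?thesis by simp
    qed
    define u where "u = (1 / sqrt (g w w)) *\<^sub>R w"
    have uu: "g u u = 1"
      unfolding u_def using linear_scale[OF lin_l] linear_scale[OF lin_r] w0 by simp
    have uh: "g u (h b) = 0" if "b \<in> S" for b
      unfolding u_def using linear_scale[OF lin_l] wh[OF that] by simp
    have hu: "g (h b) u = 0" if "b \<in> S" for b
      using uh[OF that] sym by simp
    show ?case
      by (rule exI[of _ "h(c := u)"]) (use 2 h uu uh hu in auto)
  qed
  from this[of UNIV] show ?thesis by (auto simp: orthonormal_frame_def)
qed

section \<open>Orthonormal frames and the trace form on endomorphisms\<close>

locale frame8 =
  fixes g :: "vec \<Rightarrow> vec \<Rightarrow> real" and h :: "8 \<Rightarrow> vec"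
  assumes lin_l: "\<And>y. linear (\<lambda>x. g x y)" and lin_r: "\<And>x. linear (\<lambda>y. g x y)"
    and sym: "\<And>x y. g x y = g y x" and onf: "orthonormal_frame g h"
begin

lemma frame_inner: "g (h a) (h b) = (if a = b then 1 else 0)"
  using onf by (simp add: orthonormal_frame_def)

lemmas g_l = linear_add[OF lin_l] linear_diff[OF lin_l] linear_neg[OF lin_l] linear_scale[OF lin_l]
  linear_0[OF lin_l]
lemmas g_r = linear_add[OF lin_r] linear_diff[OF lin_r] linear_neg[OF lin_r] linear_scale[OF lin_r]
  linear_0[OF lin_r]
lemmas g_sum = linear_sum[OF lin_l] linear_sum[OF lin_r]

text \<open>Orthonormality forces independence, and eight independent vectors span; pairing with
  \<open>h b\<close> identifies the coefficients.\<close>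

lemma frame_expansion: "x = (\<Sum>a\<in>UNIV. g x (h a) *\<^sub>R h a)"
proof -
  have inj: "inj h" by (rule injI) (metis frame_inner zero_neq_one)
  have coeff: "u b = 0" if "(\<Sum>a\<in>UNIV. u a *\<^sub>R h a) = 0" for u b
  proof -
    have "0 = g (\<Sum>a\<in>UNIV. u a *\<^sub>R h a) (h b)" using that by (simp add: g_l)
    also have "\<dots> = u b" by (simp add: g_sum g_l frame_inner if_distrib cong: if_cong)
    finally show ?thesis by simp
  qed
  have "independent (range h)"
    unfolding independent_explicit
  proof (intro conjI allI impI ballI)
    show "finite (range h)" by simp
    fix c v assume *: "(\<Sum>v\<in>range h. c v *\<^sub>R v) = 0" and "v \<in> range h"
    then obtain b where b: "v = h b" by auto
    have "(\<Sum>a\<in>UNIV. c (h a) *\<^sub>R h a) = 0" using * by (simp add: sum.reindex[OF inj])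
    from coeff[OF this] show "c v = 0" using b by simp
  qed
  moreover have "card (range h) = dim (UNIV :: vec set)" by (simp add: card_image[OF inj])
  ultimately have sp: "span (range h) = UNIV"
    using card_eq_dim[of "range h" UNIV] by auto
  have "x \<in> range (\<lambda>u. \<Sum>v\<in>range h. u v *\<^sub>R v)"
    using sp span_finite[of "range h"] by simp
  then obtain u where x: "x = (\<Sum>a\<in>UNIV. u (h a) *\<^sub>R h a)" by (auto simp: sum.reindex[OF inj])
  have "g x (h b) = u (h b)" for b
    by (subst x) (simp add: g_sum g_l frame_inner if_distrib cong: if_cong)
  then show ?thesis using x by simp
qed

lemma g_eqI: "(\<And>y. g x y = g x' y) \<Longrightarrow> x = x'"
  by (metis (no_types, lifting) frame_expansion sum.cong)

text \<open>The frame expansion pushed through a linear functional. Sums over a frame index are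
  eliminated this way; the four versions differ only in the order of the factors and of the
  arguments of \<open>g\<close>.\<close>

lemma contract:
  assumes "linear (f :: vec \<Rightarrow> real)"
  shows "(\<Sum>a\<in>UNIV. g x (h a) * f (h a)) = f x" "(\<Sum>a\<in>UNIV. f (h a) * g x (h a)) = f x"
    "(\<Sum>a\<in>UNIV. g (h a) x * f (h a)) = f x" "(\<Sum>a\<in>UNIV. f (h a) * g (h a) x) = f x"
proof -
  have "f x = f (\<Sum>a\<in>UNIV. g x (h a) *\<^sub>R h a)" using frame_expansion[of x] by simp
  also have "\<dots> = (\<Sum>a\<in>UNIV. g x (h a) * f (h a))"
    using assms by (simp add: linear_sum linear_scale)
  finally show 1: "(\<Sum>a\<in>UNIV. g x (h a) * f (h a)) = f x" by simp
  then show "(\<Sum>a\<in>UNIV. f (h a) * g x (h a)) = f x" by (simp add: mult.commute)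
  from 1 show "(\<Sum>a\<in>UNIV. g (h a) x * f (h a)) = f x" "(\<Sum>a\<in>UNIV. f (h a) * g (h a) x) = f x"
    by (simp_all add: mult.commute sym)
qed

lemma endo_eqI: "(\<And>x y. g (A *v x) y = g (B *v x) y) \<Longrightarrow> (A::endo) = B"
  by (metis g_eqI matrix_eq)

lemma uminus_mv: "(- A) *v x = - (A *v (x :: vec))" for A :: endo
  using scaleR_matrix_vector_assoc[of "-1" A x] by simp

lemma linear_g_mv:
  fixes A :: endo
  shows "linear (\<lambda>x. g (A *v x) y)" "linear (\<lambda>x. g y (A *v x))"
  using linear_compose[OF matrix_vector_mul_linear lin_l] linear_compose[OF
      matrix_vector_mul_linear lin_r]
  by (auto simp: o_def)

lemma linear_g_mv2:
  fixes A B :: endo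
  shows "linear (\<lambda>x. g (A *v (B *v x)) y)" "linear (\<lambda>x. g y (A *v (B *v x)))"
  using linear_g_mv[where A = "A ** B"] by (auto simp: matrix_vector_mul_assoc)

definition skew :: "endo \<Rightarrow> bool" where
  "skew A \<longleftrightarrow> (\<forall>x y. g (A *v x) y = - g x (A *v y))"

text \<open>The Hilbert-Schmidt inner product. For skew \<open>B\<close> it is minus the trace of
  \<open>B ** A\<close>, which makes it invariant under brackets.\<close>

definition ip :: "endo \<Rightarrow> endo \<Rightarrow> real" where
  "ip A B = (\<Sum>a\<in>UNIV. g (A *v h a) (B *v h a))"

definition tr :: "endo \<Rightarrow> real" where
  "tr A = (\<Sum>a\<in>UNIV. g (A *v h a) (h a))"

lemma skewD: "skew A \<Longrightarrow> g (A *v x) y = - g x (A *v y)"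
  by (simp add: skew_def)

lemma tr_mult_commute: "tr (A ** B) = tr (B ** A)"
proof -
  have *: "tr (A ** B) = (\<Sum>a\<in>UNIV. \<Sum>b\<in>UNIV. g (B *v h a) (h b) * g (A *v h b) (h a))" for A B
    unfolding tr_def by (intro sum.cong refl, subst contract(1)[OF linear_g_mv(1)])
      (simp add: matrix_vector_mul_assoc)
  show ?thesis unfolding * by (subst sum.swap) (simp add: mult.commute)
qed

lemma tr_skew: "skew A \<Longrightarrow> tr A = 0"
proof -
  assume "skew A"
  then have "g (A *v h a) (h a) = 0" for a using sym skewD[of A "h a" "h a"] by simp
  then show ?thesis by (simp add: tr_def)
qed

lemma tr_linear: "tr (A + B) = tr A + tr B" "tr (A - B) = tr A - tr B" "tr (c *\<^sub>R A) = c * tr A"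
    "tr (- A) = - tr A"
proof -
  show 1: "tr (A + B) = tr A + tr B" for A B
    by (simp add: tr_def matrix_vector_mult_add_rdistrib g_l sum.distrib)
  show 2: "tr (c *\<^sub>R A) = c * tr A" for c A
    by (simp add: tr_def scaleR_matrix_vector_assoc[symmetric] g_l sum_distrib_left)
  show 3: "tr (- A) = - tr A" for A using 2[of "-1" A] by simp
  show "tr (A - B) = tr A - tr B" using 1[of A "-B"] 3[of B] by simp
qed

lemma ip_commute: "ip A B = ip B A"
proof -
  have "g (A *v h a) (B *v h a) = g (B *v h a) (A *v h a)" for a by (rule sym)
  then show ?thesis unfolding ip_def by (rule sum.cong[OF refl])
qed

lemma ip_linear: "ip (A + B) C = ip A C + ip B C" "ip (c *\<^sub>R A) C = c * ip A C"
    "ip C (A + B) = ip C A + ip C B" "ip C (c *\<^sub>R A) = c * ip C A"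
  by (simp_all add: ip_def matrix_vector_mult_add_rdistrib g_l g_r sum.distrib
      scaleR_matrix_vector_assoc[symmetric] sum_distrib_left)

lemma ip_sum: "ip C (\<Sum>i\<in>S. f i) = (\<Sum>i\<in>S. ip C (f i))"
proof -
  have "linear (ip C)" by (rule linearI) (simp_all add: ip_linear)
  then show ?thesis by (rule linear_sum)
qed

lemma ip_eq_0: "ip A A = 0 \<Longrightarrow> A = 0" if pos: "\<And>x. g x x \<ge> 0"
proof -
  assume "ip A A = 0"
  then have "g (A *v h a) (A *v h a) = 0" for a
    unfolding ip_def using sum_nonneg_eq_0_iff[of UNIV "\<lambda>a. g (A *v h a) (A *v h a)"] pos by auto
  moreover have "x = 0" if "g x x = 0" for x
  proof -
    have "g x x = (\<Sum>a\<in>UNIV. (g x (h a))^2)"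
      using contract(1)[OF lin_r, of x x] by (simp add: power2_eq_square)
    with that have "g x (h a) = 0" for a
      using sum_nonneg_eq_0_iff[of UNIV "\<lambda>a. (g x (h a))^2"] by auto
    then show ?thesis using frame_expansion[of x] by simp
  qed
  ultimately have "A *v h a = 0" for a by blast
  then have "A *v x = 0" for x
    by (subst frame_expansion[of x])
      (simp add: linear_sum[OF matrix_vector_mul_linear] linear_scale[OF matrix_vector_mul_linear])
  then show "A = 0" by (simp add: matrix_eq)
qed

lemma g_nonneg: "g x x \<ge> 0"
  using contract(1)[OF lin_r, of x x] by (metis sum_nonneg zero_le_square)

lemmas ip_zeroD = ip_eq_0[OF g_nonneg]

lemma ip_skew: "skew B \<Longrightarrow> ip A B = - tr (B ** A)"
proof -
  assume "skew B"
  then have "g (A *v h a) (B *v h a) = - g ((B ** A) *v h a) (h a)" for a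
    using skewD[of B "A *v h a" "h a"] by (simp add: matrix_vector_mul_assoc[symmetric])
  then show ?thesis by (simp add: ip_def tr_def sum_negf)
qed

text \<open>\<open>\<Phi>\<close> records the coefficients of an endomorphism in the frame
  \<open>h\<close>. It turns \<open>ip\<close> into the standard inner product of matrices, for
  which orthonormal bases of subspaces are available, and the basis is pulled back.\<close>

lemma ip_orthonormal_basis:
  assumes "subspace V"
  obtains B where "finite B" "B \<subseteq> V" "span B = V"
    "\<And>e f. e \<in> B \<Longrightarrow> f \<in> B \<Longrightarrow> ip e f = (if e = f then 1 else 0)"
    "\<And>A. A \<in> V \<Longrightarrow> A = (\<Sum>e\<in>B. ip e A *\<^sub>R e)"
proof -
  define \<Phi> :: "endo \<Rightarrow> endo" where "\<Phi> A = (\<chi> a b. g (A *v h a) (h b))" for A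
  have lin: "linear \<Phi>"
    by (rule linearI) (simp_all add: \<Phi>_def vec_eq_iff matrix_vector_mult_add_rdistrib g_l
        scaleR_matrix_vector_assoc[symmetric])
  have inner: "\<Phi> A \<bullet> \<Phi> B = ip A B" for A B
    unfolding \<Phi>_def
    by (simp add: inner_vec_def contract[OF lin_r]) (subst ip_commute, simp only: ip_def)
  have "inj \<Phi>"
    by (rule linear_injective_0[THEN
        iffD2, OF lin, rule_format]) (metis inner inner_zero_left ip_zeroD)
  have sub: "subspace (\<Phi> ` V)" using assms lin by (rule linear_subspace_image[rotated])
  obtain C where C: "C \<subseteq> \<Phi> ` V" "pairwise orthogonal C" "\<And>x. x \<in> C \<Longrightarrow> norm x = 1"
    "independent C" "span C = \<Phi> ` V"
    using orthonormal_basis_subspace[OF sub] by metis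
  define B where "B = {A\<in>V. \<Phi> A \<in> C}"
  have BC: "\<Phi> ` B = C" using C(1) by (auto simp: B_def)
  have injB: "inj_on \<Phi> B" using \<open>inj \<Phi>\<close> by (rule inj_on_subset) simp
  have fin: "finite B" using BC injB C(4) by (metis finite_imageD independent_imp_finite)
  have sp: "span B = V"
  proof -
    have "\<Phi> ` span B = \<Phi> ` V" using linear_span_image[OF lin, of B] BC C(5) by simp
    then show ?thesis using \<open>inj \<Phi>\<close> by (simp add: inj_image_eq_iff)
  qed
  have on: "ip e f = (if e = f then 1 else 0)" if "e \<in> B" "f \<in> B" for e f
  proof (cases "e = f")
    case True
    have "norm (\<Phi> e) = 1" using that C(3) by (auto simp: B_def)
    then have "\<Phi> e \<bullet> \<Phi> e = 1" by (simp add: norm_eq_1)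
    then show ?thesis using True inner[of e e] by simp
  next
    case False
    then have "\<Phi> e \<noteq> \<Phi> f" using \<open>inj \<Phi>\<close> by (simp add: inj_eq)
    then have "\<Phi> e \<bullet> \<Phi> f = 0" using that C(2) unfolding B_def pairwise_def orthogonal_def by blast
    then show ?thesis using False by (simp add: inner)
  qed
  have ex: "A = (\<Sum>e\<in>B. ip e A *\<^sub>R e)" if "A \<in> V" for A
  proof -
    have "A \<in> range (\<lambda>u. \<Sum>e\<in>B. u e *\<^sub>R e)" using that sp span_finite[OF fin] by simp
    then obtain u where u: "A = (\<Sum>e\<in>B. u e *\<^sub>R e)" by blast
    have "ip f A = u f" if "f \<in> B" for f
    proof -
      have "ip f A = (\<Sum>e\<in>B. u e * ip f e)" unfolding u by (simp add: ip_sum ip_linear)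
      also have "\<dots> = (\<Sum>e\<in>B. if e = f then u f else 0)" using on that by (intro sum.cong) auto
      finally show ?thesis using that fin by simp
    qed
    then show ?thesis using u by (metis (no_types, lifting) sum.cong)
  qed
  show thesis using that[of B] fin sp on ex C(1) span_superset[of B] by (auto simp: B_def)
qed

end

section \<open>The quaternionic structure and the projection of bivectors to
  \<open>Bsp2\<close>\<close>

locale quat8 = frame8 +
  fixes Q :: "endo set" and I :: "3 \<Rightarrow> endo"
  assumes qb: "quaternionic_basis g Q I"
begin

lemma I_mv: "I 1 *v (I 2 *v x) = I 3 *v x" "I 2 *v (I 1 *v x) = - (I 3 *v x)"
  "I s *v (I s *v x) = - x"
proof -
  have "I 1 ** I 2 = I 3" "I 2 ** I 1 = - I 3" "I s ** I s = - mat 1"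
    using qb by (auto simp: quaternionic_basis_def)
  then show "I 1 *v (I 2 *v x) = I 3 *v x" "I 2 *v (I 1 *v x) = - (I 3 *v x)"
    "I s *v (I s *v x) = - x"
    by (simp_all add: matrix_vector_mul_assoc uminus_mv)
qed

lemma mv_neg: "(A::endo) *v (- x) = - (A *v x)"
  by (rule linear_neg[OF matrix_vector_mul_linear])

lemma I_mv': "I 1 *v (I 3 *v x) = - (I 2 *v x)" "I 3 *v (I 1 *v x) = I 2 *v x"
  "I 2 *v (I 3 *v x) = I 1 *v x" "I 3 *v (I 2 *v x) = - (I 1 *v x)"
proof -
  show "I 1 *v (I 3 *v x) = - (I 2 *v x)" by (simp flip: I_mv(1) add: I_mv(3))
  show "I 3 *v (I 2 *v x) = - (I 1 *v x)" by (simp flip: I_mv(1) add: I_mv(3) mv_neg)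
  have "I 2 *v (- (I 3 *v x)) = I 2 *v (I 2 *v (I 1 *v x))" by (simp add: I_mv(2))
  then show "I 2 *v (I 3 *v x) = I 1 *v x" by (simp add: I_mv(3) mv_neg)
  have "- (I 3 *v (I 1 *v x)) = I 2 *v (I 1 *v (I 1 *v x))" by (simp add: I_mv(2))
  then show "I 3 *v (I 1 *v x) = I 2 *v x" by (simp add: I_mv(3) mv_neg)
qed

lemmas I_simps = I_mv I_mv' mv_neg

lemma g_I: "g (I s *v x) (I s *v y) = g x y"
  using qb by (simp add: quaternionic_basis_def)

lemma g_I_left: "g (I s *v x) y = - g x (I s *v y)"
  using g_I[of s x "I s *v y"] by (simp add: I_simps g_r)

lemma g_I_right: "g x (I s *v y) = - g (I s *v x) y"
  by (simp add: g_I_left)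

lemma skew_I: "skew (I s)"
  by (simp add: skew_def g_I_left)

lemma Bsp2_iff: "A \<in> Bsp2 g Q \<longleftrightarrow> skew A \<and> (\<forall>s x. A *v (I s *v x) = I s *v (A *v x))"
proof -
  have Q: "Q = span (range I)" using qb by (simp add: quaternionic_basis_def)
  have "(\<forall>J\<in>Q. A ** J = J ** A) \<longleftrightarrow> (\<forall>s. A ** I s = I s ** A)"
  proof
    assume *: "\<forall>s. A ** I s = I s ** A"
    show "\<forall>J\<in>Q. A ** J = J ** A"
    proof
      fix J assume "J \<in> Q"
      then have "J \<in> span (range I)" using Q by simp
      then show "A ** J = J ** A"
      proof (induction rule: span_induct_alt)
        case base
        then show ?case by (simp add: matrix_eq matrix_vector_mul_assoc[symmetric])
      next
        case (step c x y)
        then show ?case using *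
          by (auto simp: matrix_eq matrix_vector_mul_assoc[symmetric]
              matrix_vector_mult_add_rdistrib
            matrix_vector_right_distrib scaleR_matrix_vector_assoc[symmetric]
                matrix_vector_mult_scaleR)
      qed
    qed
  qed (auto simp: Q span_base)
  moreover have "A ** I s = I s ** A \<longleftrightarrow> (\<forall>x. A *v (I s *v x) = I s *v (A *v x))" for s
    by (simp add: matrix_eq matrix_vector_mul_assoc)
  ultimately show ?thesis by (simp add: Bsp2_def skew_def)
qed

lemma Bsp2_skew: "A \<in> Bsp2 g Q \<Longrightarrow> skew A"
  by (simp add: Bsp2_iff)

lemma Bsp2_I: "A \<in> Bsp2 g Q \<Longrightarrow> A *v (I s *v x) = I s *v (A *v x)"
  by (simp add: Bsp2_iff)

lemma subspace_Bsp2: "subspace (Bsp2 g Q)"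
proof (rule subspaceI)
  show "0 \<in> Bsp2 g Q" by (simp add: Bsp2_iff skew_def g_l g_r)
next
  fix A B assume "A \<in> Bsp2 g Q" "B \<in> Bsp2 g Q"
  then show "A + B \<in> Bsp2 g Q"
    by (simp add: Bsp2_iff skew_def matrix_vector_mult_add_rdistrib g_l g_r
        matrix_vector_right_distrib)
next
  fix c A assume "A \<in> Bsp2 g Q"
  then show "c *\<^sub>R A \<in> Bsp2 g Q"
    by (simp add: Bsp2_iff skew_def scaleR_matrix_vector_assoc[symmetric] g_l g_r
        matrix_vector_mult_scaleR)
qed

lemma bracket_mv: "bracket A B *v x = A *v (B *v x) - B *v (A *v x)"
  by (simp add: bracket_def matrix_vector_mult_diff_rdistrib matrix_vector_mul_assoc)

lemma bracket_Bsp2: "A \<in> Bsp2 g Q \<Longrightarrow> B \<in> Bsp2 g Q \<Longrightarrow> bracket A B \<in> Bsp2 g Q"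
  by (auto simp: Bsp2_iff bracket_mv skew_def g_l g_r matrix_vector_mult_diff_distrib)

text \<open>Cyclicity of the trace. This makes the structure constants of \<open>V\<close> totally
  skew and carries orthogonality to \<open>V\<close> over from \<open>A\<close> to
  \<open>bracket A e\<close>.\<close>

lemma ip_bracket:
  assumes "skew A" "skew B" "skew C"
  shows "ip (bracket A B) C = ip A (bracket B C)"
proof -
  have sub: "X ** (Y - Z) = X ** Y - X ** Z" "(Y - Z) ** X = Y ** X - Z ** X" for X Y Z :: endo
    by (simp_all add: matrix_eq matrix_vector_mul_assoc[symmetric] matrix_vector_mult_diff_rdistrib
        matrix_vector_mult_diff_distrib)
  have sk: "skew (bracket B C)"
    using assms unfolding skew_def by (simp add: bracket_mv g_l g_r)
  have "ip (bracket A B) C = - (tr (C ** (A ** B)) - tr (C ** (B ** A)))"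
    using assms by (simp add: ip_skew bracket_def sub tr_linear)
  also have "tr (C ** (A ** B)) = tr (B ** C ** A)"
    using tr_mult_commute[of "C ** A" B] by (simp add: matrix_mul_assoc)
  also have "tr (C ** (B ** A)) = tr (C ** B ** A)" by (simp add: matrix_mul_assoc)
  also have "- (tr (B ** C ** A) - tr (C ** B ** A)) = ip A (bracket B C)"
    using sk by (simp add: ip_skew bracket_def sub tr_linear)
  finally show ?thesis .
qed

lemma tr_I_I: "tr (I s ** I t) = (if s = t then - 8 else 0)"
proof -
  have "tr (I s) = 0" for s by (rule tr_skew[OF skew_I])
  moreover have "tr (mat 1) = 8" by (simp add: tr_def frame_inner)
  moreover have "I s ** I s = - mat 1" for s using qb by (simp add: quaternionic_basis_def)
  moreover have "I 1 ** I 2 = I 3" "I 2 ** I 1 = - I 3" "I 1 ** I 3 = - I 2" "I 3 ** I 1 = I 2"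
     "I 2 ** I 3 = I 1" "I 3 ** I 2 = - I 1"
    by (simp_all add: matrix_eq matrix_vector_mul_assoc[symmetric] I_simps uminus_mv)
  ultimately show ?thesis
    using exhaust_3[of s] exhaust_3[of t] by (auto simp: tr_linear)
qed

text \<open>\<open>I s\<close> is a product of two anticommuting units, and \<open>A\<close>
  commutes with both; rotating the trace turns it into its own negative. So \<open>Bsp2\<close> is
  orthogonal to \<open>Q\<close>.\<close>

lemma tr_I_Bsp2:
  assumes "A \<in> Bsp2 g Q" shows "tr (I s ** A) = 0"
proof -
  have *: "tr (I s ** A) = 0" if "\<And>x. I s *v x = I u *v (I v *v x)"
      "\<And>x. I v *v (I u *v x) = - (I s *v x)"
    for u v
  proof -
    have 1: "I s = I u ** I v" "I v ** I u = - I s"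
      using that by (simp_all add: matrix_eq matrix_vector_mul_assoc[symmetric] uminus_mv)
    have "tr (I s ** A) = tr (I u ** (I v ** A))" using 1 by (simp add: matrix_mul_assoc)
    also have "\<dots> = tr (I v ** A ** I u)" by (rule tr_mult_commute)
    also have "I v ** A ** I u = I v ** I u ** A"
      using Bsp2_I[OF assms] by (simp add: matrix_eq matrix_vector_mul_assoc[symmetric])
    also have "\<dots> = - (I s ** A)" using 1
      by (simp add: matrix_eq matrix_vector_mul_assoc[symmetric] uminus_mv)
    finally show ?thesis by (simp add: tr_linear)
  qed
  show ?thesis
    using exhaust_3[of s] *[of 2 3] *[of 3 1] *[of 1 2] by (auto simp: I_simps)
qed

text \<open>The bivector \<open>N z\<close> wedge \<open>N w\<close> evaluated on \<open>x\<close>,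
  \<open>y\<close>. Being quadratic in \<open>N\<close>, it is blind to the signs in the products of
  the \<open>I s\<close>.\<close>

definition pair_form :: "endo \<Rightarrow> vec \<Rightarrow> vec \<Rightarrow> vec \<Rightarrow> vec \<Rightarrow> real" where
  "pair_form N x y z w = g (N *v z) x * g (N *v w) y - g (N *v w) x * g (N *v z) y"

text \<open>Up to the factor 1/4, \<open>proj_form\<close> is the orthogonal projection of \<open>\<Lambda>\<^sup>2\<close> onto the 2-forms of
  \<open>Bsp2\<close>, written as the average over conjugation by \<open>1, I 1, I 2, I 3\<close>; \<open>sp2_part z w\<close> is the
  corresponding projection of \<open>z \<and> w\<close>, read as a skew endomorphism.\<close>
definition proj_form :: "vec \<Rightarrow> vec \<Rightarrow> vec \<Rightarrow> vec \<Rightarrow> real" where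
  "proj_form x y z w = pair_form (mat 1) x y z w + (\<Sum>s\<in>UNIV. pair_form (I s) x y z w)"

definition wedge_endo :: "endo \<Rightarrow> vec \<Rightarrow> vec \<Rightarrow> endo" where
  "wedge_endo N z w = matrix (\<lambda>u. g (N *v z) u *\<^sub>R (N *v w) - g (N *v w) u *\<^sub>R (N *v z))"

definition sp2_part :: "vec \<Rightarrow> vec \<Rightarrow> endo" where
  "sp2_part z w = (1/4) *\<^sub>R (wedge_endo (mat 1) z w + (\<Sum>s\<in>UNIV. wedge_endo (I s) z w))"

lemma wedge_endo_mv: "wedge_endo N z w *v u = g (N *v z) u *\<^sub>R (N *v w) - g (N *v w) u *\<^sub>R (N *v z)"
proof -
  have "linear (\<lambda>u. g (N *v z) u *\<^sub>R (N *v w) - g (N *v w) u *\<^sub>R (N *v z))"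
    by (rule linearI) (simp_all add: g_r algebra_simps)
  from matrix_works[of "\<lambda>u. g (N *v z) u *\<^sub>R (N *v w) - g (N *v w) u *\<^sub>R (N *v z)" u]
    this show ?thesis by (simp add: wedge_endo_def linear_matrix_vector_mul_eq)
qed

lemma sp2_part_mv: "sp2_part z w *v u = (1/4) *\<^sub>R (wedge_endo (mat 1) z w *v u
    + (\<Sum>s\<in>UNIV. wedge_endo (I s) z w *v u))"
  by (simp add: sp2_part_def scaleR_matrix_vector_assoc[symmetric] matrix_vector_mult_add_rdistrib
      sum_3)

lemma g_sp2_part: "g (sp2_part z w *v x) y = (1/4) * proj_form x y z w"
  by (simp add: sp2_part_mv wedge_endo_mv proj_form_def pair_form_def g_l g_sum sum_subtractf)

lemma sp2_part_Bsp2: "sp2_part z w \<in> Bsp2 g Q"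
  unfolding Bsp2_iff skew_def
proof (intro conjI allI)
  fix x y
  show "g (sp2_part z w *v x) y = - g x (sp2_part z w *v y)"
    unfolding sym[of x "sp2_part z w *v y"] g_sp2_part proj_form_def pair_form_def
        by (simp add: sum_3 field_simps)
next
  fix s x
  \<comment> \<open>Moving \<open>I s\<close> from \<open>x\<close>, \<open>y\<close> to the other
    side of \<open>g\<close> multiplies the operators \<open>1, I 1, I 2, I 3\<close> by a unit,
    which permutes them up to sign.\<close>
  have inv: "proj_form (I s *v x) (I s *v y) z w = proj_form x y z w" for x y
    using exhaust_3[of s]
    by (auto simp: proj_form_def pair_form_def sum_3 g_I_right I_simps g_l)
  show "sp2_part z w *v (I s *v x) = I s *v (sp2_part z w *v x)"
  proof (rule g_eqI)
    fix y
    \<comment> \<open>Invariance evaluated at \<open>I s y\<close> becomes commutation, because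
      \<open>I s\<close> squares to -1.\<close>
    have "g (sp2_part z w *v (I s *v x)) (I s *v (I s *v y)) = g (sp2_part z w *v x) (I s *v y)"
      by (simp add: g_sp2_part inv)
    then show "g (sp2_part z w *v (I s *v x)) y = g (I s *v (sp2_part z w *v x)) y"
      by (simp add: I_simps g_I_left g_r)
  qed
qed

text \<open>All four terms of the average pair equally with \<open>A\<close>, because
  \<open>A\<close> commutes with the isometries \<open>I s\<close>: projecting \<open>z\<close>
  wedge \<open>w\<close> does not change its pairing with an element of \<open>Bsp2\<close>.\<close>

lemma ip_sp2_part:
  assumes "A \<in> Bsp2 g Q"
  shows "ip A (sp2_part z w) = 2 * g (A *v z) w"
proof -
  have *: "(\<Sum>a\<in>UNIV. g (A *v h a) (wedge_endo N z w *v h a)) = g (A *v (N *v z)) (N *v w)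
      - g (A *v (N *v w)) (N *v z)" for N
    by (simp add: wedge_endo_mv g_r sum_subtractf contract[OF linear_g_mv(1)])
  have **: "g (A *v z) w - g (A *v w) z = 2 * g (A *v z) w" for z w
    using skewD[OF Bsp2_skew[OF assms], of w z] sym[of w] by simp
  have "ip A (sp2_part z w) = (1/4) * ((\<Sum>a\<in>UNIV. g (A *v h a) (wedge_endo (mat 1) z w *v h a))
      + (\<Sum>s\<in>UNIV. \<Sum>a\<in>UNIV. g (A *v h a) (wedge_endo (I s) z w *v h a)))"
    by (simp add: ip_def sp2_part_mv g_r g_sum sum.distrib sum_3 add_divide_distrib flip:
        sum_divide_distrib)
  also have "\<dots> = 2 * g (A *v z) w"
    unfolding * by (simp add: ** Bsp2_I[OF assms] g_I)
  finally show ?thesis .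
qed

end

section \<open>The operator \<open>T\<close> of a cubic discriminant and its eigenspace
  \<open>V\<close>\<close>

locale cubic8 = quat8 +
  fixes K :: "vec \<Rightarrow> vec \<Rightarrow> vec \<Rightarrow> vec \<Rightarrow> real"
  assumes h_frame: "h = frame g" and K: "K \<in> cubic_discriminants_at g Q"
begin

abbreviation T :: "endo \<Rightarrow> endo" where "T \<equiv> TK g K"

lemma K_R: "K \<in> RSp2 g Q"
  using K by (simp add: cubic_discriminants_at_def)

lemma K_linear: "linear (\<lambda>v. K v y z w)" "linear (\<lambda>v. K x v z w)"
    "linear (\<lambda>v. K x y v w)" "linear (\<lambda>v. K x y z v)"
proof -
  have "multilinear4 K" using K_R unfolding RSp2_def by blast
  then show "linear (\<lambda>v. K v y z w)" "linear (\<lambda>v. K x v z w)"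
    "linear (\<lambda>v. K x y v w)" "linear (\<lambda>v. K x y z v)"
    by (simp_all add: multilinear4_def)
qed

lemmas K_simps = linear_add[OF K_linear(1)] linear_diff[OF K_linear(1)] linear_scale[OF K_linear(1)]
  linear_add[OF K_linear(2)] linear_diff[OF K_linear(2)] linear_scale[OF K_linear(2)]
  linear_add[OF K_linear(3)] linear_diff[OF K_linear(3)] linear_scale[OF K_linear(3)]
  linear_add[OF K_linear(4)] linear_diff[OF K_linear(4)] linear_scale[OF K_linear(4)]

lemma K_skew1: "K x y z w = - K y x z w" and K_skew2: "K x y z w = - K x y w z"
  and K_bianchi: "K x y z w + K y z x w + K z x y w = 0"
  using K_R unfolding RSp2_def by blast+

lemma K_I: "K x y (I s *v z) (I s *v w) = K x y z w"
  using K_R qb unfolding RSp2_def by blast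

text \<open>\<open>RSp2\<close> does not list this curvature symmetry; it follows by combining the
  four Bianchi identities for the cyclic shifts of \<open>x, y, z, w\<close> with the skew
  symmetries. It makes \<open>T\<close> self-adjoint and carries \<open>K_I\<close> over to the
  first two slots.\<close>

lemma K_pair: "K x y z w = K z w x y"
  using K_bianchi[of x y z w] K_bianchi[of y z w x] K_bianchi[of z w x y] K_bianchi[of w x y z]
    K_skew1[of y z x w] K_skew1[of z x y w] K_skew2[of y z w x] K_skew1[of z w y x]
    K_skew2[of z w x y] K_skew1[of w y z x] K_skew2[of w y z x] K_skew1[of w x z y]
    K_skew2[of w x y z] K_skew2[of x z w y] K_skew1[of x z w y] K_skew1[of x y w z]
    K_skew2[of x y w z] K_skew1[of y w x z] K_skew2[of y w x z]
  by linarith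

text \<open>\<open>TK\<close> is defined in the frame \<open>frame g\<close>, and
  \<open>h_frame\<close> takes that frame for \<open>h\<close>; the formula then comes out by
  contraction in the second slot of \<open>K\<close>.\<close>

lemma TK_eq: "g (T A *v x) y = 1/2 * (\<Sum>a\<in>UNIV. K x y (h a) (A *v h a))"
proof -
  let ?f = "\<lambda>x. \<Sum>b\<in>UNIV. (1/2 * (\<Sum>a\<in>UNIV. K x (h b) (h a) (A *v h a))) *\<^sub>R h b"
  have lin: "linear ?f"
    by (rule linearI) (simp_all add: K_simps sum.distrib scaleR_left_distrib distrib_left
        scaleR_sum_right sum_distrib_left algebra_simps)
  then have "T A *v x = ?f x"
    unfolding TK_def Let_def h_frame[symmetric] by (rule fun_cong[OF matrix_vector_mul(2)])
  then have "g (T A *v x) y = 1/2 * (\<Sum>b\<in>UNIV. (\<Sum>a\<in>UNIV. K x (h b) (h a) (A *v h a)) * g (h b) y)"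
    by (simp add: g_sum g_l flip: sum_divide_distrib)
  also have "(\<Sum>b\<in>UNIV. (\<Sum>a\<in>UNIV. K x (h b) (h a) (A *v h a)) * g (h b) y)
      = (\<Sum>a\<in>UNIV. \<Sum>b\<in>UNIV. K x (h b) (h a) (A *v h a) * g (h b) y)"
    by (subst sum.swap) (simp add: sum_distrib_right)
  also have "\<dots> = (\<Sum>a\<in>UNIV. K x y (h a) (A *v h a))"
    by (simp add: contract[OF K_linear(2)])
  finally show ?thesis .
qed

lemma T_linear: "T (A + B) = T A + T B" "T (c *\<^sub>R A) = c *\<^sub>R T A"
  by (rule endo_eqI, simp add: TK_eq matrix_vector_mult_add_rdistrib K_simps sum.distrib g_l
      scaleR_matrix_vector_assoc[symmetric] sum_distrib_left algebra_simps)+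

lemma T_Bsp2: "T A \<in> Bsp2 g Q"
  unfolding Bsp2_iff skew_def
proof (intro conjI allI)
  fix x y
  have "K x y (h a) (A *v h a) = - K y x (h a) (A *v h a)" for a by (rule K_skew1)
  then have "g (T A *v x) y = - g (T A *v y) x"
    unfolding TK_eq by (simp add: sum_negf)
  then show "g (T A *v x) y = - g x (T A *v y)" using sym[of x "T A *v y"] by simp
next
  fix s x
  have inv: "g (T A *v (I s *v x)) (I s *v y) = g (T A *v x) y" for y
    unfolding TK_eq K_pair[of "I s *v x"] K_I by (simp add: K_pair[of x])
  show "T A *v (I s *v x) = I s *v (T A *v x)"
  proof (rule g_eqI)
    fix y
    have "g (T A *v (I s *v x)) (I s *v (I s *v y)) = g (T A *v x) (I s *v y)"
      by (rule inv)
    then show "g (T A *v (I s *v x)) y = g (I s *v (T A *v x)) y"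
      by (simp add: I_simps g_I_left g_r)
  qed
qed

lemma T_symmetric: "ip (T A) B = ip A (T B)"
proof -
  have *: "ip (T A) B = 1/2 * (\<Sum>b\<in>UNIV. \<Sum>a\<in>UNIV. K (h b) (B *v h b) (h a) (A *v h a))" for A B
    by (simp add: ip_def TK_eq sum_distrib_left)
  have "ip (T A) B = 1/2 * (\<Sum>a\<in>UNIV. \<Sum>b\<in>UNIV. K (h b) (B *v h b) (h a) (A *v h a))"
    unfolding * by (subst sum.swap) (rule refl)
  also have "\<dots> = 1/2 * (\<Sum>a\<in>UNIV. \<Sum>b\<in>UNIV. K (h a) (A *v h a) (h b) (B *v h b))"
    using K_pair by (intro arg_cong2[of _ _ _ _ "(*)"] sum.cong refl)
  also have "\<dots> = ip (T B) A" unfolding * ..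
  finally show ?thesis by (simp only: ip_commute[of A])
qed

text \<open>\<open>T\<close> contains all of \<open>K\<close>: contracting the last two slots with a
  bivector returns \<open>2 * K\<close>, the 1/2 in \<open>T\<close> cancels the 2, and by
  \<open>K_I\<close> the four terms of the average agree.\<close>

lemma K_eq_T_sp2_part: "K x y z w = g (T (sp2_part z w) *v x) y"
proof -
  have *: "(\<Sum>a\<in>UNIV. K x y (h a) (wedge_endo N z w *v h a)) = 2 * K x y (N *v z) (N *v w)" for N
    using K_skew2[of x y "N *v z" "N *v w"]
    by (simp add: wedge_endo_mv K_simps sum_subtractf contract[OF K_linear(3)])
  have "(\<Sum>a\<in>UNIV. K x y (h a) (sp2_part z w *v h a))
      = 1/4 * ((\<Sum>a\<in>UNIV. K x y (h a) (wedge_endo (mat 1) z w *v h a))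
      + (\<Sum>s\<in>UNIV. \<Sum>a\<in>UNIV. K x y (h a) (wedge_endo (I s) z w *v h a)))"
    by (simp add: sp2_part_mv K_simps sum.distrib sum_3 add_divide_distrib flip: sum_divide_distrib)
  also have "\<dots> = 2 * K x y z w" unfolding * by (simp add: K_I)
  finally show ?thesis by (simp add: TK_eq)
qed

abbreviation V :: "endo set" where "V \<equiv> Bsp1_ir g Q K"

lemma V_iff: "A \<in> V \<longleftrightarrow> A \<in> Bsp2 g Q \<and> T A = (7/2) *\<^sub>R A"
  by (simp add: Bsp1_ir_def)

lemma subspace_V: "subspace V"
proof (rule subspaceI)
  show "0 \<in> V" using T_linear(2)[of 0 0] subspace_0[OF subspace_Bsp2] by (simp add: V_iff)
qed (auto simp: V_iff T_linear scaleR_right_distrib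
      intro: subspace_add[OF subspace_Bsp2] subspace_scale[OF subspace_Bsp2])

text \<open>The quadratic equation, read from the left: \<open>2T - 7\<close> vanishes on the image
  of \<open>2T + 3\<close>.\<close>

lemma projection_V: "A \<in> Bsp2 g Q \<Longrightarrow> 2 *\<^sub>R T A + 3 *\<^sub>R A \<in> V"
proof -
  assume A: "A \<in> Bsp2 g Q"
  let ?B = "2 *\<^sub>R T A + 3 *\<^sub>R A"
  have "2 *\<^sub>R T ?B - 7 *\<^sub>R ?B = 0"
    using K A by (simp add: cubic_discriminants_at_def Let_def)
  then have "(1/2) *\<^sub>R (2 *\<^sub>R T ?B) = (1/2) *\<^sub>R (7 *\<^sub>R ?B)" by simp
  then have "T ?B = (7/2) *\<^sub>R ?B" by (simp only: scaleR_scaleR) simp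
  then show ?thesis
    by (simp add: V_iff A T_Bsp2 subspace_add[OF subspace_Bsp2] subspace_scale[OF subspace_Bsp2])
qed

text \<open>On eigenvectors for 7/2 the bracket condition on a discriminant reduces to
  \<open>(35/2) [A, B] = 5 T [A, B]\<close>, so \<open>[A, B]\<close> has the same eigenvalue. This
  is the one place where that condition enters.\<close>

lemma bracket_V:
  assumes "A \<in> V" "B \<in> V"
  shows "bracket A B \<in> V"
proof -
  have AB: "A \<in> Bsp2 g Q" "B \<in> Bsp2 g Q" "T A = (7/2) *\<^sub>R A" "T B = (7/2) *\<^sub>R B"
    using assms by (auto simp: V_iff)
  have sc: "bracket (c *\<^sub>R X) Y = c *\<^sub>R bracket X Y" "bracket X (c *\<^sub>R Y) = c *\<^sub>R bracket X Y"
      for c X Y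
    by (simp_all add: matrix_eq bracket_mv matrix_vector_mult_scaleR scaleR_right_diff_distrib
        flip: scaleR_matrix_vector_assoc)
  have "bracket (T A) (T B) - T (bracket (T A) B) = (3/2) *\<^sub>R (T (bracket A B) - bracket A (T B))"
    using K AB(1,2) unfolding cubic_discriminants_at_def Let_def by blast
  then have "(49/4) *\<^sub>R bracket A B - (7/2) *\<^sub>R T (bracket A B)
      = (3/2) *\<^sub>R T (bracket A B) - (21/4) *\<^sub>R bracket A B"
    by (simp add: AB sc T_linear scaleR_right_diff_distrib)
  then have "(49/4) *\<^sub>R bracket A B + (21/4) *\<^sub>R bracket A B
      = (3/2) *\<^sub>R T (bracket A B) + (7/2) *\<^sub>R T (bracket A B)"
    by (simp add: algebra_simps)
  then have "(35/2) *\<^sub>R bracket A B = 5 *\<^sub>R T (bracket A B)"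
    by (simp only: scaleR_left_distrib[symmetric]) simp
  then have "(1/5) *\<^sub>R ((35/2) *\<^sub>R bracket A B) = (1/5) *\<^sub>R (5 *\<^sub>R T (bracket A B))" by simp
  then show ?thesis using AB(1,2) by (simp add: V_iff bracket_Bsp2)
qed

end

section \<open>\<open>K\<close> in terms of an orthonormal basis of \<open>V\<close>, and the
  Casimir operator\<close>

locale cubic8_basis = cubic8 +
  fixes B :: "endo set"
  assumes B: "finite B" "B \<subseteq> V" "span B = V"
    and B_orthonormal: "\<And>e f. e \<in> B \<Longrightarrow> f \<in> B \<Longrightarrow> ip e f = (if e = f then 1 else 0)"
    and B_expansion: "\<And>A. A \<in> V \<Longrightarrow> A = (\<Sum>e\<in>B. ip e A *\<^sub>R e)"
begin

lemma B_Bsp2: "e \<in> B \<Longrightarrow> e \<in> Bsp2 g Q"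
  using B(2) by (auto simp: V_iff)

text \<open>As \<open>T\<close> is self-adjoint, the coefficient along \<open>e\<close> is 2 times
  7/2 plus 3, times \<open>ip e A\<close>; the left side lies in \<open>V\<close>, so it has no
  further components.\<close>

lemma T_expansion:
  assumes "A \<in> Bsp2 g Q"
  shows "2 *\<^sub>R T A + 3 *\<^sub>R A = 10 *\<^sub>R (\<Sum>e\<in>B. ip e A *\<^sub>R e)"
proof -
  have "ip e (2 *\<^sub>R T A + 3 *\<^sub>R A) = 10 * ip e A" if "e \<in> B" for e
  proof -
    have "ip e (T A) = (7/2) * ip e A"
      using that B(2) T_symmetric[of e A] by (auto simp: V_iff ip_linear)
    then show ?thesis by (simp add: ip_linear)
  qed
  then show ?thesis
    by (subst B_expansion[OF projection_V[OF assms]]) (simp add: scaleR_sum_right)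
qed

text \<open>On \<open>Bsp2\<close> the operator \<open>T\<close> is \<open>5 P - 3/2\<close> with \<open>P\<close> the orthogonal projection onto \<open>V\<close>, and
  \<open>K x y z w\<close> is \<open>T\<close> applied to the projection of \<open>z \<and> w\<close>.\<close>
lemma K_form: "K x y z w = 10 * (\<Sum>e\<in>B. g (e *v x) y * g (e *v z) w) - 3/8 * proj_form x y z w"
proof -
  have "2 * g (T (sp2_part z w) *v x) y + 3 * g (sp2_part z w *v x) y = g ((2 *\<^sub>R T (sp2_part z w)
      + 3 *\<^sub>R sp2_part z w) *v x) y"
    by (simp add: matrix_vector_mult_add_rdistrib scaleR_matrix_vector_assoc[symmetric] g_l)
  also have "\<dots> = 10 * (\<Sum>e\<in>B. ip e (sp2_part z w) * g (e *v x) y)"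
  proof -
    have l: "linear (\<lambda>A. g (A *v x) y)"
      by (rule linearI) (simp_all add: matrix_vector_mult_add_rdistrib
          scaleR_matrix_vector_assoc[symmetric] g_l)
    show ?thesis
      unfolding T_expansion[OF sp2_part_Bsp2] by (simp add: linear_sum[OF l] linear_scale[OF l])
  qed
  also have "\<dots> = 20 * (\<Sum>e\<in>B. g (e *v x) y * g (e *v z) w)"
    by (simp add: ip_sp2_part B_Bsp2 sum_distrib_left mult_ac)
  finally show ?thesis by (simp add: K_eq_T_sp2_part g_sp2_part)
qed

text \<open>The contribution of \<open>pair_form N\<close> to the contracted Bianchi sum. The trace
  appears where both contracted slots meet in one factor.\<close>

definition pair_contraction :: "endo \<Rightarrow> endo \<Rightarrow> vec \<Rightarrow> vec \<Rightarrow> real" where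
  "pair_contraction N M x w = 2 * g (N *v (M *v (N *v w))) x - 2 * tr (N ** M) * g (N *v w) x
     + 2 * g (M *v (N *v x)) (N *v w)"

lemma pair_form_contract:
  assumes "skew M"
  shows "(\<Sum>a\<in>UNIV. pair_form N x (h a) (M *v h a) w + pair_form N (h a) (M *v h a) x w
      + pair_form N (M *v h a) x (h a) w)
    = pair_contraction N M x w"
proof -
  have 1: "(\<Sum>a\<in>UNIV. pair_form N x (h a) (M *v h a) w) = g (N *v (M *v (N *v w))) x
      - g (N *v w) x * tr (N ** M)"
    unfolding pair_form_def tr_def
    by (simp add: sum_subtractf contract[OF linear_g_mv2(1)] matrix_vector_mul_assoc[symmetric]
        flip: sum_distrib_left)
  have 2: "(\<Sum>a\<in>UNIV. pair_form N (h a) (M *v h a) x w) = 2 * g (M *v (N *v x)) (N *v w)"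
  proof -
    have "(\<Sum>a\<in>UNIV. pair_form N (h a) (M *v h a) x w) = g (N *v w) (M *v (N *v x))
        - g (N *v x) (M *v (N *v w))"
      unfolding pair_form_def by (simp add: sum_subtractf contract[OF linear_g_mv(2)])
    then show ?thesis using skewD[OF assms, of "N *v x" "N *v w"] sym[of "N *v w"] by simp
  qed
  have 3: "(\<Sum>a\<in>UNIV. pair_form N (M *v h a) x (h a) w) = g (N *v (M *v (N *v w))) x
      - tr (N ** M) * g (N *v w) x"
  proof -
    have "g (N *v h a) (M *v h a) = - g ((M ** N) *v h a) (h a)" for a
      using skewD[OF assms, of "N *v h a" "h a"] by (simp add: matrix_vector_mul_assoc[symmetric])
    moreover have "g (N *v w) (M *v h a) = - g (M *v (N *v w)) (h a)" for a
      using skewD[OF assms, of "N *v w" "h a"] by simp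
    ultimately have "(\<Sum>a\<in>UNIV. pair_form N (M *v h a) x (h a) w) =
       (\<Sum>a\<in>UNIV. - g ((M ** N) *v h a) (h a) * g (N *v w) x + g (M *v (N *v w)) (h a) * g (N *v h
           a) x)"
      by (simp add: pair_form_def)
    also have "\<dots> = - tr (M ** N) * g (N *v w) x + g (N *v (M *v (N *v w))) x"
      unfolding tr_def by (simp add: sum.distrib sum_negf sum_subtractf contract[OF
          linear_g_mv(1)] sum_distrib_right)
    finally show ?thesis by (simp add: tr_mult_commute[of M])
  qed
  show ?thesis unfolding sum.distrib 1 2 3 pair_contraction_def by simp
qed

text \<open>The Bianchi identity, contracted in its second and third slot with \<open>M\<close>. The choice \<open>M = I 1\<close>
  determines \<open>\<Sum>e e\<close> and hence the dimension of \<open>V\<close>; the choice \<open>M \<in> Bsp2\<close> determines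
  \<open>\<Sum>e M e\<close> and hence the Casimir operator.\<close>
lemma bianchi_contract:
  assumes "skew M"
  shows "20 * (\<Sum>e\<in>B. g (e *v (M *v (e *v x))) w) + 10 * (\<Sum>e\<in>B. ip e M * g (e *v x) w)
    = 3/8 * (pair_contraction (mat 1) M x w + (\<Sum>s\<in>UNIV. pair_contraction (I s) M x w))"
proof -
  \<comment> \<open>In the contribution of \<open>e\<close> tensor \<open>e\<close>, the first and
    the third cyclic position give \<open>e M e\<close> each, and the second pairs \<open>e\<close>
    with \<open>M\<close>.\<close>
  have e: "(\<Sum>a\<in>UNIV. g (e *v x) (h a) * g (e *v (M *v h a)) w
      + g (e *v h a) (M *v h a) * g (e *v x) w
      + g (e *v (M *v h a)) x * g (e *v h a) w) = 2 * g (e *v (M *v (e *v x))) w + ip e M * g (e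
          *v x) w"
    if "e \<in> B" for e
  proof -
    have "g (e *v (M *v h a)) x = g (M *v (e *v x)) (h a)" for a
      using skewD[OF Bsp2_skew[OF B_Bsp2[OF that]], of "M *v h a" x] skewD[OF assms, of "h a"
          "e *v x"]
        sym[of "h a"] by simp
    then show ?thesis
      by (simp add: sum.distrib contract[OF linear_g_mv2(1)] contract[OF linear_g_mv(1)] ip_def
          flip: sum_distrib_right)
  qed
  have "0 = (\<Sum>a\<in>UNIV. K x (h a) (M *v h a) w + K (h a) (M *v h a) x w + K (M *v h a) x (h a) w)"
    by (simp add: K_bianchi)
  also have "\<dots> = 10 * (\<Sum>a\<in>UNIV. \<Sum>e\<in>B. g (e *v x) (h a) * g (e *v (M *v h a)) w
        + g (e *v h a) (M *v h a) * g (e *v x) w + g (e *v (M *v h a)) x * g (e *v h a) w)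
      - 3/8 * (\<Sum>a\<in>UNIV. proj_form x (h a) (M *v h a) w + proj_form (h a) (M *v h a) x w +
          proj_form (M *v h a) x (h a) w)"
    unfolding K_form by (simp add: sum.distrib sum_subtractf sum_distrib_left flip:
        sum_divide_distrib)
      (simp add: field_simps)
  also have "(\<Sum>a\<in>UNIV. proj_form x (h a) (M *v h a) w + proj_form (h a) (M *v h a) x w
      + proj_form (M *v h a) x (h a) w)
      = pair_contraction (mat 1) M x w + (\<Sum>s\<in>UNIV. pair_contraction (I s) M x w)"
    unfolding pair_form_contract[OF assms, symmetric] proj_form_def sum_3 by (simp add: sum.distrib)
  also have "(\<Sum>a\<in>UNIV. \<Sum>e\<in>B. g (e *v x) (h a) * g (e *v (M *v h a)) w
        + g (e *v h a) (M *v h a) * g (e *v x) w + g (e *v (M *v h a)) x * g (e *v h a) w)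
      = (\<Sum>e\<in>B. 2 * g (e *v (M *v (e *v x))) w + ip e M * g (e *v x) w)"
    by (subst sum.swap) (simp add: e)
  finally show ?thesis by (simp add: sum.distrib sum_distrib_left)
qed

text \<open>For \<open>M = A\<close> the identity contributes nothing and each of the three
  \<open>I s\<close> contributes 4 times the form of \<open>A\<close>; 9/2 is 3/8 times 12.\<close>

lemma sum_eAe:
  assumes "A \<in> Bsp2 g Q"
  shows "20 * (\<Sum>e\<in>B. g (e *v (A *v (e *v x))) w) + 10 * (\<Sum>e\<in>B. ip e A * g (e *v x) w)
    = 9/2 * g (A *v x) w"
proof -
  have sk: "g (A *v w) x = - g (A *v x) w"
    using skewD[OF Bsp2_skew[OF assms], of w x] sym[of w] by simp
  have 1: "pair_contraction (mat 1) A x w = 0"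
    by (simp add: pair_contraction_def tr_skew[OF Bsp2_skew[OF assms]] sk)
  have 2: "pair_contraction (I s) A x w = 4 * g (A *v x) w" for s
    by (simp add: pair_contraction_def tr_I_Bsp2[OF assms] Bsp2_I[OF assms] I_simps g_I g_l sk)
  show ?thesis
    unfolding bianchi_contract[OF Bsp2_skew[OF assms]] 1 2 by simp
qed

text \<open>For \<open>M = I 1\<close> the terms \<open>ip e M\<close> vanish, and the three units
  contribute -12, -4 and -4 times the form of \<open>I 1\<close>; the -12 contains the trace -8 of
  the square of \<open>I 1\<close>. As \<open>e\<close> commutes with \<open>I 1\<close>, evaluation
  at \<open>I 1 x\<close> leaves \<open>e e\<close>.\<close>

lemma sum_ee: "(\<Sum>e\<in>B. g (e *v (e *v x)) w) = - 3/8 * g x w"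
proof -
  have ip0: "ip e (I 1) = 0" if "e \<in> B" for e
    using tr_I_Bsp2[OF B_Bsp2[OF that]] by (simp add: ip_skew[OF skew_I])
  have sk: "g (I s *v w) x = - g (I s *v x) w" for s x
    using g_I_left[of s w x] sym[of w] by simp
  have mat: "pair_contraction (mat 1) (I 1) x w = 0" for x
    by (simp add: pair_contraction_def tr_skew[OF skew_I] sk)
  have "pair_contraction (I 1) (I 1) x w + pair_contraction (I 2) (I 1) x w
      + pair_contraction (I 3) (I 1) x w = - 20 * g (I 1 *v x) w" for x
    by (simp add: pair_contraction_def tr_I_I I_simps g_l g_r g_I g_I_right sk)
  then have "20 * (\<Sum>e\<in>B. g (e *v (I 1 *v (e *v x))) w) = - 15/2 * g (I 1 *v x) w" for x
    using bianchi_contract[OF skew_I, of 1 x w] by (simp add: ip0 mat sum_3)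
  from this[of "I 1 *v x"] show ?thesis
    by (simp add: Bsp2_I B_Bsp2 I_simps g_l sum_negf)
qed

text \<open>The trace of \<open>sum_ee\<close>: -3/8 times 8 on one side, minus the sum of the
  squared norms of the basis on the other.\<close>

lemma card_B: "card B = 3"
proof -
  have "(\<Sum>a\<in>UNIV. \<Sum>e\<in>B. g (e *v (e *v h a)) (h a)) = -3"
    unfolding sum_ee by (simp add: frame_inner)
  moreover have "(\<Sum>a\<in>UNIV. \<Sum>e\<in>B. g (e *v (e *v h a)) (h a)) = (\<Sum>e\<in>B. - ip e e)"
    using skewD[OF Bsp2_skew[OF B_Bsp2]]
    by (subst sum.swap) (simp add: ip_def sum_negf)
  moreover have "(\<Sum>e\<in>B. - ip e e) = - real (card B)" by (simp add: B_orthonormal sum_negf)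
  ultimately show ?thesis by simp
qed

text \<open>The double bracket is \<open>e e A - 2 e A e + A e e\<close>. By \<open>sum_ee\<close>
  the outer terms give -3/8 each; by \<open>sum_eAe\<close> the middle one gives -9/20 plus the
  projection to \<open>V\<close>.\<close>

lemma casimir:
  assumes "A \<in> Bsp2 g Q"
  shows "(\<Sum>e\<in>B. g (bracket e (bracket e A) *v x) w) =
    - 6/5 * g (A *v x) w + (\<Sum>e\<in>B. ip e A * g (e *v x) w)"
proof -
  have "(\<Sum>e\<in>B. g (bracket e (bracket e A) *v x) w) = (\<Sum>e\<in>B. g (e *v (e *v (A *v x))) w)
      - 2 * (\<Sum>e\<in>B. g (e *v (A *v (e *v x))) w) + (\<Sum>e\<in>B. g (A *v (e *v (e *v x))) w)"
  proof -
    have "g (bracket e (bracket e A) *v x) w = g (e *v (e *v (A *v x))) w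
      - 2 * g (e *v (A *v (e *v x))) w + g (A *v (e *v (e *v x))) w" for e
      by (simp only: bracket_mv matrix_vector_mult_diff_distrib g_l)
    then show ?thesis by (simp add: sum.distrib sum_subtractf sum_distrib_left)
  qed
  moreover have "(\<Sum>e\<in>B. g (A *v (e *v (e *v x))) w) = - 3/8 * g (A *v x) w"
  proof -
    have "(\<Sum>e\<in>B. g (A *v (e *v (e *v x))) w) = - (\<Sum>e\<in>B. g (e *v (e *v x)) (A *v w))"
      by (simp add: skewD[OF Bsp2_skew[OF assms]] sum_negf)
    then show ?thesis unfolding sum_ee by (simp add: skewD[OF Bsp2_skew[OF assms]])
  qed
  ultimately show ?thesis using sum_eAe[OF assms, of x w] sum_ee[of "A *v x" w] by simp
qed

text \<open>In dimension three an invariant inner product leaves a single structure constant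
  \<open>l\<close>; generators exist as soon as it is nonzero.\<close>

lemma exists_sp1_generators: "\<exists>E. sp1_generators g Q K E"
proof -
  obtain f :: "3 \<Rightarrow> endo" where "bij_betw f UNIV B"
    using finite_same_card_bij[of "UNIV :: 3 set" B] B(1) card_B by auto
  then have f: "inj f" "range f = B" by (auto simp: bij_betw_def)
  have fB: "f s \<in> B" for s using f(2) by auto
  have fV: "f s \<in> V" for s using fB B(2) by auto
  have sk: "skew (f s)" for s using fB B_Bsp2 Bsp2_skew by blast
  have on: "ip (f s) (f t) = (if s = t then 1 else 0)" for s t
    using B_orthonormal[OF fB fB] f(1) by (simp add: inj_eq)
  have ex: "A = ip (f 1) A *\<^sub>R f 1 + ip (f 2) A *\<^sub>R f 2 + ip (f 3) A *\<^sub>R f 3" if "A \<in> V" for A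
    using B_expansion[OF that] sum.reindex[OF f(1), of "\<lambda>e. ip e A *\<^sub>R e"] f(2) by (simp add: sum_3)
  have br0: "bracket A A = 0" and brn: "bracket A C = - bracket C A" for A C
    by (simp_all add: bracket_def)
  have ip_neg: "ip A (- C) = - ip A C" for A C using ip_linear(4)[of A "-1" C] by simp
  have ip_0: "ip A 0 = 0" for A using ip_linear(4)[of A 0 0] by simp
  have same: "ip (f s) (bracket (f s) (f t)) = 0" "ip (f t) (bracket (f s) (f t)) = 0" for s t
  proof -
    show *: "ip (f s) (bracket (f s) (f t)) = 0" for s t
      using ip_bracket[OF sk[of s] sk[of s] sk[of t]] ip_0[of "f t"] by (simp add: br0 ip_commute)
    show "ip (f t) (bracket (f s) (f t)) = 0"
      using *[of t s] by (subst brn) (simp add: ip_neg)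
  qed
  define l where "l = ip (f 3) (bracket (f 1) (f 2))"
  have l: "ip (f 1) (bracket (f 2) (f 3)) = l" "ip (f 2) (bracket (f 3) (f 1)) = l"
    using ip_bracket[OF sk sk sk, of 1 2 3] ip_bracket[OF sk sk sk, of 2 3 1]
    by (simp_all add: l_def ip_commute)
  have b: "bracket (f 1) (f 2) = l *\<^sub>R f 3" "bracket (f 2) (f 3) = l *\<^sub>R f 1"
      "bracket (f 3) (f 1) = l *\<^sub>R f 2"
    using ex[OF bracket_V[OF fV fV], of 1 2] ex[OF bracket_V[OF fV fV], of 2 3]
      ex[OF bracket_V[OF fV fV], of 3 1]
    by (simp_all add: same l l_def[symmetric])
  \<comment> \<open>If \<open>l\<close> were 0, all double brackets with \<open>f 1\<close> would
    vanish, whereas \<open>casimir\<close> gives -6/5 + 1 times \<open>f 1\<close>.\<close>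
  have "l \<noteq> 0"
  proof
    assume "l = 0"
    then have "bracket (f s) (f 1) = 0" for s
      using b brn[of "f 1" "f 2"] br0 exhaust_3[of s]
          by (metis neg_equal_0_iff_equal scaleR_zero_left)
    then have z: "bracket e (f 1) = 0" if "e \<in> B" for e using f(2) that by auto
    have "g (f 1 *v x) w = 0" for x w
    proof -
      have "(\<Sum>e\<in>B. ip e (f 1) * g (e *v x) w) = (\<Sum>s\<in>UNIV. ip (f s) (f 1) * g (f s *v x) w)"
        unfolding f(2)[symmetric] by (simp add: sum.reindex[OF f(1)])
      also have "\<dots> = g (f 1 *v x) w" by (simp add: on sum_3)
      finally show ?thesis
        using casimir[OF B_Bsp2[OF fB], of 1 x w]
        by (simp add: z bracket_mv matrix_vector_mult_0_right g_l)
    qed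
    then have "ip (f 1) (f 1) = 0" by (simp add: ip_def)
    then show False by (simp add: on)
  qed
  \<comment> \<open>The bracket is quadratic in the scale and the relation linear, so division by
    \<open>l\<close> normalises it; for negative \<open>l\<close> this also corrects the
    sign.\<close>
  define E where "E s = (1 / l) *\<^sub>R f s" for s
  have br_scale: "bracket (c *\<^sub>R A) (c *\<^sub>R C) = (c * c) *\<^sub>R bracket A C" for A C and c :: real
    by (simp add: matrix_eq bracket_mv matrix_vector_mult_scaleR scaleR_right_diff_distrib
        flip: scaleR_matrix_vector_assoc)
  have "span (range E) = V"
  proof
    show "span (range E) \<subseteq> V"
      using subspace_V fV by (intro span_minimal) (auto simp: E_def subspace_scale)
    have "f s \<in> span (range E)" for s
    proof -
      have "f s = l *\<^sub>R E s" using \<open>l \<noteq> 0\<close> by (simp add: E_def)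
      then show ?thesis by (simp add: span_base span_scale)
    qed
    then show "V \<subseteq> span (range E)"
      unfolding B(3)[symmetric] using f(2) by (intro span_minimal) auto
  qed
  moreover have "bracket (E 1) (E 2) = E 3" "bracket (E 2) (E 3) = E 1" "bracket (E 3) (E 1) = E 2"
    unfolding E_def br_scale b using \<open>l \<noteq> 0\<close> by simp_all
  ultimately show ?thesis unfolding sp1_generators_def by blast
qed

text \<open>\<open>DK\<close> is minus the infinitesimal action of \<open>A\<close> on \<open>K\<close>. It only sees the part
  \<open>10 \<Sum>e \<otimes> e\<close> of \<open>K\<close>, the other part being \<open>Sp(2)\<close>-invariant, and each \<open>[A, e]\<close> lies in the
  \<open>-3/2\<close>-eigenspace of \<open>T\<close>. The sum becomes \<open>-100\<close> times the Casimir operator of \<open>V\<close> at \<open>A\<close>,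
  which is \<open>-6/5\<close> there.\<close>
lemma reconstruction:
  fixes A :: endo
  defines "DK \<equiv> \<lambda>x y z w. K (A *v x) y z w + K x (A *v y) z w + K x y (A *v z) w + K x y z (A *v w)"
  assumes A: "A \<in> Bsp2 g Q" and orth: "\<And>e. e \<in> V \<Longrightarrow> ip e A = 0"
  shows "1/120 * (\<Sum>a\<in>UNIV. \<Sum>b\<in>UNIV. \<Sum>c\<in>UNIV.
       DK y (h a) (h b) (h c) * K z (h a) (h b) (h c) - DK z (h a) (h b) (h c) * K y (h a) (h b)
           (h c))
     = g (A *v y) z"
proof -
  have orthB: "ip e A = 0" if "e \<in> B" for e using orth that B(2) by auto
  have fB: "bracket A e \<in> Bsp2 g Q" if "e \<in> B" for e using A B_Bsp2 that bracket_Bsp2 by blast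
  have AI: "I s *v (A *v x) = A *v (I s *v x)" for s x using Bsp2_I[OF A] by simp
  have skA: "g x (A *v y) = - g (A *v x) y" for x y using skewD[OF Bsp2_skew[OF A], of x y] by simp
  have DK: "DK x y z w = - 10 * (\<Sum>e\<in>B. g (bracket A e *v x) y * g (e *v z) w
      + g (e *v x) y * g (bracket A e *v z) w)" for x y z w
  proof -
    \<comment> \<open>\<open>proj_form\<close> is built from \<open>g\<close> and the
      \<open>I s\<close>, so a skew \<open>A\<close> commuting with the \<open>I s\<close>
      annihilates it as a derivation.\<close>
    have proj0: "proj_form (A *v x) y z w + proj_form x (A *v y) z w + proj_form x y (A *v z) w
        + proj_form x y z (A *v w) = 0"
      unfolding proj_form_def pair_form_def sum_3 by (simp add: AI skA)
    have e: "g (e *v (A *v x)) y + g (e *v x) (A *v y) = - g (bracket A e *v x) y" for e x y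
      by (simp add: bracket_mv g_l skA)
    have "DK x y z w = 10 * (\<Sum>e\<in>B. (g (e *v (A *v x)) y + g (e *v x) (A *v y)) * g (e *v z) w
        + g (e *v x) y * (g (e *v (A *v z)) w + g (e *v z) (A *v w)))
        - 3/8 * (proj_form (A *v x) y z w + proj_form x (A *v y) z w + proj_form x y (A *v z) w +
            proj_form x y z (A *v w))"
      unfolding DK_def K_form by (simp add: sum.distrib sum_distrib_left algebra_simps)
    also have "\<dots> = - 10 * (\<Sum>e\<in>B. g (bracket A e *v x) y * g (e *v z) w
        + g (e *v x) y * g (bracket A e *v z) w)"
      unfolding proj0 e by (simp add: sum.distrib sum_negf sum_subtractf)
    finally show ?thesis .
  qed
  \<comment> \<open>Pairing a 2-form with the last two slots of \<open>K\<close> is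
    \<open>T\<close>; the 2 undoes the 1/2 in its definition.\<close>
  have KT: "(\<Sum>b\<in>UNIV. \<Sum>c\<in>UNIV. g (C *v h b) (h c) * K z a (h b) (h c)) = 2 * g (T C *v z) a"
      for C z a
    by (simp add: contract[OF K_linear(4)] TK_eq)
  \<comment> \<open>By invariance \<open>ip u [A, e]\<close> equals \<open>ip A [e, u]\<close>,
    which vanishes because \<open>V\<close> is a subalgebra orthogonal to \<open>A\<close>. So
    \<open>[A, e]\<close> has no part in \<open>V\<close>.\<close>
  have Tf: "T (bracket A e) = (- 3/2) *\<^sub>R bracket A e" if "e \<in> B" for e
  proof -
    have "ip u (bracket A e) = 0" if "u \<in> B" for u
    proof -
      have "bracket e u \<in> V" using bracket_V \<open>e \<in> B\<close> that B(2) by blast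
      then have "ip A (bracket e u) = 0" using orth ip_commute by metis
      then show ?thesis
        using ip_bracket[of A e u] A B_Bsp2 Bsp2_skew \<open>e \<in> B\<close> that by (simp add: ip_commute)
    qed
    then have "2 *\<^sub>R T (bracket A e) + 3 *\<^sub>R bracket A e = 0"
      using T_expansion[OF fB[OF that]] by simp
    then have "(1/2) *\<^sub>R (2 *\<^sub>R T (bracket A e)) = (1/2) *\<^sub>R (- (3 *\<^sub>R bracket A e))"
      by (simp only: add_eq_0_iff2)
    then show ?thesis by simp
  qed
  have Te: "T e = (7/2) *\<^sub>R e" if "e \<in> B" for e using that B(2) by (auto simp: V_iff)
  \<comment> \<open>70 and -30 are 20 times the eigenvalues 7/2 and -3/2; the minus sign in
    \<open>DK\<close> disappears when a skew factor moves across \<open>g\<close>.\<close>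
  have main: "(\<Sum>a\<in>UNIV. \<Sum>b\<in>UNIV. \<Sum>c\<in>UNIV. DK y (h a) (h b) (h c) * K z (h a) (h b) (h c))
    = (\<Sum>e\<in>B. 70 * g (e *v (bracket A e *v y)) z - 30 * g (bracket A e *v (e *v y)) z)" for y z
  proof -
    have "(\<Sum>b\<in>UNIV. \<Sum>c\<in>UNIV. DK y a (h b) (h c) * K z a (h b) (h c))
      = - 10 * (\<Sum>e\<in>B. 7 * (g (bracket A e *v y) a * g (e *v z) a)
          - 3 * (g (e *v y) a * g (bracket A e *v z) a))" for a
    proof -
      have "(\<Sum>b\<in>UNIV. \<Sum>c\<in>UNIV. DK y a (h b) (h c) * K z a (h b) (h c))
        = - 10 * (\<Sum>b\<in>UNIV. \<Sum>c\<in>UNIV. \<Sum>e\<in>B.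
            g (bracket A e *v y) a * (g (e *v h b) (h c) * K z a (h b) (h c))
            + g (e *v y) a * (g (bracket A e *v h b) (h c) * K z a (h b) (h c)))"
        unfolding DK by (simp add: sum_distrib_left sum_distrib_right sum_negf algebra_simps)
      also have "(\<Sum>b\<in>UNIV. \<Sum>c\<in>UNIV. \<Sum>e\<in>B.
            g (bracket A e *v y) a * (g (e *v h b) (h c) * K z a (h b) (h c))
            + g (e *v y) a * (g (bracket A e *v h b) (h c) * K z a (h b) (h c)))
        = (\<Sum>e\<in>B. \<Sum>b\<in>UNIV. \<Sum>c\<in>UNIV.
            g (bracket A e *v y) a * (g (e *v h b) (h c) * K z a (h b) (h c))
            + g (e *v y) a * (g (bracket A e *v h b) (h c) * K z a (h b) (h c)))"
        by (simp only: sum.swap[where A = "UNIV :: 8 set" and B = B])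
      also have "\<dots> = (\<Sum>e\<in>B. g (bracket A e *v y) a * (2 * g (T e *v z) a)
          + g (e *v y) a * (2 * g (T (bracket A e) *v z) a))"
        unfolding sum.distrib sum_distrib_left[symmetric] KT ..
      also have "\<dots> = (\<Sum>e\<in>B. 7 * (g (bracket A e *v y) a * g (e *v z) a)
          - 3 * (g (e *v y) a * g (bracket A e *v z) a))"
        by (intro sum.cong refl) (simp add: Te Tf uminus_mv g_l flip: scaleR_matrix_vector_assoc)
      finally show ?thesis .
    qed
    then have "(\<Sum>a\<in>UNIV. \<Sum>b\<in>UNIV. \<Sum>c\<in>UNIV. DK y (h a) (h b) (h c) * K z (h a) (h b) (h c))
      = - 10 * (\<Sum>a\<in>UNIV. \<Sum>e\<in>B. 7 * (g (bracket A e *v y) (h a) * g (e *v z) (h a))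
          - 3 * (g (e *v y) (h a) * g (bracket A e *v z) (h a)))"
      by (simp add: sum_distrib_left)
    also have "\<dots> = - 10 * (\<Sum>e\<in>B. 7 * (\<Sum>a\<in>UNIV. g (bracket A e *v y) (h a) * g (e *v z) (h a))
          - 3 * (\<Sum>a\<in>UNIV. g (e *v y) (h a) * g (bracket A e *v z) (h a)))"
      by (subst sum.swap) (simp add: sum_subtractf sum_distrib_left)
    also have "\<dots> = (\<Sum>e\<in>B. 70 * g (e *v (bracket A e *v y)) z - 30 * g (bracket A e *v (e *v y)) z)"
    proof -
      have "- 10 * (7 * g (e *v z) (bracket A e *v y) - 3 * g (bracket A e *v z) (e *v y))
          = 70 * g (e *v (bracket A e *v y)) z - 30 * g (bracket A e *v (e *v y)) z" if "e \<in>
              B" for e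
        using skewD[OF Bsp2_skew[OF B_Bsp2[OF that]], of z "bracket A e *v y"]
          skewD[OF Bsp2_skew[OF fB[OF that]], of z "e *v y"] sym[of z] by simp
      then show ?thesis unfolding contract[OF lin_r] sum_distrib_left
        by (intro sum.cong refl) (simp add: sym[of "_ *v z"])
    qed
    finally show ?thesis .
  qed
  \<comment> \<open>Exchanging \<open>y\<close> and \<open>z\<close> reverses a product of skew
    endomorphisms, so antisymmetrisation turns the weights 70 and -30 into 70 + 30 = 100 times a
    commutator.\<close>
  have sw: "g (e *v (f *v z)) y = g (f *v (e *v y)) z" if "skew e" "skew f" for e f
    using skewD[OF that(1), of "f *v z" y] skewD[OF that(2), of z "e *v y"] sym[of z] by simp
  have "(\<Sum>a\<in>UNIV. \<Sum>b\<in>UNIV. \<Sum>c\<in>UNIV.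
       DK y (h a) (h b) (h c) * K z (h a) (h b) (h c) - DK z (h a) (h b) (h c) * K y (h a) (h b)
           (h c))
    = (\<Sum>e\<in>B. (70 * g (e *v (bracket A e *v y)) z - 30 * g (bracket A e *v (e *v y)) z)
       - (70 * g (e *v (bracket A e *v z)) y - 30 * g (bracket A e *v (e *v z)) y))"
    by (simp add: sum_subtractf main)
  also have "\<dots> = (\<Sum>e\<in>B. - 100 * g (bracket e (bracket e A) *v y) z)"
  proof (rule sum.cong[OF refl])
    fix e assume "e \<in> B"
    then have sk: "skew e" "skew (bracket A e)" using B_Bsp2 fB Bsp2_skew by blast+
    have "bracket e A = - bracket A e" by (simp add: bracket_def)
    then have "g (bracket e (bracket e A) *v y) z
        = - (g (e *v (bracket A e *v y)) z - g (bracket A e *v (e *v y)) z)"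
      by (simp add: bracket_mv[of e] uminus_mv mv_neg g_l)
    then show "(70 * g (e *v (bracket A e *v y)) z - 30 * g (bracket A e *v (e *v y)) z)
       - (70 * g (e *v (bracket A e *v z)) y - 30 * g (bracket A e *v (e *v z)) y)
      = - 100 * g (bracket e (bracket e A) *v y) z"
      by (simp add: sw[OF sk] sw[OF sk(2) sk(1)])
  qed
  also have "\<dots> = 120 * g (A *v y) z"
    using casimir[OF A, of y z] by (simp add: orthB sum_negf flip: sum_distrib_left)
  finally show ?thesis by simp
qed

end

section \<open>Smooth functions on open sets\<close>

lemma frechet_derivative_eqI: "(f has_derivative f') (at x) \<Longrightarrow> frechet_derivative f (at x) = f'"
  using frechet_derivative_at by metis

lemma has_frechet_derivative: "f differentiable (at x) \<Longrightarrow>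
    (f has_derivative frechet_derivative f (at x)) (at x)"
  by (simp add: frechet_derivative_works)

lemma frechet_derivative_cong_open:
  assumes "open S" "x \<in> S" "\<And>y. y \<in> S \<Longrightarrow> f y = g y"
  shows "frechet_derivative f (at x) = frechet_derivative g (at x)"
proof -
  have "(f has_derivative D) (at x) \<longleftrightarrow> (g has_derivative D) (at x)" for D
    using has_derivative_transform_within_open[OF _ assms(1,2)] assms(3) by metis
  then show ?thesis by (simp add: frechet_derivative_def)
qed

text \<open>The derivatives in \<open>Ck_on\<close> are taken at points and not within
  \<open>S\<close>, so they see the values near a point; hence the open set.\<close>

lemma Ck_on_cong:
  assumes "open S" "\<And>y. y \<in> S \<Longrightarrow> f y = g y" "Ck_on k S f"
  shows "Ck_on k S g"
  using assms(2,3)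
proof (induction k arbitrary: f g)
  case 0
  then show ?case by (simp cong: continuous_on_cong)
next
  case (Suc k)
  have "g differentiable (at x)" if "x \<in> S" for x
  proof -
    have "f differentiable (at x)" using Suc.prems(2) that by simp
    from has_derivative_transform_within_open[OF has_frechet_derivative[OF this] assms(1) that
        Suc.prems(1)]
    show ?thesis unfolding differentiable_def by blast
  qed
  moreover have "Ck_on k S (\<lambda>x. frechet_derivative g (at x) v)" for v
  proof (rule Suc.IH)
    show "Ck_on k S (\<lambda>x. frechet_derivative f (at x) v)" using Suc.prems(2) by simp
    show "frechet_derivative f (at y) v = frechet_derivative g (at y) v" if "y \<in> S" for y
      using frechet_derivative_cong_open[OF assms(1) that Suc.prems(1)] by simp
  qed
  ultimately show ?case by simp
qed

lemma Ck_on_subset: "Ck_on k S f \<Longrightarrow> T \<subseteq> S \<Longrightarrow> Ck_on k T f"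
  by (induction k arbitrary: f) (auto intro: continuous_on_subset)

lemma Ck_on_SucD: "Ck_on (Suc k) S f \<Longrightarrow> Ck_on k S f"
proof (induction k arbitrary: f)
  case 0
  have "isCont f x" if "x \<in> S" for x
    using 0 that by (simp add: differentiable_imp_continuous_within)
  then show ?case by (simp add: continuous_at_imp_continuous_on)
next
  case (Suc k)
  have "Ck_on k S (\<lambda>x. frechet_derivative f (at x) v)" for v
    using Suc.prems by (intro Suc.IH) simp
  with Suc.prems show ?case by simp
qed

lemma Ck_on_local:
  assumes "\<And>x. x \<in> S \<Longrightarrow> \<exists>T. open T \<and> x \<in> T \<and> Ck_on k T f"
  shows "Ck_on k S f"
  using assms
proof (induction k arbitrary: f)
  case 0
  show ?case
    unfolding continuous_on_eq_continuous_within Ck_on.simps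
  proof
    fix x assume "x \<in> S"
    from 0[OF this] obtain T where T: "open T" "x \<in> T" "continuous_on T f" by auto
    then have "isCont f x" by (simp add: continuous_on_eq_continuous_at)
    then show "continuous (at x within S) f" by (rule continuous_at_imp_continuous_at_within)
  qed
next
  case (Suc k)
  have "f differentiable (at x)" if "x \<in> S" for x using Suc.prems[OF that] by auto
  moreover have "Ck_on k S (\<lambda>x. frechet_derivative f (at x) v)" for v
  proof (rule Suc.IH)
    fix x assume "x \<in> S"
    from Suc.prems[OF this] show "\<exists>T. open T \<and> x \<in> T
        \<and> Ck_on k T (\<lambda>x. frechet_derivative f (at x) v)"
      by auto
  qed
  ultimately show ?case by simp
qed

lemma Ck_on_const: "Ck_on k S (\<lambda>x. c)"
  by (induction k arbitrary: c) (auto simp: frechet_derivative_const)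

lemma Ck_on_bounded_linear:
  assumes "bounded_linear L" "open S" "Ck_on k S f"
  shows "Ck_on k S (\<lambda>x. L (f x))"
  using assms(3)
proof (induction k arbitrary: f)
  case 0
  then show ?case using bounded_linear.continuous_on[OF assms(1)] by auto
next
  case (Suc k)
  have d: "((\<lambda>x. L (f x)) has_derivative (\<lambda>v. L (frechet_derivative f (at x) v))) (at x)" if
      "x \<in> S" for x
    using Suc.prems that has_frechet_derivative
    by (intro bounded_linear.has_derivative[OF assms(1)]) auto
  have "Ck_on k S (\<lambda>x. frechet_derivative (\<lambda>x. L (f x)) (at x) v)" for v
  proof (rule Ck_on_cong[OF assms(2)])
    show "Ck_on k S (\<lambda>x. L (frechet_derivative f (at x) v))" using Suc by simp
  qed (simp add: frechet_derivative_eqI[OF d])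
  then show ?case using d by (auto simp: differentiable_def)
qed

lemma Ck_on_add:
  assumes "open S" "Ck_on k S f" "Ck_on k S g"
  shows "Ck_on k S (\<lambda>x. f x + g x)"
  using assms(2,3)
proof (induction k arbitrary: f g)
  case 0
  then show ?case by (auto intro: continuous_on_add)
next
  case (Suc k)
  have d: "((\<lambda>x. f x + g x) has_derivative (\<lambda>v. frechet_derivative f (at x) v
      + frechet_derivative g (at x) v)) (at x)"
    if "x \<in> S" for x
    using Suc.prems that has_frechet_derivative by (intro has_derivative_add) auto
  have "Ck_on k S (\<lambda>x. frechet_derivative (\<lambda>x. f x + g x) (at x) v)" for v
  proof (rule Ck_on_cong[OF assms(1)])
    show "Ck_on k S (\<lambda>x. frechet_derivative f (at x) v + frechet_derivative g (at x) v)" using Suc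
        by simp
  qed (simp add: frechet_derivative_eqI[OF d])
  then show ?case using d by (auto simp: differentiable_def)
qed

lemma Ck_on_bilinear:
  assumes "bounded_bilinear b" "open S" "Ck_on k S f" "Ck_on k S g"
  shows "Ck_on k S (\<lambda>x. b (f x) (g x))"
  using assms(3,4)
proof (induction k arbitrary: f g)
  case 0
  then show ?case using bounded_bilinear.continuous_on[OF assms(1)] by auto
next
  case (Suc k)
  have d: "((\<lambda>x. b (f x) (g x)) has_derivative
      (\<lambda>v. b (f x) (frechet_derivative g (at x) v) + b (frechet_derivative f (at x) v) (g x))) (at
          x)"
    if "x \<in> S" for x
    using Suc.prems that by (intro bounded_bilinear.FDERIV[OF assms(1)] has_frechet_derivative) auto
  have "Ck_on k S (\<lambda>x. frechet_derivative (\<lambda>x. b (f x) (g x)) (at x) v)" for v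
  proof (rule Ck_on_cong[OF assms(2)])
    show "Ck_on k S (\<lambda>x. b (f x) (frechet_derivative g (at x) v)
        + b (frechet_derivative f (at x) v) (g x))"
      using Suc.prems Ck_on_SucD[OF Suc.prems(1)] Ck_on_SucD[OF Suc.prems(2)]
      by (intro Ck_on_add[OF assms(2)] Suc.IH) simp_all
  qed (simp add: frechet_derivative_eqI[OF d])
  then show ?case using d by (auto simp: differentiable_def)
qed

lemma Ck_on_inverse:
  fixes f :: "'a::real_normed_vector \<Rightarrow> real"
  assumes "open S" "Ck_on k S f" "\<And>x. x \<in> S \<Longrightarrow> f x \<noteq> 0"
  shows "Ck_on k S (\<lambda>x. inverse (f x))"
  using assms(2)
proof (induction k)
  case 0
  then show ?case using assms(3) by (auto intro: continuous_on_inverse)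
next
  case (Suc k)
  have d: "((\<lambda>x. inverse (f x)) has_derivative
      (\<lambda>v. - (inverse (f x) * frechet_derivative f (at x) v * inverse (f x)))) (at x)"
    if "x \<in> S" for x
    using Suc.prems that has_frechet_derivative assms(3)
    by (intro Deriv.has_derivative_inverse) auto
  have I: "Ck_on k S (\<lambda>x. inverse (f x))" using Suc.IH[OF Ck_on_SucD[OF Suc.prems]] .
  have "Ck_on k S (\<lambda>x. frechet_derivative (\<lambda>x. inverse (f x)) (at x) v)" for v
  proof (rule Ck_on_cong[OF assms(1)])
    have "Ck_on k S (\<lambda>x. inverse (f x) * frechet_derivative f (at x) v * inverse (f x))"
      using Suc.prems I by (intro Ck_on_bilinear[OF bounded_bilinear_mult assms(1)]) auto
    then show "Ck_on k S (\<lambda>x. - (inverse (f x) * frechet_derivative f (at x) v * inverse (f x)))"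
      by (rule Ck_on_bounded_linear[OF bounded_linear_minus[OF bounded_linear_ident] assms(1)])
  qed (simp add: frechet_derivative_eqI[OF d])
  then show ?case using d by (auto simp: differentiable_def)
qed

lemma Ck_on_sum:
  assumes "open S" "\<And>i. i \<in> A \<Longrightarrow> Ck_on k S (f i)"
  shows "Ck_on k S (\<lambda>x. \<Sum>i\<in>A. f i x)"
  using assms(2) by (induction A rule: infinite_finite_induct) (auto simp: Ck_on_const
      Ck_on_add[OF assms(1)])

text \<open>\<open>Ck_on\<close> speaks of derivatives in fixed directions, but the chain rule
  applies the derivative of \<open>F\<close> to a vector depending on \<open>x\<close>. Expanding
  this vector in a basis, for which the middle space is Euclidean, gives a sum of products to which
  the induction applies.\<close>

lemma Ck_on_compose:
  fixes F :: "'b::euclidean_space \<Rightarrow> 'c::real_normed_vector"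
  assumes "open S" "open T" "f ` S \<subseteq> T" "Ck_on k S f" "Ck_on k T F"
  shows "Ck_on k S (\<lambda>x. F (f x))"
  using assms(4,5)
proof (induction k arbitrary: F)
  case 0
  then show ?case using continuous_on_compose2[of T F S f] assms(3) by auto
next
  case (Suc k)
  let ?D = "\<lambda>x v. \<Sum>b\<in>Basis. (frechet_derivative f (at x) v \<bullet> b) *\<^sub>R frechet_derivative F (at (f
      x)) b"
  have d: "((\<lambda>x. F (f x)) has_derivative ?D x) (at x)" if "x \<in> S" for x
  proof -
    have F: "(F has_derivative frechet_derivative F (at (f x))) (at (f x))"
    proof (rule has_frechet_derivative)
      have "f x \<in> T" using that assms(3) by blast
      then show "F differentiable (at (f x))" using Suc.prems(2) by simp
    qed
    then have lin: "linear (frechet_derivative F (at (f x)))"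
      using has_derivative_linear by blast
    have "((\<lambda>x. F (f x)) has_derivative (\<lambda>v. frechet_derivative F (at (f x)) (frechet_derivative f
        (at x) v))) (at x)"
      using Suc.prems(1) that
      by (intro has_derivative_compose[of f _ x UNIV F, OF _ F] has_frechet_derivative) simp
    moreover have rep: "frechet_derivative F (at (f x)) w
        = (\<Sum>b\<in>Basis. (w \<bullet> b) *\<^sub>R frechet_derivative F (at (f x)) b)" for w
      using linear_sum[OF lin, of "\<lambda>b. (w \<bullet> b) *\<^sub>R b" Basis]
          by (simp add: euclidean_representation linear_scale[OF lin])
    moreover have "(\<lambda>v. frechet_derivative F (at (f x)) (frechet_derivative f (at x) v)) = ?D x"
      by (rule ext) (rule rep)
    ultimately show ?thesis by argo
  qed
  have "Ck_on k S (\<lambda>x. frechet_derivative (\<lambda>x. F (f x)) (at x) v)" for v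
  proof (rule Ck_on_cong[OF assms(1)])
    have "Ck_on k S (\<lambda>x. frechet_derivative f (at x) v \<bullet> b)" for b
      using Suc.prems by (intro Ck_on_bounded_linear[OF bounded_linear_inner_left assms(1)]) simp
    moreover have "Ck_on k S (\<lambda>x. frechet_derivative F (at (f x)) b)" for b
      using Suc.prems Ck_on_SucD[OF Suc.prems(1)]
      by (intro Suc.IH[of "\<lambda>y. frechet_derivative F (at y) b"]) simp_all
    ultimately show "Ck_on k S (\<lambda>x. ?D x v)"
      by (intro Ck_on_sum[OF assms(1)] Ck_on_bilinear[OF bounded_bilinear_scaleR assms(1)])
  qed (simp add: frechet_derivative_eqI[OF d])
  then show ?case using d by (auto simp: differentiable_def)
qed

lemma smooth_on_cong:
  "open S \<Longrightarrow> (\<And>y. y \<in> S \<Longrightarrow> f y = g y) \<Longrightarrow> smooth_on S f \<Longrightarrow> smooth_on S g"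
  unfolding smooth_on_def using Ck_on_cong by metis

lemma smooth_on_subset: "smooth_on S f \<Longrightarrow> T \<subseteq> S \<Longrightarrow> smooth_on T f"
  unfolding smooth_on_def using Ck_on_subset by blast

lemma smooth_on_local: "(\<And>x. x \<in> S \<Longrightarrow> \<exists>T. open T \<and> x \<in> T \<and> smooth_on T f) \<Longrightarrow> smooth_on S f"
  unfolding smooth_on_def by (intro allI Ck_on_local) blast

lemma smooth_on_const: "smooth_on S (\<lambda>x. c)"
  by (simp add: smooth_on_def Ck_on_const)

lemma smooth_on_bounded_linear:
  "bounded_linear L \<Longrightarrow> open S \<Longrightarrow> smooth_on S f \<Longrightarrow> smooth_on S (\<lambda>x. L (f x))"
  by (simp add: smooth_on_def Ck_on_bounded_linear)

lemma smooth_on_add: "open S \<Longrightarrow> smooth_on S f \<Longrightarrow> smooth_on S g \<Longrightarrow> smooth_on S (\<lambda>x. f x + g x)"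
  by (simp add: smooth_on_def Ck_on_add)

lemma smooth_on_sum: "open S \<Longrightarrow> (\<And>i. i \<in> A \<Longrightarrow> smooth_on S (f i)) \<Longrightarrow> smooth_on S (\<lambda>x. \<Sum>i\<in>A. f i x)"
  by (simp add: smooth_on_def Ck_on_sum)

lemma smooth_on_mult:
  fixes f g :: "_ \<Rightarrow> real"
  shows "open S \<Longrightarrow> smooth_on S f \<Longrightarrow> smooth_on S g \<Longrightarrow> smooth_on S (\<lambda>x. f x * g x)"
  by (simp add: smooth_on_def Ck_on_bilinear[OF bounded_bilinear_mult])

lemma smooth_on_scaleR: "open S \<Longrightarrow> smooth_on S f \<Longrightarrow> smooth_on S g \<Longrightarrow> smooth_on S (\<lambda>x. f x *\<^sub>R g x)"
  by (simp add: smooth_on_def Ck_on_bilinear[OF bounded_bilinear_scaleR])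

lemma smooth_on_inverse:
  fixes f :: "_ \<Rightarrow> real"
  shows "open S \<Longrightarrow> smooth_on S f \<Longrightarrow> (\<And>x. x \<in> S \<Longrightarrow> f x \<noteq> 0) \<Longrightarrow> smooth_on S (\<lambda>x. inverse (f x))"
  by (simp add: smooth_on_def Ck_on_inverse)

lemma smooth_on_compose:
  fixes F :: "'b::euclidean_space \<Rightarrow> 'c::real_normed_vector"
  shows "open S \<Longrightarrow> open T \<Longrightarrow> f ` S \<subseteq> T \<Longrightarrow> smooth_on S f \<Longrightarrow> smooth_on T F \<Longrightarrow> smooth_on S (\<lambda>x. F (f x))"
  by (simp add: smooth_on_def Ck_on_compose)

lemma smooth_on_Suc: "smooth_on S f \<Longrightarrow> Ck_on (Suc k) S f"
  unfolding smooth_on_def by blast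

lemma smooth_on_differentiable: "smooth_on S f \<Longrightarrow> x \<in> S \<Longrightarrow> f differentiable (at x)"
  using smooth_on_Suc[of S f 0] by simp

lemma smooth_on_frechet_derivative: "smooth_on S f \<Longrightarrow>
    smooth_on S (\<lambda>x. frechet_derivative f (at x) v)"
  unfolding smooth_on_def[of S "\<lambda>x. frechet_derivative f (at x) v"]
  using smooth_on_Suc[of S f] by simp

section \<open>Smooth fields and functions on a manifold\<close>

locale smooth_manifold =
  fixes \<A> :: "'m::topological_space chart set"
  assumes atlas: "smooth_atlas \<A>"
begin

lemma chart_at: "chart_at \<A> p \<in> \<A>" "p \<in> dom_of (chart_at \<A> p)"
proof -
  have "\<exists>c. c \<in> \<A> \<and> p \<in> dom_of c" using atlas unfolding smooth_atlas_def by blast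
  from someI_ex[OF this] show "chart_at \<A> p \<in> \<A>" "p \<in> dom_of (chart_at \<A> p)"
    by (auto simp: chart_at_def)
qed

lemma is_chartD: "c \<in> \<A> \<Longrightarrow> is_chart c"
  using atlas by (simp add: smooth_atlas_def)

lemma open_dom: "c \<in> \<A> \<Longrightarrow> open (dom_of c)"
  using is_chartD by (simp add: is_chart_def)

lemma inv_chart_map: "c \<in> \<A> \<Longrightarrow> q \<in> dom_of c \<Longrightarrow> inv_chart c (map_of_chart c q) = q"
  using is_chartD[of c] by (simp add: is_chart_def homeomorphism_def)

lemma open_image:
  assumes "c \<in> \<A>" "open W"
  shows "open (map_of_chart c ` (W \<inter> dom_of c))"
proof -
  have c: "open (map_of_chart c ` dom_of c)" "open (dom_of c)"
    "homeomorphism (dom_of c) (map_of_chart c ` dom_of c) (map_of_chart c) (inv_chart c)"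
    using is_chartD[OF assms(1)] by (auto simp: is_chart_def)
  have "openin (top_of_set (dom_of c)) (W \<inter> dom_of c)"
    using assms(2) by (auto simp: openin_open)
  from homeomorphism_imp_open_map[OF c(3) this] show ?thesis
    using c(1) by (rule openin_open_trans)
qed

lemma open_image_subset:
  assumes "c \<in> \<A>" "open W" "W \<subseteq> dom_of c"
  shows "open (map_of_chart c ` W)"
  using open_image[OF assms(1,2)] assms(3) by (simp add: Int_absorb2)

lemma smooth_transition_map:
  assumes "c \<in> \<A>" "c' \<in> \<A>"
  shows "smooth_on (map_of_chart c ` (dom_of c \<inter> dom_of c')) (map_of_chart c' \<circ> inv_chart c)"
  using atlas assms by (simp add: smooth_atlas_def)

lemma transition_has_derivative:
  assumes "c \<in> \<A>" "c' \<in> \<A>" "p \<in> dom_of c" "p \<in> dom_of c'"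
  shows "((map_of_chart c' \<circ> inv_chart c) has_derivative transition c c' p) (at (map_of_chart c p))"
proof -
  have "(map_of_chart c' \<circ> inv_chart c) differentiable (at (map_of_chart c p))"
    using smooth_on_differentiable[OF smooth_transition_map[OF assms(1,2)]] assms(3,4) by blast
  from has_frechet_derivative[OF this] show ?thesis by (simp add: transition_def[abs_def])
qed

lemma linear_transition:
  assumes "c \<in> \<A>" "c' \<in> \<A>" "p \<in> dom_of c" "p \<in> dom_of c'"
  shows "linear (transition c c' p)"
  using transition_has_derivative[OF assms] by (rule has_derivative_linear)

text \<open>The chain rule: near \<open>p\<close>, where all three charts are defined, the
  coordinate changes compose.\<close>

lemma transition_compose:
  assumes "c \<in> \<A>" "c' \<in> \<A>" "c'' \<in> \<A>" "p \<in> dom_of c" "p \<in> dom_of c'" "p \<in> dom_of c''"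
  shows "transition c' c'' p (transition c c' p v) = transition c c'' p v"
proof -
  let ?W = "dom_of c \<inter> dom_of c' \<inter> dom_of c''"
  let ?S = "map_of_chart c ` (?W \<inter> dom_of c)"
  have S: "open ?S" "map_of_chart c p \<in> ?S"
    using assms by (intro open_image open_Int open_dom imageI; simp)+
  have "((map_of_chart c'' \<circ> inv_chart c') has_derivative transition c' c'' p)
      (at ((map_of_chart c' \<circ> inv_chart c) (map_of_chart c p)))"
    using transition_has_derivative[OF assms(2,3,5,6)] assms by (simp add: inv_chart_map)
  from diff_chain_at[OF transition_has_derivative[OF assms(1,2,4,5)] this]
  have "(map_of_chart c'' \<circ> inv_chart c' \<circ> (map_of_chart c' \<circ> inv_chart c) has_derivative
      transition c' c'' p \<circ> transition c c' p) (at (map_of_chart c p))" .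
  moreover have "(map_of_chart c'' \<circ> inv_chart c' \<circ> (map_of_chart c' \<circ> inv_chart c)) y
      = (map_of_chart c'' \<circ> inv_chart c) y" if "y \<in> ?S" for y
    using that assms by (auto simp: inv_chart_map)
  ultimately have "((map_of_chart c'' \<circ> inv_chart c) has_derivative
      transition c' c'' p \<circ> transition c c' p) (at (map_of_chart c p))"
    using has_derivative_transform_within_open[OF _ S] by blast
  from has_derivative_unique[OF this transition_has_derivative[OF assms(1,3,4,6)]]
  show ?thesis by (metis comp_apply)
qed

lemma transition_same:
  assumes "c \<in> \<A>" "p \<in> dom_of c"
  shows "transition c c p v = v"
proof -
  have S: "open (map_of_chart c ` dom_of c)" "map_of_chart c p \<in> map_of_chart c ` dom_of c"
    using assms open_dom open_image_subset by auto
  have "((map_of_chart c \<circ> inv_chart c) has_derivative (\<lambda>v. v)) (at (map_of_chart c p))"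
    by (rule has_derivative_transform_within_open[OF has_derivative_ident S])
      (use assms in \<open>auto simp: inv_chart_map\<close>)
  from has_derivative_unique[OF this transition_has_derivative[OF assms(1,1,2,2)]]
  show ?thesis by metis
qed

lemma components_map:
  assumes "c \<in> \<A>" "q \<in> dom_of c"
  shows "components \<A> c X (map_of_chart c q) = transition (chart_at \<A> q) c q (X q)"
  using assms by (simp add: components_def inv_chart_map)

lemma components_change:
  assumes "c \<in> \<A>" "c' \<in> \<A>" "q \<in> dom_of c" "q \<in> dom_of c'"
  shows "components \<A> c' X (map_of_chart c' q)
      = transition c c' q (components \<A> c X (map_of_chart c q))"
  using assms by (simp add: components_map transition_compose chart_at)

text \<open>The point is read in \<open>c'\<close> but the derivative is taken in \<open>c\<close>,
  so smoothness comes from composing the derivative with the coordinate change from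
  \<open>c'\<close> to \<open>c\<close>.\<close>

lemma smooth_transition:
  assumes "c \<in> \<A>" "c' \<in> \<A>" "open W" "W \<subseteq> dom_of c" "W \<subseteq> dom_of c'"
  shows "smooth_on (map_of_chart c' ` W) (\<lambda>u. transition c c' (inv_chart c' u) b)"
proof -
  let ?F = "\<lambda>x. frechet_derivative (map_of_chart c' \<circ> inv_chart c) (at x) b"
  have "smooth_on (map_of_chart c' ` W) (\<lambda>u. ?F ((map_of_chart c \<circ> inv_chart c') u))"
  proof (rule smooth_on_compose[where F = ?F])
    show "open (map_of_chart c' ` W)" using assms open_image_subset by blast
    show "open (map_of_chart c ` (dom_of c \<inter> dom_of c'))"
      using open_image[OF assms(1) open_dom[OF assms(2)]] by (simp add: Int_commute)
    show "smooth_on (map_of_chart c' ` W) (map_of_chart c \<circ> inv_chart c')"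
      by (rule smooth_on_subset[OF smooth_transition_map[OF assms(2,1)]]) (use assms in auto)
    show "(map_of_chart c \<circ> inv_chart c') ` map_of_chart c' ` W \<subseteq> map_of_chart c ` (dom_of c \<inter>
        dom_of c')"
      using assms by (auto simp: inv_chart_map subset_iff)
    show "smooth_on (map_of_chart c ` (dom_of c \<inter> dom_of c')) ?F"
      by (rule smooth_on_frechet_derivative[OF smooth_transition_map[OF assms(1,2)]])
  qed
  then show ?thesis by (simp add: transition_def)
qed

text \<open>Smoothness is demanded in every chart; compatibility of the atlas reduces it to one
  chart around each point.\<close>

lemma smooth_funI:
  assumes "\<And>p. p \<in> U \<Longrightarrow> \<exists>c\<in>\<A>. \<exists>W. open W \<and> p \<in> W \<and> W \<subseteq> dom_of c \<and>
    smooth_on (map_of_chart c ` W) (f \<circ> inv_chart c)"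
  shows "smooth_fun \<A> U f"
  unfolding smooth_fun_def
proof (intro ballI smooth_on_local)
  fix c' x assume c': "c' \<in> \<A>" and "x \<in> map_of_chart c' ` (U \<inter> dom_of c')"
  then obtain p where p: "x = map_of_chart c' p" "p \<in> U" "p \<in> dom_of c'" by auto
  then obtain c W where c: "c \<in> \<A>" "open W" "p \<in> W" "W \<subseteq> dom_of c"
    "smooth_on (map_of_chart c ` W) (f \<circ> inv_chart c)" using assms by blast
  let ?T = "map_of_chart c' ` (W \<inter> dom_of c')"
  have T: "open ?T" using c c' open_image by blast
  have "smooth_on ?T (\<lambda>u. (f \<circ> inv_chart c) ((map_of_chart c \<circ> inv_chart c') u))"
  proof (rule smooth_on_compose[OF T _ _ _ c(5)])
    show "open (map_of_chart c ` W)" using c open_image_subset by blast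
    show "smooth_on ?T (map_of_chart c \<circ> inv_chart c')"
      by (rule smooth_on_subset[OF smooth_transition_map[OF c' c(1)]]) (use c in auto)
    show "(map_of_chart c \<circ> inv_chart c') ` ?T \<subseteq> map_of_chart c ` W"
      using c c' by (auto simp: inv_chart_map)
  qed
  then have "smooth_on ?T (f \<circ> inv_chart c')"
    by (rule smooth_on_cong[OF T, rotated]) (use c c' in \<open>auto simp: inv_chart_map subset_iff\<close>)
  then show "\<exists>T. open T \<and> x \<in> T \<and> smooth_on T (f \<circ> inv_chart c')" using T p c by blast
qed

lemma smooth_fieldI:
  assumes "\<And>p. p \<in> U \<Longrightarrow> \<exists>c\<in>\<A>. \<exists>W. open W \<and> p \<in> W \<and> W \<subseteq> dom_of c \<and>
    smooth_on (map_of_chart c ` W) (components \<A> c X)"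
  shows "smooth_field \<A> U X"
  unfolding smooth_field_def
proof (intro ballI smooth_on_local)
  fix c' x assume c': "c' \<in> \<A>" and "x \<in> map_of_chart c' ` (U \<inter> dom_of c')"
  then obtain p where p: "x = map_of_chart c' p" "p \<in> U" "p \<in> dom_of c'" by auto
  then obtain c W where c: "c \<in> \<A>" "open W" "p \<in> W" "W \<subseteq> dom_of c"
    "smooth_on (map_of_chart c ` W) (components \<A> c X)" using assms by blast
  let ?T = "map_of_chart c' ` (W \<inter> dom_of c')"
  let ?X = "\<lambda>u. components \<A> c X ((map_of_chart c \<circ> inv_chart c') u)"
  have T: "open ?T" using c c' open_image by blast
  have "smooth_on ?T ?X"
  proof (rule smooth_on_compose[OF T _ _ _ c(5)])
    show "open (map_of_chart c ` W)" using c open_image_subset by blast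
    show "smooth_on ?T (map_of_chart c \<circ> inv_chart c')"
      by (rule smooth_on_subset[OF smooth_transition_map[OF c' c(1)]]) (use c in auto)
    show "(map_of_chart c \<circ> inv_chart c') ` ?T \<subseteq> map_of_chart c ` W"
      using c c' by (auto simp: inv_chart_map)
  qed
  then have "smooth_on ?T (\<lambda>u. ?X u \<bullet> b)" for b
    by (rule smooth_on_bounded_linear[OF bounded_linear_inner_left T])
  moreover have "smooth_on ?T (\<lambda>u. transition c c' (inv_chart c' u) b)" for b
    using c c' by (intro smooth_transition open_Int open_dom) auto
  \<comment> \<open>The components in \<open>c'\<close> arise from a linear map and a vector that
    both vary with \<open>u\<close>; the basis expansion separates the two.\<close>
  ultimately have "smooth_on ?T (\<lambda>u. \<Sum>b\<in>Basis. (?X u \<bullet> b) *\<^sub>R transition c c' (inv_chart c' u) b)"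
    by (intro smooth_on_sum T smooth_on_scaleR)
  then have "smooth_on ?T (components \<A> c' X)"
  proof (rule smooth_on_cong[OF T, rotated])
    fix u assume "u \<in> ?T"
    then obtain q where q: "u = map_of_chart c' q" "q \<in> W" "q \<in> dom_of c'" "q \<in> dom_of c"
      using c(4) by auto
    have lin: "linear (transition c c' q)" using c c' q by (intro linear_transition)
    have "components \<A> c' X u = transition c c' q (\<Sum>b\<in>Basis. (?X u \<bullet> b) *\<^sub>R b)"
      using q c c' by (simp add: components_change[of c c'] inv_chart_map euclidean_representation)
    also have "\<dots> = (\<Sum>b\<in>Basis. (?X u \<bullet> b) *\<^sub>R transition c c' (inv_chart c' u) b)"
      using q c' by (simp add: linear_sum[OF lin] linear_scale[OF lin] inv_chart_map)
    finally show "(\<Sum>b\<in>Basis. (?X u \<bullet> b) *\<^sub>R transition c c' (inv_chart c' u) b)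
        = components \<A> c' X u" ..
  qed
  then show "\<exists>T. open T \<and> x \<in> T \<and> smooth_on T (components \<A> c' X)" using T p c by blast
qed

lemma smooth_field_subset: "smooth_field \<A> U X \<Longrightarrow> V \<subseteq> U \<Longrightarrow> smooth_field \<A> V X"
  unfolding smooth_field_def by (blast intro: smooth_on_subset)

lemma smooth_fun_chart: "smooth_fun \<A> U f \<Longrightarrow> c \<in> \<A> \<Longrightarrow>
    smooth_on (map_of_chart c ` (U \<inter> dom_of c)) (f \<circ> inv_chart c)"
  by (simp add: smooth_fun_def)

lemma smooth_field_chart: "smooth_field \<A> U X \<Longrightarrow> c \<in> \<A> \<Longrightarrow>
    smooth_on (map_of_chart c ` (U \<inter> dom_of c)) (components \<A> c X)"
  by (simp add: smooth_field_def)

lemma smooth_field_local: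
  assumes "\<And>p. p \<in> U \<Longrightarrow> \<exists>V. open V \<and> p \<in> V \<and> smooth_field \<A> V X"
  shows "smooth_field \<A> U X"
proof (rule smooth_fieldI)
  fix p assume "p \<in> U"
  then obtain V where "open V" "p \<in> V" "smooth_field \<A> V X" using assms by blast
  then show "\<exists>c\<in>\<A>. \<exists>W. open W \<and> p \<in> W \<and> W \<subseteq> dom_of c
      \<and> smooth_on (map_of_chart c ` W) (components \<A> c X)"
    using chart_at[of p] open_dom[of "chart_at \<A> p"] smooth_field_chart[of V X "chart_at \<A> p"]
    by (intro bexI[of _ "chart_at \<A> p"] exI[of _
        "V \<inter> dom_of (chart_at \<A> p)"] conjI open_Int) simp_all
qed

lemma smooth_field_cong:
  assumes "open U" "\<And>q. q \<in> U \<Longrightarrow> X q = X' q" "smooth_field \<A> U X"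
  shows "smooth_field \<A> U X'"
  unfolding smooth_field_def
proof
  fix c assume c: "c \<in> \<A>"
  show "smooth_on (map_of_chart c ` (U \<inter> dom_of c)) (components \<A> c X')"
    by (rule smooth_on_cong[OF open_image[OF c assms(1)] _ smooth_field_chart[OF assms(3) c]])
      (use assms(2) c in \<open>auto simp: inv_chart_map components_def\<close>)
qed

lemma smooth_fun_const: "smooth_fun \<A> U (\<lambda>q. k)"
  unfolding smooth_fun_def by (simp add: o_def smooth_on_const)

lemma smooth_fun_add: "open U \<Longrightarrow> smooth_fun \<A> U f \<Longrightarrow> smooth_fun \<A> U f' \<Longrightarrow>
    smooth_fun \<A> U (\<lambda>q. f q + f' q)"
  unfolding smooth_fun_def by (auto simp: o_def intro!: smooth_on_add open_image)

lemma smooth_fun_mult: "open U \<Longrightarrow> smooth_fun \<A> U f \<Longrightarrow> smooth_fun \<A> U f' \<Longrightarrow>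
    smooth_fun \<A> U (\<lambda>q. f q * f' q)"
  unfolding smooth_fun_def by (auto simp: o_def intro!: smooth_on_mult open_image)

lemma smooth_fun_minus: "open U \<Longrightarrow> smooth_fun \<A> U f \<Longrightarrow> smooth_fun \<A> U (\<lambda>q. - f q)"
  using smooth_fun_mult[OF _ smooth_fun_const[of U "-1"]] by simp

lemma smooth_fun_inverse:
  assumes "open U" "smooth_fun \<A> U f" "\<And>q. q \<in> U \<Longrightarrow> f q \<noteq> 0"
  shows "smooth_fun \<A> U (\<lambda>q. inverse (f q))"
  unfolding smooth_fun_def
proof
  fix c assume c: "c \<in> \<A>"
  have "smooth_on (map_of_chart c ` (U \<inter> dom_of c)) (\<lambda>u. inverse ((f \<circ> inv_chart c) u))"
    by (rule smooth_on_inverse[OF open_image[OF c assms(1)] smooth_fun_chart[OF assms(2) c]])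
      (use assms(3) c in \<open>auto simp: inv_chart_map\<close>)
  then show "smooth_on (map_of_chart c ` (U \<inter> dom_of c)) ((\<lambda>q. inverse (f q)) \<circ> inv_chart c)"
    by (simp add: o_def)
qed

lemma smooth_fun_sum: "open U \<Longrightarrow> (\<And>i. i \<in> A \<Longrightarrow> smooth_fun \<A> U (f i)) \<Longrightarrow>
    smooth_fun \<A> U (\<lambda>q. \<Sum>i\<in>A. f i q)"
  by (induction A rule: infinite_finite_induct) (auto simp: smooth_fun_const smooth_fun_add)

lemma smooth_fun_prod: "open U \<Longrightarrow> (\<And>i. i \<in> A \<Longrightarrow> smooth_fun \<A> U (f i)) \<Longrightarrow>
    smooth_fun \<A> U (\<lambda>q. \<Prod>i\<in>A. f i q)"
  by (induction A rule: infinite_finite_induct) (auto simp: smooth_fun_const smooth_fun_mult)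

lemma smooth_field_add:
  assumes "open U" "smooth_field \<A> U X" "smooth_field \<A> U Y"
  shows "smooth_field \<A> U (\<lambda>q. X q + Y q)"
  unfolding smooth_field_def
proof
  fix c assume c: "c \<in> \<A>"
  have S: "open (map_of_chart c ` (U \<inter> dom_of c))" by (rule open_image[OF c assms(1)])
  show "smooth_on (map_of_chart c ` (U \<inter> dom_of c)) (components \<A> c (\<lambda>q. X q + Y q))"
    by (rule smooth_on_cong[OF S _ smooth_on_add[OF S smooth_field_chart[OF assms(2) c]
        smooth_field_chart[OF assms(3) c]]])
      (use c in \<open>auto simp: components_map linear_add[OF linear_transition] chart_at\<close>)
qed

lemma smooth_field_scaleR:
  assumes "open U" "smooth_fun \<A> U f" "smooth_field \<A> U X"
  shows "smooth_field \<A> U (\<lambda>q. f q *\<^sub>R X q)"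
  unfolding smooth_field_def
proof
  fix c assume c: "c \<in> \<A>"
  have S: "open (map_of_chart c ` (U \<inter> dom_of c))" by (rule open_image[OF c assms(1)])
  show "smooth_on (map_of_chart c ` (U \<inter> dom_of c)) (components \<A> c (\<lambda>q. f q *\<^sub>R X q))"
    by (rule smooth_on_cong[OF S _ smooth_on_scaleR[OF S smooth_fun_chart[OF assms(2) c]
        smooth_field_chart[OF assms(3) c]]])
      (use c in \<open>auto simp: components_map linear_scale[OF linear_transition] chart_at
          inv_chart_map\<close>)
qed

lemma smooth_field_zero: "open U \<Longrightarrow> smooth_field \<A> U (\<lambda>q. 0)"
proof -
  assume U: "open U"
  show ?thesis
    unfolding smooth_field_def
  proof
    fix c assume c: "c \<in> \<A>"
    show "smooth_on (map_of_chart c ` (U \<inter> dom_of c)) (components \<A> c (\<lambda>q. 0))"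
      by (rule smooth_on_cong[OF open_image[OF c U] _ smooth_on_const[of _ 0]])
        (use c in \<open>auto simp: components_map linear_0[OF linear_transition] chart_at\<close>)
  qed
qed

lemma smooth_field_sum:
  "open U \<Longrightarrow> (\<And>i. i \<in> A \<Longrightarrow> smooth_field \<A> U (X i)) \<Longrightarrow> smooth_field \<A> U (\<lambda>q. \<Sum>i\<in>A. X i q)"
  by (induction A rule: infinite_finite_induct) (auto simp: smooth_field_zero smooth_field_add)

lemma smooth_field_diff:
  assumes "open U" "smooth_field \<A> U X" "smooth_field \<A> U Y"
  shows "smooth_field \<A> U (\<lambda>q. X q - Y q)"
  using smooth_field_add[OF assms(1,2) smooth_field_scaleR[OF assms(1) smooth_fun_const[of U
      "-1"] assms(3)]]
  by simp

abbreviation chart_dom :: "'m \<Rightarrow> 'm set" where "chart_dom p \<equiv> dom_of (chart_at \<A> p)"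

lemma open_chart_dom: "open (chart_dom p)"
  using open_dom chart_at by blast

lemma extend_same: "extend \<A> p y p = y"
  by (simp add: extend_def transition_same chart_at)

lemma linear_extend: "q \<in> chart_dom p \<Longrightarrow> linear (\<lambda>y. extend \<A> p y q)"
  using linear_transition[OF chart_at(1)[of p] chart_at(1)[of q]] chart_at
      by (simp add: extend_def[abs_def])

lemma smooth_extend:
  assumes "U \<subseteq> chart_dom p"
  shows "smooth_field \<A> U (extend \<A> p y)"
proof (rule smooth_fieldI)
  fix r assume r: "r \<in> U"
  let ?c = "chart_at \<A> p"
  have "components \<A> ?c (extend \<A> p y) u = y" if "u \<in> map_of_chart ?c ` dom_of ?c" for u
    using that by (auto simp: components_map chart_at extend_def transition_compose transition_same)
  then have "smooth_on (map_of_chart ?c ` dom_of ?c) (components \<A> ?c (extend \<A> p y))"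
    using smooth_on_cong[OF open_image_subset[OF chart_at(1) open_chart_dom] _ smooth_on_const[of
        _ y]] by simp
  then show "\<exists>c\<in>\<A>. \<exists>W. open W \<and> r \<in> W \<and> W \<subseteq> dom_of c
      \<and> smooth_on (map_of_chart c ` W) (components \<A> c (extend \<A> p y))"
    using chart_at open_chart_dom r assms by blast
qed

text \<open>Coordinates in the one chart belonging to \<open>p\<close>, also at other points
  \<open>q\<close>: the raw vector \<open>Y q\<close> is written in \<open>chart_at \<A> q\<close>
  and need not vary smoothly.\<close>

definition coord :: "'m \<Rightarrow> ('m \<Rightarrow> vec) \<Rightarrow> 8 \<Rightarrow> 'm \<Rightarrow> real" where
  "coord p Y i q = transition (chart_at \<A> q) (chart_at \<A> p) q (Y q) $ i"

lemma coord_same: "coord p Y i p = Y p $ i"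
  by (simp add: coord_def transition_same chart_at)

lemma smooth_coord:
  assumes "open U" "smooth_field \<A> U Y"
  shows "smooth_fun \<A> (U \<inter> chart_dom p) (coord p Y i)"
proof (rule smooth_funI)
  fix r assume r: "r \<in> U \<inter> chart_dom p"
  let ?c = "chart_at \<A> p"
  let ?W = "U \<inter> dom_of ?c"
  have W: "open (map_of_chart ?c ` ?W)" using open_image chart_at assms by blast
  have "smooth_on (map_of_chart ?c ` ?W) (\<lambda>u. components \<A> ?c Y u $ i)"
    using smooth_field_chart[OF assms(2) chart_at(1)]
        by (intro smooth_on_bounded_linear[OF bounded_linear_vec_nth W])
  then have "smooth_on (map_of_chart ?c ` ?W) (coord p Y i \<circ> inv_chart ?c)"
    by (rule smooth_on_cong[OF W, rotated]) (auto simp: coord_def components_map chart_at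
        inv_chart_map)
  then show "\<exists>c\<in>\<A>. \<exists>W. open W \<and> r \<in> W \<and> W \<subseteq> dom_of c
      \<and> smooth_on (map_of_chart c ` W) (coord p Y i \<circ> inv_chart c)"
    using chart_at open_chart_dom r assms by (intro bexI[of _ ?c] exI[of _ ?W]) auto
qed

lemma field_expansion:
  assumes "q \<in> chart_dom p"
  shows "Y q = (\<Sum>i\<in>UNIV. coord p Y i q *\<^sub>R extend \<A> p (axis i 1) q)"
proof -
  let ?w = "transition (chart_at \<A> q) (chart_at \<A> p) q (Y q)"
  have "extend \<A> p ?w q = Y q"
    using assms by (simp add: extend_def transition_compose transition_same chart_at)
  moreover have "?w = (\<Sum>i\<in>UNIV. coord p Y i q *\<^sub>R axis i 1)"
    by (simp add: coord_def basis_expansion flip: scalar_mult_eq_scaleR)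
  ultimately show ?thesis
    using linear_sum[OF linear_extend[OF assms], of "\<lambda>i. coord p Y i q *\<^sub>R axis i 1" UNIV]
    by (simp add: linear_scale[OF linear_extend[OF assms]])
qed

lemma extend_expansion:
  assumes "q \<in> chart_dom p"
  shows "extend \<A> p y q = (\<Sum>i\<in>UNIV. (y $ i) *\<^sub>R extend \<A> p (axis i 1) q)"
proof -
  have "y = (\<Sum>i\<in>UNIV. (y $ i) *\<^sub>R axis i 1)"
    by (simp add: basis_expansion flip: scalar_mult_eq_scaleR)
  then show ?thesis
    using linear_sum[OF linear_extend[OF assms], of "\<lambda>i. (y $ i) *\<^sub>R axis i 1" UNIV]
    by (simp add: linear_scale[OF linear_extend[OF assms]])
qed

text \<open>Near \<open>p\<close> a field is a combination of coordinate fields with coefficients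
  \<open>coord p Y i\<close>; a local operator that is linear over functions takes these out as
  their values at \<open>p\<close>. The hypotheses allow smaller \<open>V\<close> because the
  expansion holds only in the chart of \<open>p\<close>.\<close>

lemma tensoriality:
  fixes F :: "('m \<Rightarrow> vec) \<Rightarrow> 'b::real_vector"
  assumes U: "open U" "p \<in> U" and Y: "smooth_field \<A> U Y"
    and loc: "\<And>V Y Z. open V \<Longrightarrow> p \<in> V \<Longrightarrow> V \<subseteq> U \<Longrightarrow> smooth_field \<A> V Y \<Longrightarrow> (\<And>q. q \<in> V \<Longrightarrow> Y q = Z q) \<Longrightarrow>
        F Y = F Z"
    and add: "\<And>V Y Z. open V \<Longrightarrow> p \<in> V \<Longrightarrow> V \<subseteq> U \<Longrightarrow> smooth_field \<A> V Y \<Longrightarrow> smooth_field \<A> V Z \<Longrightarrow>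
        F (\<lambda>q. Y q + Z q) = F Y + F Z"
    and mult: "\<And>V f Y. open V \<Longrightarrow> p \<in> V \<Longrightarrow> V \<subseteq> U \<Longrightarrow> smooth_fun \<A> V f \<Longrightarrow> smooth_field \<A> V Y \<Longrightarrow>
        F (\<lambda>q. f q *\<^sub>R Y q) = f p *\<^sub>R F Y"
  shows "F Y = F (extend \<A> p (Y p))"
    and "F Y = (\<Sum>i\<in>UNIV. (Y p $ i) *\<^sub>R F (extend \<A> p (axis i 1)))"
proof -
  let ?V = "U \<inter> chart_dom p"
  have V: "open ?V" "p \<in> ?V" "?V \<subseteq> U" using U open_chart_dom chart_at by auto
  let ?e = "\<lambda>i. extend \<A> p (axis i 1)"
  have e: "smooth_field \<A> ?V (?e i)" for i by (rule smooth_extend) simp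
  have z: "F (\<lambda>q. 0) = 0"
    using add[OF V, of "\<lambda>q. 0" "\<lambda>q. 0"] smooth_field_zero V by simp
  have sum: "F (\<lambda>q. \<Sum>i\<in>A. f i q *\<^sub>R ?e i q) = (\<Sum>i\<in>A. f i p *\<^sub>R F (?e i))"
    if "\<And>i. smooth_fun \<A> ?V (f i)" "finite A" for f and A :: "8 set"
    using that(2)
  proof (induction A rule: finite_induct)
    case empty
    then show ?case by (simp add: z)
  next
    case (insert j A)
    have "F (\<lambda>q. f j q *\<^sub>R ?e j q + (\<Sum>i\<in>A. f i q *\<^sub>R ?e i q)) = F (\<lambda>q. f j q *\<^sub>R ?e j q)
        + F (\<lambda>q. \<Sum>i\<in>A. f i q *\<^sub>R ?e i q)"
      by (intro add[OF V] smooth_field_scaleR smooth_field_sum V that e)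
    then show ?case using insert by (simp add: mult[OF V that(1) e])
  qed
  have "F Y = F (\<lambda>q. \<Sum>i\<in>UNIV. coord p Y i q *\<^sub>R ?e i q)"
    using field_expansion by (intro loc[OF V smooth_field_subset[OF Y]]) auto
  also have "\<dots> = (\<Sum>i\<in>UNIV. (Y p $ i) *\<^sub>R F (?e i))"
    using sum[of "coord p Y"] smooth_coord[OF U(1) Y] by (simp add: coord_same)
  finally show 1: "F Y = (\<Sum>i\<in>UNIV. (Y p $ i) *\<^sub>R F (?e i))" .
  have "F (extend \<A> p (Y p)) = F (\<lambda>q. \<Sum>i\<in>UNIV. (Y p $ i) *\<^sub>R ?e i q)"
    using extend_expansion by (intro loc[OF V smooth_extend]) auto
  also have "\<dots> = (\<Sum>i\<in>UNIV. (Y p $ i) *\<^sub>R F (?e i))"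
    using sum[of "\<lambda>i q. Y p $ i"] by (simp add: smooth_fun_const)
  finally show "F Y = F (extend \<A> p (Y p))" using 1 by simp
qed

lemma dir_deriv_has:
  assumes "open U" "p \<in> U" "smooth_fun \<A> U f"
  shows "((f \<circ> inv_chart (chart_at \<A> p)) has_derivative (\<lambda>x. dir_deriv \<A> p x f)) (at (map_of_chart
      (chart_at \<A> p) p))"
proof -
  have "(f \<circ> inv_chart (chart_at \<A> p)) differentiable (at (map_of_chart (chart_at \<A> p) p))"
    using smooth_on_differentiable[OF smooth_fun_chart[OF assms(3) chart_at(1)]] assms chart_at
        by blast
  from has_frechet_derivative[OF this] show ?thesis by (simp add: dir_deriv_def)
qed

lemma dir_deriv_eqI:
  assumes "((f \<circ> inv_chart (chart_at \<A> p)) has_derivative D) (at (map_of_chart (chart_at \<A> p) p))"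
  shows "dir_deriv \<A> p x f = D x"
  unfolding dir_deriv_def using frechet_derivative_eqI[OF assms] by simp

lemma dir_deriv_cong:
  assumes "open U" "p \<in> U" "\<And>q. q \<in> U \<Longrightarrow> f q = f' q"
  shows "dir_deriv \<A> p x f = dir_deriv \<A> p x f'"
  unfolding dir_deriv_def
proof (rule fun_cong[OF frechet_derivative_cong_open])
  let ?c = "chart_at \<A> p"
  show "open (map_of_chart ?c ` (U \<inter> dom_of ?c))" using open_image chart_at assms by blast
  show "map_of_chart ?c p \<in> map_of_chart ?c ` (U \<inter> dom_of ?c)" using assms chart_at by blast
  show "(f \<circ> inv_chart ?c) y = (f' \<circ> inv_chart ?c) y" if "y \<in> map_of_chart ?c ` (U \<inter> dom_of ?c)"
      for y
    using that assms(3) chart_at by (auto simp: inv_chart_map)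
qed

lemma dir_deriv_const: "dir_deriv \<A> p x (\<lambda>q. k) = 0"
  by (rule dir_deriv_eqI) (simp add: o_def)

lemma dir_deriv_add:
  assumes "open U" "p \<in> U" "smooth_fun \<A> U f" "smooth_fun \<A> U f'"
  shows "dir_deriv \<A> p x (\<lambda>q. f q + f' q) = dir_deriv \<A> p x f + dir_deriv \<A> p x f'"
  by (rule dir_deriv_eqI) (use has_derivative_add[OF dir_deriv_has[OF assms(1,2,3)]
      dir_deriv_has[OF assms(1,2,4)]] in \<open>simp add: o_def\<close>)

lemma dir_deriv_mult:
  assumes "open U" "p \<in> U" "smooth_fun \<A> U f" "smooth_fun \<A> U f'"
  shows "dir_deriv \<A> p x (\<lambda>q. f q * f' q) = f p * dir_deriv \<A> p x f' + dir_deriv \<A> p x f * f' p"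
  by (rule dir_deriv_eqI)
    (use has_derivative_mult[OF dir_deriv_has[OF assms(1,2,3)] dir_deriv_has[OF assms(1,2,4)]]
        chart_at in
      \<open>simp add: o_def inv_chart_map\<close>)

lemma dir_deriv_minus:
  assumes "open U" "p \<in> U" "smooth_fun \<A> U f"
  shows "dir_deriv \<A> p x (\<lambda>q. - f q) = - dir_deriv \<A> p x f"
  using dir_deriv_mult[OF assms(1,2) smooth_fun_const[of _ "-1"] assms(3)]
      by (simp add: dir_deriv_const)

lemma dir_deriv_sum:
  assumes "open U" "p \<in> U" "\<And>i. i \<in> A \<Longrightarrow> smooth_fun \<A> U (f i)"
  shows "dir_deriv \<A> p x (\<lambda>q. \<Sum>i\<in>A. f i q) = (\<Sum>i\<in>A. dir_deriv \<A> p x (f i))"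
  using assms(3)
proof (induction A rule: infinite_finite_induct)
  case (insert j A)
  then show ?case
    using dir_deriv_add[OF assms(1,2), of "f j"
        "\<lambda>q. \<Sum>i\<in>A. f i q"] smooth_fun_sum[OF assms(1), of A f] by simp
qed (auto simp: dir_deriv_const)

end

section \<open>Connections and metrics\<close>

lemma linear_connectionD:
  assumes "linear_connection \<A> D" "open U"
  shows "smooth_field \<A> U Y \<Longrightarrow> p \<in> U \<Longrightarrow> linear (\<lambda>x. D p x Y)"
    and "smooth_field \<A> U Y \<Longrightarrow> smooth_field \<A> U Z \<Longrightarrow> p \<in> U \<Longrightarrow>
        D p x (\<lambda>q. Y q + Z q) = D p x Y + D p x Z"
    and "smooth_fun \<A> U f \<Longrightarrow> smooth_field \<A> U Y \<Longrightarrow> p \<in> U \<Longrightarrow>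
      D p x (\<lambda>q. f q *\<^sub>R Y q) = dir_deriv \<A> p x f *\<^sub>R Y p + f p *\<^sub>R D p x Y"
    and "smooth_field \<A> U Y \<Longrightarrow> (\<And>q. q \<in> U \<Longrightarrow> Y q = Z q) \<Longrightarrow> p \<in> U \<Longrightarrow> D p x Y = D p x Z"
    and "smooth_field \<A> U X \<Longrightarrow> smooth_field \<A> U Y \<Longrightarrow> smooth_field \<A> U (\<lambda>q. D q (X q) Y)"
proof -
  note * = assms(1)[unfolded linear_connection_def, THEN spec, of U, THEN mp, OF assms(2)]
  show "smooth_field \<A> U Y \<Longrightarrow> p \<in> U \<Longrightarrow> linear (\<lambda>x. D p x Y)"
    using *[THEN conjunct1] by blast
  show "smooth_field \<A> U Y \<Longrightarrow> smooth_field \<A> U Z \<Longrightarrow> p \<in> U \<Longrightarrow> D p x (\<lambda>q. Y q + Z q) = D p x Y + D p x Z"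
    using *[THEN conjunct2, THEN conjunct1] by blast
  show "smooth_fun \<A> U f \<Longrightarrow> smooth_field \<A> U Y \<Longrightarrow> p \<in> U \<Longrightarrow>
      D p x (\<lambda>q. f q *\<^sub>R Y q) = dir_deriv \<A> p x f *\<^sub>R Y p + f p *\<^sub>R D p x Y"
    using *[THEN conjunct2, THEN conjunct2, THEN conjunct1] by blast
  show "smooth_field \<A> U Y \<Longrightarrow> (\<And>q. q \<in> U \<Longrightarrow> Y q = Z q) \<Longrightarrow> p \<in> U \<Longrightarrow> D p x Y = D p x Z"
    using *[THEN conjunct2, THEN conjunct2, THEN conjunct2, THEN conjunct1] by blast
  show "smooth_field \<A> U X \<Longrightarrow> smooth_field \<A> U Y \<Longrightarrow> smooth_field \<A> U (\<lambda>q. D q (X q) Y)"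
    using *[THEN conjunct2, THEN conjunct2, THEN conjunct2, THEN conjunct2] by blast
qed

context smooth_manifold
begin

text \<open>The derivative terms of the two Leibniz rules cancel.\<close>

lemma connection_difference_tensorial:
  assumes C: "linear_connection \<A> D" "linear_connection \<A> D'"
    and "open U" "p \<in> U" "smooth_field \<A> U Y"
  shows "D p x Y - D' p x Y = D p x (extend \<A> p (Y p)) - D' p x (extend \<A> p (Y p))"
proof (rule tensoriality(1)[OF assms(3-5), of "\<lambda>Y. D p x Y - D' p x Y"])
  fix V Y Z
  assume V: "open V" "p \<in> V" "V \<subseteq> U" "smooth_field \<A> V Y"
  { assume "\<And>q. q \<in> V \<Longrightarrow> Y q = Z q"
    then show "D p x Y - D' p x Y = D p x Z - D' p x Z"
      using linear_connectionD(4)[OF C(1) V(1,4) _ V(2), of Z x] linear_connectionD(4)[OF C(2)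
          V(1,4) _ V(2), of Z x] by simp }
  { assume "smooth_field \<A> V Z"
    then show "D p x (\<lambda>q. Y q + Z q) - D' p x (\<lambda>q. Y q + Z q) = D p x Y - D' p x Y + (D p x Z
        - D' p x Z)"
      using V by (simp add: linear_connectionD(2)[OF C(1) V(1)] linear_connectionD(2)[OF C(2)
          V(1)]) }
  { fix f assume "smooth_fun \<A> V f"
    then show "D p x (\<lambda>q. f q *\<^sub>R Y q) - D' p x (\<lambda>q. f q *\<^sub>R Y q) = f p *\<^sub>R (D p x Y - D' p x Y)"
      using V by (simp add: linear_connectionD(3)[OF C(1) V(1)] linear_connectionD(3)[OF C(2) V(1)]
          scaleR_right_diff_distrib) }
qed

lemma smooth_endoD:
  "smooth_endo \<A> U J \<Longrightarrow> open V \<Longrightarrow> V \<subseteq> U \<Longrightarrow> smooth_field \<A> V X \<Longrightarrow> smooth_field \<A> V (\<lambda>q. J q *v X q)"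
  unfolding smooth_endo_def by blast

text \<open>The commutator of \<open>D\<close> with \<open>J\<close> is tensorial, since
  \<open>J\<close> commutes with multiplication by functions; so the Leibniz rule passes from
  coordinate fields, where it is the definition, to all smooth fields.\<close>

lemma cov_deriv_endo_eq:
  assumes C: "linear_connection \<A> D" and J: "smooth_endo \<A> U J"
    and U: "open U" "p \<in> U" and Y: "smooth_field \<A> U Y"
  shows "D p x (\<lambda>q. J q *v Y q) = cov_deriv_endo \<A> D J p x *v Y p + J p *v D p x Y"
proof -
  let ?F = "\<lambda>Y. D p x (\<lambda>q. J q *v Y q) - J p *v D p x Y"
  let ?U = "U \<inter> chart_dom p"
  have *: "?F Y = ?F (extend \<A> p (Y p))"
      "?F Y = (\<Sum>i\<in>UNIV. (Y p $ i) *\<^sub>R ?F (extend \<A> p (axis i 1)))"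
    if U': "open U'" "p \<in> U'" "U' \<subseteq> U" "smooth_field \<A> U' Y" for Y U'
  proof -
    have loc: "?F Y = ?F Z" if V: "open V" "p \<in> V" "V \<subseteq> U'" "smooth_field \<A> V Y"
        and YZ: "\<And>q. q \<in> V \<Longrightarrow> Y q = Z q" for V Y Z
      using linear_connectionD(4)[OF C V(1,4) YZ V(2), of x]
        linear_connectionD(4)[OF C V(1) smooth_endoD[OF J V(1) _ V(4)] _ V(2), of
            "\<lambda>q. J q *v Z q" x] YZ V(3) U'(3) by simp
    have add: "?F (\<lambda>q. Y q + Z q) = ?F Y + ?F Z" if V: "open V" "p \<in> V" "V \<subseteq> U'"
        "smooth_field \<A> V Y" "smooth_field \<A> V Z" for V Y Z
    proof -
      have "V \<subseteq> U" using V U' by blast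
      then show ?thesis
        using linear_connectionD(2)[OF C V(1,4,5,2), of x]
          linear_connectionD(2)[OF C V(1) smooth_endoD[OF J V(1) _ V(4)] smooth_endoD[OF J V(1) _
              V(5)] V(2), of x]
        by (simp add: matrix_vector_right_distrib)
    qed
    have mult: "?F (\<lambda>q. f q *\<^sub>R Y q) = f p *\<^sub>R ?F Y" if V: "open V" "p \<in> V" "V \<subseteq> U'"
        "smooth_fun \<A> V f" "smooth_field \<A> V Y" for V f Y
    proof -
      have "V \<subseteq> U" using V U' by blast
      then show ?thesis
        using linear_connectionD(3)[OF C V(1,4,5,2), of x]
          linear_connectionD(3)[OF C V(1,4) smooth_endoD[OF J V(1) _ V(5)] V(2), of x]
        by (simp add: matrix_vector_right_distrib matrix_vector_mult_scaleR
            scaleR_right_diff_distrib)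
    qed
    show "?F Y = ?F (extend \<A> p (Y p))" "?F Y = (\<Sum>i\<in>UNIV. (Y p $ i) *\<^sub>R ?F (extend \<A> p (axis i 1)))"
      by (rule tensoriality[OF U'(1,2,4), where F = ?F]; (rule loc add mult; assumption))+
  qed
  have V: "open ?U" "p \<in> ?U" "?U \<subseteq> U" using U open_chart_dom chart_at by auto
  \<comment> \<open>\<open>cov_deriv_endo\<close> is a \<open>matrix\<close> and represents the map
    only if that map is linear, which the expansion in coordinate fields shows.\<close>
  define c where "c i = ?F (extend \<A> p (axis i 1))" for i
  have "?F (extend \<A> p y) = (\<Sum>i\<in>UNIV. (y $ i) *\<^sub>R c i)" for y
    using *(2)[OF V smooth_extend[of ?U p y]] by (simp add: extend_same c_def)
  moreover have "linear (\<lambda>y. \<Sum>i\<in>UNIV. (y $ i) *\<^sub>R c i)"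
    by (intro linearI) (simp_all add: scaleR_left_distrib sum.distrib scaleR_sum_right)
  ultimately have lin: "linear (\<lambda>y. ?F (extend \<A> p y))" by presburger
  have "cov_deriv_endo \<A> D J p x *v Y p = ?F (extend \<A> p (Y p))"
    unfolding cov_deriv_endo_def by (rule fun_cong[OF matrix_vector_mul(2)[OF lin]])
  then have "?F Y = cov_deriv_endo \<A> D J p x *v Y p" using *(1)[OF U order_refl Y] by argo
  then show ?thesis by (metis diff_add_cancel)
qed

end

section \<open>Riemannian metrics and the Levi-Civita connection\<close>

locale metric_manifold = smooth_manifold \<A> for \<A> :: "'m::topological_space chart set" +
  fixes g :: "'m \<Rightarrow> vec \<Rightarrow> vec \<Rightarrow> real"
  assumes riem: "riemannian_metric \<A> g"
begin

lemma g_linear: "linear (\<lambda>v. g p v y)" "linear (\<lambda>v. g p x v)"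
  using riem by (auto simp: riemannian_metric_def tensor2_field_def)

lemma g_sym: "g p x y = g p y x"
  using riem unfolding riemannian_metric_def by blast

lemma g_pos: "x \<noteq> 0 \<Longrightarrow> g p x x > 0"
  using riem unfolding riemannian_metric_def by blast

lemma smooth_g: "open U \<Longrightarrow> smooth_field \<A> U X \<Longrightarrow> smooth_field \<A> U Y \<Longrightarrow>
    smooth_fun \<A> U (\<lambda>q. g q (X q) (Y q))"
  using riem by (simp add: riemannian_metric_def tensor2_field_def)

lemmas g_simps = linear_add[OF g_linear(1)] linear_diff[OF g_linear(1)] linear_neg[OF g_linear(1)]
  linear_scale[OF g_linear(1)] linear_0[OF g_linear(1)] linear_add[OF g_linear(2)]
  linear_diff[OF g_linear(2)] linear_neg[OF g_linear(2)] linear_scale[OF g_linear(2)] linear_0[OF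
      g_linear(2)]

lemma frame: "orthonormal_frame (g p) (frame (g p))"
  unfolding frame_def
  using someI_ex[OF exists_orthonormal_frame[of "g p", OF g_linear g_sym g_pos]] .

sublocale fr: frame8 "g p" "frame (g p)" for p
  by (intro frame8.intro g_linear g_sym frame)

text \<open>In coordinates the field solves a linear system with the Gram matrix, and Cramer's rule
  writes its coefficients as quotients of determinants with smooth entries. This raises the index of
  \<open>d\<close>.\<close>

lemma smooth_dual:
  assumes U: "open U" and W: "\<And>q z. q \<in> U \<Longrightarrow> g q (W q) z = w q z"
    and w: "\<And>V Z. open V \<Longrightarrow> V \<subseteq> U \<Longrightarrow> smooth_field \<A> V Z \<Longrightarrow> smooth_fun \<A> V (\<lambda>q. w q (Z q))"
  shows "smooth_field \<A> U W"
proof (rule smooth_field_local)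
  fix p assume p: "p \<in> U"
  define V where "V = U \<inter> chart_dom p"
  have V: "open V" "p \<in> V" "V \<subseteq> U" "V \<subseteq> chart_dom p" using U p open_chart_dom chart_at
      by (auto simp: V_def)
  define e :: "8 \<Rightarrow> 'm \<Rightarrow> vec" where "e i = extend \<A> p (axis i 1)" for i
  have e: "smooth_field \<A> V (e i)" for i unfolding e_def by (rule smooth_extend[OF V(4)])
  define G :: "'m \<Rightarrow> endo" where "G q = (\<chi> i j. g q (e j q) (e i q))" for q
  define b :: "'m \<Rightarrow> vec" where "b q = (\<chi> i. w q (e i q))" for q
  have combine: "G q *v x = (\<chi> i. g q (extend \<A> p x q) (e i q))" if "q \<in> V" for q x
  proof -
    have q: "q \<in> chart_dom p" using that V by blast
    show ?thesis
      by (subst extend_expansion[OF q])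
        (simp add: G_def matrix_vector_mult_def fr.g_sum g_simps e_def mult.commute)
  qed
  \<comment> \<open>A vector in the kernel is orthogonal to the coordinate frame, hence to
    itself.\<close>
  have det: "det (G q) \<noteq> 0" if q: "q \<in> V" for q
  proof -
    have "x = 0" if "G q *v x = 0" for x
    proof -
      have qc: "q \<in> chart_dom p" using q V by blast
      have "g q (extend \<A> p x q) (e i q) = 0" for i
        using that unfolding combine[OF q] by (simp add: vec_eq_iff)
      then have "g q (extend \<A> p x q) (extend \<A> p x q) = 0"
        by (subst (2) extend_expansion[OF qc]) (simp add: fr.g_sum g_simps e_def)
      then have "extend \<A> p x q = 0" using g_pos[of "extend \<A> p x q" q] by fastforce
      then have "transition (chart_at \<A> q) (chart_at \<A> p) q (extend \<A> p x q) = 0"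
        using linear_0[OF linear_transition[OF chart_at(1) chart_at(1) chart_at(2) qc]] by simp
      then show "x = 0"
        using qc by (simp add: extend_def transition_compose transition_same chart_at)
    qed
    then show ?thesis
      by (metis invertible_det_nz invertible_left_inverse matrix_left_invertible_ker)
  qed
  define c :: "'m \<Rightarrow> vec" where "c q = (\<chi> k. det (\<chi> i j. if j
      = k then b q $ i else G q $ i $ j) / det (G q))" for q
  have Wc: "W q = (\<Sum>k\<in>UNIV. (c q $ k) *\<^sub>R e k q)" if q: "q \<in> V" for q
  proof -
    have qc: "q \<in> chart_dom p" "q \<in> U" using q V by auto
    define x :: vec where "x = (\<chi> i. coord p W i q)"
    have ext: "extend \<A> p x q = W q"
      using extend_expansion[OF qc(1), of x] field_expansion[OF qc(1), of W] by (simp add: x_def)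
    have "G q *v x = b q"
      unfolding combine[OF q] ext by (simp add: W[OF qc(2)] b_def)
    then have "x = c q" unfolding c_def using cramer[OF det[OF q]] by blast
    then show ?thesis using ext extend_expansion[OF qc(1), of x] by (simp add: e_def)
  qed
  have sG: "smooth_fun \<A> V (\<lambda>q. G q $ i $ j)" for i j
    by (simp add: G_def) (intro smooth_g V e)
  have sb: "smooth_fun \<A> V (\<lambda>q. b q $ i)" for i
    by (simp add: b_def) (intro w V e)
  have sdet: "smooth_fun \<A> V (\<lambda>q. det (H q))" if "\<And>i j. smooth_fun \<A> V (\<lambda>q. H q $ i $ j)" for H ::
      "'m \<Rightarrow> endo"
    unfolding det_def by (intro smooth_fun_sum smooth_fun_mult smooth_fun_prod smooth_fun_const V
        that)
  have "smooth_fun \<A> V (\<lambda>q. det (\<chi> i j. if j = k then b q $ i else G q $ i $ j))" for k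
  proof (rule sdet)
    show "smooth_fun \<A> V (\<lambda>q. (\<chi> i j. if j = k then b q $ i else G q $ i $ j) $ i $ j)" for i j
      using sG sb by (cases "j = k") simp_all
  qed
  moreover have "smooth_fun \<A> V (\<lambda>q. inverse (det (G q)))"
    by (rule smooth_fun_inverse[OF V(1) sdet[OF sG] det])
  ultimately have "smooth_fun \<A> V (\<lambda>q. det (\<chi> i j. if j
      = k then b q $ i else G q $ i $ j) * inverse (det (G q)))" for k
    by (rule smooth_fun_mult[OF V(1)])
  then have sc: "smooth_fun \<A> V (\<lambda>q. c q $ k)" for k
    by (simp add: c_def divide_inverse)
  have "smooth_field \<A> V W"
  proof (rule smooth_field_cong[OF V(1)])
    show "smooth_field \<A> V (\<lambda>q. \<Sum>k\<in>UNIV. (c q $ k) *\<^sub>R e k q)"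
      by (intro smooth_field_sum smooth_field_scaleR V sc e)
  qed (simp add: Wc)
  then show "\<exists>V. open V \<and> p \<in> V \<and> smooth_field \<A> V W" using V by blast
qed

text \<open>Parallelism is stated only for coordinate extensions. The defect is tensorial in each
  slot; \<open>sw\<close> exchanges the slots, so one of them is enough.\<close>

lemma metric_derivative:
  assumes C: "linear_connection \<A> N" and par: "\<And>p x y z. cov_deriv2 \<A> N g p x y z = 0"
    and U: "open U" "p \<in> U" and Y: "smooth_field \<A> U Y" and Z: "smooth_field \<A> U Z"
  shows "dir_deriv \<A> p x (\<lambda>q. g q (Y q) (Z q)) = g p (N p x Y) (Z p) + g p (Y p) (N p x Z)"
proof -
  let ?F = "\<lambda>Y Z. dir_deriv \<A> p x (\<lambda>q. g q (Y q) (Z q)) - g p (N p x Y) (Z p) - g p (Y p) (N p x Z)"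
  have 1: "?F Y Z = ?F (extend \<A> p (Y p)) Z" if U': "open U'" "p \<in> U'" "smooth_field \<A> U' Y"
      "smooth_field \<A> U' Z" for U' Y Z
  proof (rule tensoriality(1)[OF U'(1-3), of "\<lambda>Y. ?F Y Z"])
    fix V Y Y'
    assume V: "open V" "p \<in> V" "V \<subseteq> U'" "smooth_field \<A> V Y"
    have Z: "smooth_field \<A> V Z" using smooth_field_subset U' V by blast
    { assume YY: "\<And>q. q \<in> V \<Longrightarrow> Y q = Y' q"
      have "dir_deriv \<A> p x (\<lambda>q. g q (Y q) (Z q)) = dir_deriv \<A> p x (\<lambda>q. g q (Y' q) (Z q))"
        by (rule dir_deriv_cong[OF V(1,2)]) (simp add: YY)
      then show "?F Y Z = ?F Y' Z"
        using linear_connectionD(4)[OF C V(1,4) YY V(2), of x] YY[OF V(2)] by simp }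
    { assume Y': "smooth_field \<A> V Y'"
      show "?F (\<lambda>q. Y q + Y' q) Z = ?F Y Z + ?F Y' Z"
        using dir_deriv_add[OF V(1,2) smooth_g[OF V(1,4) Z] smooth_g[OF V(1) Y' Z], of x]
          linear_connectionD(2)[OF C V(1,4) Y' V(2), of x] by (simp add: g_simps) }
    { fix f assume f: "smooth_fun \<A> V f"
      show "?F (\<lambda>q. f q *\<^sub>R Y q) Z = f p *\<^sub>R ?F Y Z"
        using dir_deriv_mult[OF V(1,2) f smooth_g[OF V(1,4) Z], of x]
          linear_connectionD(3)[OF C V(1) f V(4,2), of x] by (simp add: g_simps algebra_simps) }
  qed
  have sw: "?F Y Z = ?F Z Y" for Y Z
  proof -
    have *: "(\<lambda>q. g q (Y q) (Z q)) = (\<lambda>q. g q (Z q) (Y q))" by (rule ext) (rule g_sym)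
    show ?thesis unfolding * using g_sym[of p "N p x Y" "Z p"] g_sym[of p "Y p" "N p x Z"]
        by linarith
  qed
  let ?U = "U \<inter> chart_dom p"
  have V: "open ?U" "p \<in> ?U" "?U \<subseteq> U" using U open_chart_dom chart_at by auto
  have "?F Y Z = ?F Z (extend \<A> p (Y p))" using 1[OF U Y Z] sw[of "extend \<A> p (Y p)" Z] by simp
  also have "\<dots> = ?F (extend \<A> p (Z p)) (extend \<A> p (Y p))"
    using 1[OF V(1,2) smooth_field_subset[OF Z V(3)] smooth_extend[of ?U p "Y p"]] by simp
  also have "\<dots> = 0"
    using par[of p x "Z p" "Y p"] by (simp add: cov_deriv2_def extend_same)
  finally show ?thesis by simp
qed

lemma is_levi_civitaD:
  assumes "is_levi_civita \<A> g N"
  shows "linear_connection \<A> N" "cov_deriv2 \<A> N g p x y z = 0"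
    "open U \<Longrightarrow> smooth_field \<A> U X \<Longrightarrow> smooth_field \<A> U Y \<Longrightarrow> p \<in> U \<Longrightarrow> torsion \<A> N X Y p = 0"
  using assms unfolding is_levi_civita_def by blast+

text \<open>The difference \<open>S\<close> is symmetric in \<open>x\<close>, \<open>y\<close> by
  vanishing torsion, and \<open>g p (S x y) z\<close> is skew in \<open>y\<close>, \<open>z\<close>
  by the metric property; alternating the two symmetries forces it to be zero.\<close>

lemma levi_civita_unique:
  assumes N: "is_levi_civita \<A> g N" and N': "is_levi_civita \<A> g N'"
    and U: "open U" "p \<in> U" and Y: "smooth_field \<A> U Y"
  shows "N p x Y = N' p x Y"
proof -
  note C = is_levi_civitaD(1)[OF N] is_levi_civitaD(1)[OF N']
  define S where "S x y = N p x (extend \<A> p y) - N' p x (extend \<A> p y)" for x y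
  have skew: "g p (S x y) z = - g p (S x z) y" for x y z
    using is_levi_civitaD(2)[OF N, of p x y z] is_levi_civitaD(2)[OF N', of p x y z]
      g_sym[of p y "N p x (extend \<A> p z)"] g_sym[of p y "N' p x (extend \<A> p z)"]
    unfolding cov_deriv2_def S_def by (simp only: g_simps)
  have sym: "S x y = S y x" for x y
  proof -
    have *: "smooth_field \<A> (chart_dom p) (extend \<A> p v)" for v by (rule smooth_extend) simp
    have "torsion \<A> N (extend \<A> p x) (extend \<A> p y) p
        = torsion \<A> N' (extend \<A> p x) (extend \<A> p y) p"
      using is_levi_civitaD(3)[OF N open_chart_dom * * chart_at(2)]
        is_levi_civitaD(3)[OF N' open_chart_dom * * chart_at(2)] by simp
    then show ?thesis unfolding torsion_def S_def extend_same by (simp add: algebra_simps)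
  qed
  have sym': "g p (S x y) z = g p (S y x) z" for x y z using sym[of x y] by (rule arg_cong)
  have "g p (S x y) z = 0" for x y z
    using skew[of x y z] sym'[of x z y] skew[of z x y] sym'[of z y x] skew[of y z x] sym'[of y x z]
    by linarith
  then have "S x y = 0" for x y by (intro fr.g_eqI[of p]) (simp add: g_simps)
  then show ?thesis using connection_difference_tensorial[OF C U Y, of x] by (simp add: S_def)
qed

end

section \<open>The fundamental 4-form and the cubic discriminant\<close>

context quat8
begin

lemma I_anticommute: "I s *v (I t *v x) + I t *v (I s *v x) = (if s = t then -2 else 0) *\<^sub>R x"
proof -
  have "- x - x = (-2) *\<^sub>R x" using scaleR_left_diff_distrib[of "-1" 1 x] by simp
  then show ?thesis using exhaust_3[of s] exhaust_3[of t] by (auto simp: I_simps)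
qed

lemma Q_expansion:
  assumes "J \<in> Q"
  shows "\<exists>c. \<forall>x. J *v x = (\<Sum>t\<in>UNIV. c t *\<^sub>R (I t *v x))"
proof -
  have "J \<in> span (range I)" using assms qb by (simp add: quaternionic_basis_def)
  then show ?thesis
  proof (induction rule: span_induct_alt)
    case base
    show ?case by (rule exI[of _ "\<lambda>_. 0"]) simp
  next
    case (step k M N)
    then obtain c s where cs: "\<And>x. N *v x = (\<Sum>t\<in>UNIV. c t *\<^sub>R (I t *v x))" "M = I s" by blast
    have "(k *\<^sub>R M + N) *v x = (\<Sum>t\<in>UNIV. (c t + (if t = s then k else 0)) *\<^sub>R (I t *v x))" for x
      using exhaust_3[of s] unfolding cs(2) matrix_vector_mult_add_rdistrib cs(1)
      by (auto simp: sum_3 scaleR_left_distrib simp flip: scaleR_matrix_vector_assoc)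
    then show ?case by (intro exI[of _ "\<lambda>t. c t + (if t = s then k else 0)"] allI)
  qed
qed

text \<open>The Clifford relation: anticommutators are -2 times the inner product of the
  coefficients. It makes a change of quaternionic basis orthogonal.\<close>

lemma combination_anticommute:
  assumes "\<And>x. J *v x = (\<Sum>t\<in>UNIV. c t *\<^sub>R (I t *v x))"
      "\<And>x. J' *v x = (\<Sum>t\<in>UNIV. c' t *\<^sub>R (I t *v x))"
  shows "J *v (J' *v x) + J' *v (J *v x) = (- 2 * (\<Sum>t\<in>UNIV. c t * c' t)) *\<^sub>R x"
proof -
  have lin: "linear (\<lambda>x. I t *v x)" for t by (rule matrix_vector_mul_linear)
  have "J *v (J' *v x) + J' *v (J *v x) =
    (\<Sum>s\<in>UNIV. \<Sum>t\<in>UNIV. (c s * c' t) *\<^sub>R (I s *v (I t *v x) + I t *v (I s *v x)))"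
  proof -
    have "J' *v (J *v x) = (\<Sum>s\<in>UNIV. \<Sum>t\<in>UNIV. (c s * c' t) *\<^sub>R (I t *v (I s *v x)))"
      unfolding assms by (subst sum.swap) (simp add: linear_sum[OF lin] linear_scale[OF lin]
          scaleR_sum_right mult.commute)
    moreover have "J *v (J' *v x) = (\<Sum>s\<in>UNIV. \<Sum>t\<in>UNIV. (c s * c' t) *\<^sub>R (I s *v (I t *v x)))"
      unfolding assms by (simp add: linear_sum[OF lin] linear_scale[OF lin] scaleR_sum_right)
    ultimately show ?thesis by (simp add: scaleR_right_distrib sum.distrib)
  qed
  also have "\<dots> = (\<Sum>s\<in>UNIV. (- 2 * (c s * c' s)) *\<^sub>R x)"
  proof (rule sum.cong[OF refl])
    fix s
    have "(\<Sum>t\<in>UNIV. (c s * c' t) *\<^sub>R (I s *v (I t *v x) + I t *v (I s *v x)))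
      = (\<Sum>t\<in>UNIV. if t = s then (- 2 * (c s * c' s)) *\<^sub>R x else 0)"
      by (intro sum.cong refl) (simp add: I_anticommute)
    then show "(\<Sum>t\<in>UNIV. (c s * c' t) *\<^sub>R (I s *v (I t *v x) + I t *v (I s *v x)))
        = (- 2 * (c s * c' s)) *\<^sub>R x"
      by simp
  qed
  finally show ?thesis by (simp only: sum_distrib_left scaleR_sum_left)
qed

text \<open>\<open>fundamental_4form\<close> chooses its basis separately at each point; this allows
  a smooth local basis to be used when it is differentiated.\<close>

lemma sum_omega_basis_independent:
  assumes "quaternionic_basis g Q I'"
  shows "(\<Sum>s\<in>UNIV. g (I' s *v x) y * g (I' s *v z) w) = (\<Sum>s\<in>UNIV. g (I s *v x) y * g (I s *v z) w)"
proof -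
  interpret q': quat8 g h Q I' by unfold_locales (rule assms)
  have "I' s \<in> Q" for s using assms by (auto simp: quaternionic_basis_def span_base)
  then have "\<forall>s. \<exists>c. \<forall>x. I' s *v x = (\<Sum>t\<in>UNIV. c t *\<^sub>R (I t *v x))"
    by (intro allI Q_expansion)
  from choice[OF this] obtain c where c: "\<And>s x. I' s *v x = (\<Sum>t\<in>UNIV. c s t *\<^sub>R (I t *v x))"
    by blast
  define M :: "real^3^3" where "M = (\<chi> s t. c s t)"
  have orth: "(\<Sum>u\<in>UNIV. c s u * c t u) = (if s = t then 1 else 0)" for s t
  proof -
    have "(- 2 * (\<Sum>u\<in>UNIV. c s u * c t u)) *\<^sub>R h 1 = (if s = t then -2 else 0) *\<^sub>R h 1"
      using combination_anticommute[OF c c, of s t "h 1"] q'.I_anticommute[of s t "h 1"] by simp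
    moreover have "h 1 \<noteq> 0" using frame_inner[of 1 1] by (auto simp: g_l)
    ultimately show ?thesis by (auto simp: scaleR_cancel_right split: if_splits)
  qed
  then have "M ** transpose M = mat 1"
    by (simp add: M_def matrix_matrix_mult_def transpose_def mat_def vec_eq_iff)
  \<comment> \<open>The anticommutators give orthonormal rows, while the sum over \<open>s\<close>
    needs orthonormal columns.\<close>
  then have "transpose M ** M = mat 1" by (simp add: matrix_left_right_inverse)
  then have orth': "(\<Sum>s\<in>UNIV. c s t * c s u) = (if t = u then 1 else 0)" for t u
    by (simp add: M_def matrix_matrix_mult_def transpose_def mat_def vec_eq_iff)
  have "(\<Sum>s\<in>UNIV. g (I' s *v x) y * g (I' s *v z) w)
    = (\<Sum>s\<in>UNIV. \<Sum>t\<in>UNIV. \<Sum>u\<in>UNIV. (c s t * c s u) * (g (I t *v x) y * g (I u *v z) w))"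
    unfolding c by (simp add: g_sum g_l sum_product mult_ac)
  also have "\<dots> = (\<Sum>t\<in>UNIV. \<Sum>u\<in>UNIV. \<Sum>s\<in>UNIV. (c s t * c s u) * (g (I t *v x) y * g (I u *v z) w))"
    by (subst sum.swap) (intro sum.cong refl sum.swap)
  also have "\<dots> = (\<Sum>t\<in>UNIV. \<Sum>u\<in>UNIV. if t = u then g (I t *v x) y * g (I u *v z) w else 0)"
    unfolding sum_distrib_right[symmetric] orth' by (intro sum.cong refl) simp
  finally show ?thesis by simp
qed

definition omega2 :: "vec \<Rightarrow> vec \<Rightarrow> vec \<Rightarrow> vec \<Rightarrow> real" where
  "omega2 x y z w = (\<Sum>s\<in>UNIV. g (I s *v x) y * g (I s *v z) w)"

text \<open>The six terms of the wedge of a form with itself coincide in pairs, hence the factor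
  2.\<close>

lemma fundamental_4form_eq:
  "fundamental_4form g Q x y z w = 2 * (omega2 x y z w - omega2 x z y w + omega2 x w y z)"
proof -
  define I' where "I' = (SOME I. quaternionic_basis g Q I)"
  have "quaternionic_basis g Q I'" unfolding I'_def
      by (rule someI[of "quaternionic_basis g Q" I, OF qb])
  note * = sum_omega_basis_independent[OF this]
  have "fundamental_4form g Q x y z w = 2 * ((\<Sum>s\<in>UNIV. g (I' s *v x) y * g (I' s *v z) w)
      - (\<Sum>s\<in>UNIV. g (I' s *v x) z * g (I' s *v y) w) + (\<Sum>s\<in>UNIV. g (I' s *v x) w * g (I' s *v y)
          z))"
    unfolding fundamental_4form_def Let_def I'_def[symmetric] wedge22_def
    by (simp add: sum.distrib sum_subtractf sum_distrib_left algebra_simps)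
  then show ?thesis unfolding * omega2_def .
qed

end

section \<open>The connection \<open>D\<close>, its contorsion \<open>d\<close>, and the parallel
  4-form\<close>

locale discriminant_manifold = metric_manifold \<A> g
  for \<A> :: "'m::topological_space chart set" and g +
  fixes Q :: "'m \<Rightarrow> endo set"
    and K :: "'m \<Rightarrow> vec \<Rightarrow> vec \<Rightarrow> vec \<Rightarrow> vec \<Rightarrow> real"
    and D :: "'m connection"
    and d :: "'m \<Rightarrow> vec \<Rightarrow> vec \<Rightarrow> vec \<Rightarrow> real"
  assumes aqh: "almost_quaternion_hermitian \<A> g Q"
    and cubic: "cubic_discriminant \<A> g Q K"
    and D: "linear_connection \<A> D"
    and holonomy: "holonomy_in_SO4_ir \<A> g Q K D"
    and d_tensor: "tensor3_field \<A> d"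
    and d_skew: "\<And>p x y z. d p x y z = - d p x z y"
    and torsion_d: "\<And>U X Y Z p. open U \<Longrightarrow> smooth_field \<A> U X \<Longrightarrow> smooth_field \<A> U Y \<Longrightarrow>
        smooth_field \<A> U Z \<Longrightarrow> p \<in> U \<Longrightarrow>
        g p (torsion \<A> D X Y p) (Z p) = d p (X p) (Y p) (Z p) - d p (Y p) (X p) (Z p)"
    and d_quaternionic: "\<And>p I s x y z. quaternionic_basis (g p) (Q p) I \<Longrightarrow>
        d p x y z = d p x (I s *v y) (I s *v z)"
    and d_orthogonal: "\<And>p E s h x. sp1_generators (g p) (Q p) (K p) E \<Longrightarrow> orthonormal_frame (g p) h \<Longrightarrow>
        (\<Sum>a\<in>UNIV. d p x (h a) (E s *v h a)) = 0"
begin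

lemma d_linear: "linear (\<lambda>v. d p v y z)" "linear (\<lambda>v. d p x v z)" "linear (\<lambda>v. d p x y v)"
  using d_tensor by (auto simp: tensor3_field_def)

lemma D_metric: "cov_deriv2 \<A> D g p x y z = 0"
  and D_Q: "open U \<Longrightarrow> smooth_endo \<A> U J \<Longrightarrow> (\<And>q. q \<in> U \<Longrightarrow> J q \<in> Q q) \<Longrightarrow> p \<in> U \<Longrightarrow>
      cov_deriv_endo \<A> D J p x \<in> Q p"
  and D_K: "cov_deriv4 \<A> D K p x y z v w = 0"
proof -
  note * = holonomy[unfolded holonomy_in_SO4_ir_def]
  show "cov_deriv2 \<A> D g p x y z = 0" using *[THEN conjunct1] by blast
  show "open U \<Longrightarrow> smooth_endo \<A> U J \<Longrightarrow> (\<And>q. q \<in> U \<Longrightarrow> J q \<in> Q q) \<Longrightarrow> p \<in> U \<Longrightarrow>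
      cov_deriv_endo \<A> D J p x \<in> Q p"
    using *[THEN conjunct2, THEN conjunct1] by blast
  show "cov_deriv4 \<A> D K p x y z v w = 0" using *[THEN conjunct2, THEN conjunct2] by blast
qed

abbreviation h :: "'m \<Rightarrow> 8 \<Rightarrow> vec" where "h p \<equiv> frame (g p)"

definition contorsion :: "'m \<Rightarrow> vec \<Rightarrow> vec \<Rightarrow> vec" where
  "contorsion p x y = (\<Sum>a\<in>UNIV. d p x y (h p a) *\<^sub>R h p a)"

lemma g_contorsion: "g p (contorsion p x y) z = d p x y z"
  by (simp add: contorsion_def fr.g_sum g_simps fr.contract[OF d_linear(3)])

lemma contorsion_linear: "linear (\<lambda>x. contorsion p x y)" "linear (\<lambda>y. contorsion p x y)"
  by (rule linearI; simp add: contorsion_def linear_add[OF d_linear(1)] linear_scale[OF d_linear(1)]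
      linear_add[OF d_linear(2)] linear_scale[OF d_linear(2)] scaleR_left_distrib sum.distrib
          scaleR_sum_right)+

text \<open>The Levi-Civita connection: by \<open>d_skew\<close> and \<open>torsion_d\<close> it is metric and torsion-free.\<close>
definition N :: "'m connection" where
  "N p x Y = D p x Y - contorsion p x (Y p)"

lemma smooth_contorsion:
  assumes "open U" "smooth_field \<A> U X" "smooth_field \<A> U Y"
  shows "smooth_field \<A> U (\<lambda>q. contorsion q (X q) (Y q))"
proof (rule smooth_dual[OF assms(1), where w = "\<lambda>q. d q (X q) (Y q)"])
  fix V Z assume V: "open V" "V \<subseteq> U" "smooth_field \<A> V Z"
  then have "smooth_field \<A> V X" "smooth_field \<A> V Y" using assms smooth_field_subset by blast+
  then show "smooth_fun \<A> V (\<lambda>q. d q (X q) (Y q) (Z q))"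
    using d_tensor V unfolding tensor3_field_def by blast
qed (rule g_contorsion)

lemma N_connection: "linear_connection \<A> N"
  unfolding linear_connection_def
proof (intro allI impI conjI ballI)
  fix U :: "'m set" assume U: "open U"
  note C = linear_connectionD[OF D U]
  { fix Y p assume "smooth_field \<A> U Y" "p \<in> U"
    then show "linear (\<lambda>x. N p x Y)"
      unfolding N_def using C(1) contorsion_linear(1) by (intro linear_compose_sub) auto }
  { fix Y Z p x assume "smooth_field \<A> U Y \<and> smooth_field \<A> U Z" "p \<in> U"
    then show "N p x (\<lambda>q. Y q + Z q) = N p x Y + N p x Z"
      by (simp add: N_def C(2) linear_add[OF contorsion_linear(2)]) }
  { fix f Y p x assume "smooth_fun \<A> U f \<and> smooth_field \<A> U Y" "p \<in> U"
    then show "N p x (\<lambda>q. f q *\<^sub>R Y q) = dir_deriv \<A> p x f *\<^sub>R Y p + f p *\<^sub>R N p x Y"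
      by (simp add: N_def C(3) linear_scale[OF contorsion_linear(2)] scaleR_right_diff_distrib) }
  { fix Y Z p x assume "smooth_field \<A> U Y \<and> (\<forall>q\<in>U. Y q = Z q)" "p \<in> U"
    then show "N p x Y = N p x Z"
      using C(4)[of Y Z p x] by (simp add: N_def) }
  { fix X Y assume "smooth_field \<A> U X \<and> smooth_field \<A> U Y"
    then show "smooth_field \<A> U (\<lambda>q. N q (X q) Y)"
      unfolding N_def using C(5) U by (intro smooth_field_diff smooth_contorsion) auto }
qed

lemma N_levi_civita: "is_levi_civita \<A> g N"
  unfolding is_levi_civita_def
proof (intro conjI N_connection allI impI ballI)
  fix p x y z
  have "cov_deriv2 \<A> N g p x y z = cov_deriv2 \<A> D g p x y z + d p x y z + g p y (contorsion p x z)"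
    unfolding cov_deriv2_def N_def extend_same by (simp add: g_simps g_contorsion)
  then show "cov_deriv2 \<A> N g p x y z = 0"
    using d_skew[of p x y z] g_sym[of p y "contorsion p x z"] by (simp add: D_metric g_contorsion)
next
  fix U X Y p assume U: "open U \<and> smooth_field \<A> U X \<and> smooth_field \<A> U Y" and p: "p \<in> U"
  let ?U = "U \<inter> chart_dom p"
  have V: "open ?U" "p \<in> ?U" "?U \<subseteq> U" using U p open_chart_dom chart_at by auto
  show "torsion \<A> N X Y p = 0"
  proof (rule fr.g_eqI[of p])
    fix z
    have "smooth_field \<A> ?U X" "smooth_field \<A> ?U Y" "smooth_field \<A> ?U (extend \<A> p z)"
      using U V smooth_field_subset smooth_extend by blast+
    from torsion_d[OF V(1) this V(2)]
    have "g p (torsion \<A> D X Y p) z = d p (X p) (Y p) z - d p (Y p) (X p) z"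
        by (simp add: extend_same)
    moreover have "torsion \<A> N X Y p = torsion \<A> D X Y p - contorsion p (X p) (Y p)
        + contorsion p (Y p) (X p)"
      by (simp add: torsion_def N_def)
    ultimately show "g p (torsion \<A> N X Y p) z = g p 0 z" by (simp add: g_simps g_contorsion)
  qed
qed

abbreviation L :: "'m connection" where "L \<equiv> levi_civita \<A> g"

text \<open>\<open>levi_civita\<close> is a choice, and \<open>N\<close> shows that there is
  something to choose; uniqueness then identifies the two on smooth fields.\<close>

lemma L_levi_civita: "is_levi_civita \<A> g L"
  unfolding levi_civita_def by (rule someI[of "is_levi_civita \<A> g" N, OF N_levi_civita])

lemma L_eq: "open U \<Longrightarrow> p \<in> U \<Longrightarrow> smooth_field \<A> U Y \<Longrightarrow> L p x Y = D p x Y - contorsion p x (Y p)"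
  using levi_civita_unique[OF L_levi_civita N_levi_civita] by (simp add: N_def)

lemma L_extend: "L p x (extend \<A> p y) = D p x (extend \<A> p y) - contorsion p x y"
  using L_eq[OF open_chart_dom[of p] chart_at(2)[of p] smooth_extend[OF order_refl]]
      by (simp add: extend_same)

lemma local_basis:
  obtains U I where "open U" "p \<in> U" "\<And>s. smooth_endo \<A> U (I s)"
    "\<And>q. q \<in> U \<Longrightarrow> quaternionic_basis (g q) (Q q) (\<lambda>s. I s q)"
proof -
  have "\<exists>U I. open U \<and> p \<in> U \<and> (\<forall>s. smooth_endo \<A> U (I s)) \<and>
        (\<forall>q\<in>U. quaternionic_basis (g q) (Q q) (\<lambda>s. I s q))"
    using aqh unfolding almost_quaternion_hermitian_def by blast
  then show thesis using that by blast
qed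

text \<open>A pointwise statement: \<open>reconstruction\<close> is applied to the contorsion
  \<open>A\<close> in the direction \<open>x\<close>.\<close>

lemma d_eq_t: "d p x y z = t_tensor \<A> g K p x y z"
proof -
  obtain U I where "open U" "p \<in> U" "\<And>s. smooth_endo \<A> U (I s)"
    "\<And>q. q \<in> U \<Longrightarrow> quaternionic_basis (g q) (Q q) (\<lambda>s. I s q)"
    by (rule local_basis[of p]) (rule that)
  then have qb: "quaternionic_basis (g p) (Q p) (\<lambda>s. I s p)" by blast
  have "K p \<in> cubic_discriminants_at (g p) (Q p)" using cubic by (simp add: cubic_discriminant_def)
  with qb interpret c: cubic8 "g p" "h p" "Q p" "\<lambda>s. I s p" "K p"
    by unfold_locales simp_all
  obtain B where "finite B" "B \<subseteq> c.V" "span B = c.V"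
    "\<And>e f. e \<in> B \<Longrightarrow> f \<in> B \<Longrightarrow> fr.ip p e f = (if e = f then 1 else 0)"
    "\<And>A. A \<in> c.V \<Longrightarrow> A = (\<Sum>e\<in>B. fr.ip p e A *\<^sub>R e)"
    by (rule fr.ip_orthonormal_basis[OF c.subspace_V]) (rule that)
  then interpret c: cubic8_basis "g p" "h p" "Q p" "\<lambda>s. I s p" "K p" B
    by unfold_locales
  define A :: endo where "A = matrix (contorsion p x)"
  have A: "A *v y = contorsion p x y" for y
    unfolding A_def by (rule fun_cong[OF matrix_vector_mul(2)[OF contorsion_linear(2)]])
  have "A \<in> Bsp2 (g p) (Q p)"
    unfolding c.Bsp2_iff fr.skew_def
  proof (intro conjI allI)
    fix y z show "g p (A *v y) z = - g p y (A *v z)"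
      using d_skew[of p x y z] g_sym[of p y "contorsion p x z"] by (simp add: A g_contorsion)
  next
    fix s y
    show "A *v (I s p *v y) = I s p *v (A *v y)"
    proof (rule fr.g_eqI[of p])
      fix z
      have "g p (A *v (I s p *v y)) (I s p *v (I s p *v z)) = g p (A *v y) (I s p *v z)"
        using d_quaternionic[OF qb, of x y "I s p *v z" s] by (simp add: A g_contorsion)
      then show "g p (A *v (I s p *v y)) z = g p (I s p *v (A *v y)) z"
        by (simp add: c.I_simps c.g_I_left g_simps)
    qed
  qed
  moreover have "fr.ip p e A = 0" if "e \<in> c.V" for e
  proof -
    \<comment> \<open>With generators at hand, \<open>d_orthogonal\<close> says that
      \<open>A\<close> is orthogonal to each of them, hence to their span \<open>V\<close>.\<close>
    obtain E where E: "sp1_generators (g p) (Q p) (K p) E" using c.exists_sp1_generators by blast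
    have "fr.ip p A (E s) = 0" for s
      using d_orthogonal[OF E frame[of p], of x s] by (simp add: fr.ip_def A g_contorsion)
    then have E0: "fr.ip p (E s) A = 0" for s by (simp only: fr.ip_commute)
    have "e \<in> span (range E)" using E that by (simp add: sp1_generators_def)
    then show ?thesis
      by (induction rule: span_induct_alt) (auto simp: E0 fr.ip_linear fr.ip_linear(2)[of p 0,
          simplified])
  qed
  ultimately have "1/120 * (\<Sum>a\<in>UNIV. \<Sum>b\<in>UNIV. \<Sum>c\<in>UNIV.
      (K p (A *v y) (h p a) (h p b) (h p c) + K p y (A *v h p a) (h p b) (h p c)
       + K p y (h p a) (A *v h p b) (h p c) + K p y (h p a) (h p b) (A *v h p c)) * K p z (h p a)
           (h p b) (h p c)
    - (K p (A *v z) (h p a) (h p b) (h p c) + K p z (A *v h p a) (h p b) (h p c)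
       + K p z (h p a) (A *v h p b) (h p c) + K p z (h p a) (h p b) (A *v h p c)) * K p y (h p a)
           (h p b) (h p c))
    = g p (A *v y) z"
    by (rule c.reconstruction)
  \<comment> \<open>\<open>L\<close> is \<open>D\<close> minus \<open>A\<close>, and every slot of
    \<open>K\<close> enters a covariant derivative with a minus sign; as \<open>K\<close> is
    parallel for \<open>D\<close>, the action of \<open>A\<close> remains.\<close>
  moreover have "cov_deriv4 \<A> L K p x y z v w
    = K p (A *v y) z v w + K p y (A *v z) v w + K p y z (A *v v) w + K p y z v (A *v w)" for y z v w
    using D_K[of p x y z v w] unfolding cov_deriv4_def L_extend A
    by (simp add: c.K_simps)
  ultimately show ?thesis unfolding t_tensor_def Let_def A g_contorsion by simp
qed

lemma D_eq_canonical:
  assumes "open U" "smooth_field \<A> U Y" "p \<in> U"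
  shows "D p x Y = canonical_connection \<A> g K p x Y"
  unfolding canonical_connection_def L_eq[OF assms(1,3,2)] d_eq_t[symmetric] contorsion_def by simp

text \<open>The basis is not parallel: its derivative is a matrix \<open>a\<close>, the same for
  \<open>D\<close> and \<open>L\<close> because the contorsion commutes with the \<open>I s\<close>.
  As \<open>a\<close> is skew, it cancels in the sum of the squares of the 2-forms.\<close>

lemma fundamental_form_parallel:
  "cov_deriv4 \<A> L (\<lambda>q. fundamental_4form (g q) (Q q)) p x y z v w = 0"
proof -
  obtain U I where U: "open U" "p \<in> U" and sI: "\<And>s. smooth_endo \<A> U (I s)"
    and qb: "\<And>q. q \<in> U \<Longrightarrow> quaternionic_basis (g q) (Q q) (\<lambda>s. I s q)"
    by (rule local_basis[of p]) (rule that)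
  define W where "W = U \<inter> chart_dom p"
  have W: "open W" "p \<in> W" "W \<subseteq> U" "W \<subseteq> chart_dom p" using U open_chart_dom chart_at
      by (auto simp: W_def)
  have quat: "quat8 (g q) (h q) (Q q) (\<lambda>s. I s q)" if "q \<in> W" for q
    by (intro quat8.intro fr.frame8_axioms quat8_axioms.intro qb) (use that W in blast)
  interpret q: quat8 "g p" "h p" "Q p" "\<lambda>s. I s p" using quat W by blast
  let ?e = "extend \<A> p"
  have e: "smooth_field \<A> W (?e y)" for y using W by (intro smooth_extend)
  have Ie: "smooth_field \<A> W (\<lambda>q. I s q *v Y q)" if "smooth_field \<A> W Y" for s Y
    using smooth_endoD[OF sI W(1,3) that] .
  have "cov_deriv_endo \<A> D (I s) p x \<in> Q p" for s
  proof (rule D_Q[OF U(1) sI _ U(2)])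
    fix q assume "q \<in> U"
    then show "I s q \<in> Q q" using qb[of q] by (auto simp: quaternionic_basis_def span_base)
  qed
  then have "\<forall>s. \<exists>a. \<forall>y. cov_deriv_endo \<A> D (I s) p x *v y = (\<Sum>t\<in>UNIV. a t *\<^sub>R (I t p *v y))"
    by (intro allI q.Q_expansion)
  from choice[OF this] obtain a
    where a: "\<And>s y. cov_deriv_endo \<A> D (I s) p x *v y = (\<Sum>t\<in>UNIV. a s t *\<^sub>R (I t p *v y))"
    by blast
  have DI: "D p x (\<lambda>q. I s q *v Y q) = (\<Sum>t\<in>UNIV. a s t *\<^sub>R (I t p *v Y p)) + I s p *v D p x Y"
    if "smooth_field \<A> W Y" for s Y
  proof -
    have "smooth_endo \<A> W (I s)" using sI[of s] W(3) unfolding smooth_endo_def by blast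
    from cov_deriv_endo_eq[OF D this W(1,2) that] show ?thesis by (simp add: a)
  qed
  \<comment> \<open>\<open>D\<close> is applied to the Clifford relation of the local basis. Its
    right side has constant coefficients, so the terms that differentiate the test field cancel, and
    the anticommutators leave \<open>a s t + a t s = 0\<close>.\<close>
  have a_skew: "a s t = - a t s" for s t
  proof -
    let ?c = "if s = t then - 2 else 0 :: real"
    let ?y = "h p 1"
    have delta: "(\<Sum>u\<in>UNIV. f u *\<^sub>R ((if u = r then - 2 else 0) *\<^sub>R ?y)) = (- 2 * f r) *\<^sub>R ?y"
      for f and r :: 3
    proof -
      have "(\<Sum>u\<in>UNIV. f u *\<^sub>R ((if u = r then - 2 else 0) *\<^sub>R ?y))
        = (\<Sum>u\<in>UNIV. if u = r then (- 2 * f r) *\<^sub>R ?y else 0)"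
        by (intro sum.cong refl) simp
      then show ?thesis by simp
    qed
    have anti: "I s q *v (I t q *v ?e ?y q) + I t q *v (I s q *v ?e ?y q) = ?c *\<^sub>R ?e ?y q" if
        "q \<in> W" for q
      by (rule quat8.I_anticommute[OF quat[OF that]])
    have st: "D p x (\<lambda>q. I s q *v (I t q *v ?e ?y q))
        = (\<Sum>u\<in>UNIV. a s u *\<^sub>R (I u p *v (I t p *v ?y)))
        + I s p *v ((\<Sum>u\<in>UNIV. a t u *\<^sub>R (I u p *v ?y)) + I t p *v D p x (?e ?y))" for s t
      using DI[OF Ie[OF e], of s t ?y] DI[OF e, of t ?y] by (simp add: extend_same)
    have "?c *\<^sub>R D p x (?e ?y) = D p x (\<lambda>q. ?c *\<^sub>R ?e ?y q)"
      using linear_connectionD(3)[OF D W(1) smooth_fun_const e W(2), of x ?c ?y]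
      by (simp add: dir_deriv_const)
    also have "\<dots> = D p x (\<lambda>q. I s q *v (I t q *v ?e ?y q) + I t q *v (I s q *v ?e ?y q))"
    proof (rule linear_connectionD(4)[OF D W(1) _ _ W(2)])
      show "smooth_field \<A> W (\<lambda>q. ?c *\<^sub>R ?e ?y q)"
        by (intro smooth_field_scaleR W smooth_fun_const e)
    qed (simp only: anti)
    also have "\<dots> = D p x (\<lambda>q. I s q *v (I t q *v ?e ?y q))
        + D p x (\<lambda>q. I t q *v (I s q *v ?e ?y q))"
      by (intro linear_connectionD(2)[OF D W(1)] Ie e W)
    also have "\<dots> = (\<Sum>u\<in>UNIV. a s u *\<^sub>R (I u p *v (I t p *v ?y) + I t p *v (I u p *v ?y)))
      + (\<Sum>u\<in>UNIV. a t u *\<^sub>R (I u p *v (I s p *v ?y) + I s p *v (I u p *v ?y)))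
      + (I s p *v (I t p *v D p x (?e ?y)) + I t p *v (I s p *v D p x (?e ?y)))"
      unfolding st by (simp add: sum.distrib scaleR_right_distrib matrix_vector_right_distrib
          linear_sum[OF matrix_vector_mul_linear] matrix_vector_mult_scaleR algebra_simps)
    also have "\<dots> = (\<Sum>u\<in>UNIV. a s u *\<^sub>R ((if u = t then - 2 else 0) *\<^sub>R ?y))
      + (\<Sum>u\<in>UNIV. a t u *\<^sub>R ((if u = s then - 2 else 0) *\<^sub>R ?y)) + ?c *\<^sub>R D p x (?e ?y)"
      by (simp only: q.I_anticommute)
    also have "(\<Sum>u\<in>UNIV. a s u *\<^sub>R ((if u = t then - 2 else 0) *\<^sub>R ?y)) = (- 2 * a s t) *\<^sub>R ?y"
      by (rule delta)
    also have "(\<Sum>u\<in>UNIV. a t u *\<^sub>R ((if u = s then - 2 else 0) *\<^sub>R ?y)) = (- 2 * a t s) *\<^sub>R ?y"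
      by (rule delta)
    finally have "(- 2 * a s t - 2 * a t s) *\<^sub>R ?y = 0" by (simp add: scaleR_left_diff_distrib)
    moreover have "?y \<noteq> 0" using fr.frame_inner[of p 1 1] by (auto simp: g_simps)
    ultimately show ?thesis by simp
  qed
  have comm: "contorsion p x (I s p *v y) = I s p *v contorsion p x y" for s y
  proof (rule fr.g_eqI[of p])
    fix z
    have "g p (contorsion p x (I s p *v y)) (I s p *v (I s p *v z))
        = g p (contorsion p x y) (I s p *v z)"
      using d_quaternionic[OF q.qb, of x y "I s p *v z" s] by (simp add: g_contorsion)
    then show "g p (contorsion p x (I s p *v y)) z = g p (I s p *v contorsion p x y) z"
      by (simp add: q.I_simps q.g_I_left g_simps)
  qed
  define l where "l y = L p x (?e y)" for y
  have LI: "L p x (\<lambda>q. I s q *v ?e y q) = (\<Sum>t\<in>UNIV. a s t *\<^sub>R (I t p *v y)) + I s p *v l y" for s y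
    using L_eq[OF W(1,2) Ie[OF e], of x s y] DI[OF e, of s y]
    by (simp add: l_def L_extend extend_same comm matrix_vector_mult_diff_distrib)
  let ?w = "\<lambda>s y z q. g q (I s q *v ?e y q) (?e z q)"
  have sw: "smooth_fun \<A> W (?w s y z)" for s y z by (intro smooth_g W Ie e)
  have dw: "dir_deriv \<A> p x (?w s y z) = (\<Sum>t\<in>UNIV. a s t * g p (I t p *v y) z)
      + g p (I s p *v l y) z + g p (I s p *v y) (l z)" for s y z
    using metric_derivative[OF is_levi_civitaD(1,2)[OF L_levi_civita] W(1,2) Ie[OF e] e, of x s y z]
    unfolding LI by (simp add: extend_same l_def g_simps fr.g_sum)
  let ?O = "\<lambda>y z v w q. \<Sum>s\<in>UNIV. ?w s y z q * ?w s v w q"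
  have sO: "smooth_fun \<A> W (?O y z v w)" for y z v w
    by (intro smooth_fun_sum smooth_fun_mult W sw)
  have dO: "dir_deriv \<A> p x (?O y z v w) = q.omega2 (l y) z v w + q.omega2 y (l z) v w
      + q.omega2 y z (l v) w + q.omega2 y z v (l w)" for y z v w
  proof -
    let ?g = "\<lambda>s y z. g p (I s p *v y) z"
    have "dir_deriv \<A> p x (?O y z v w) = (\<Sum>s\<in>UNIV. ?w s y z p * dir_deriv \<A> p x (?w s v w)
        + dir_deriv \<A> p x (?w s y z) * ?w s v w p)"
      by (subst dir_deriv_sum[OF W(1,2)]) (intro smooth_fun_mult W sw, simp only:
          dir_deriv_mult[OF W(1,2) sw sw])
    also have "\<dots> = (\<Sum>s\<in>UNIV. \<Sum>t\<in>UNIV. a s t * (?g s y z * ?g t v w + ?g t y z * ?g s v w))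
      + (q.omega2 (l y) z v w + q.omega2 y (l z) v w + q.omega2 y z (l v) w + q.omega2 y z v (l w))"
      unfolding dw extend_same q.omega2_def
      by (simp add: sum.distrib sum_distrib_left sum_distrib_right algebra_simps)
    \<comment> \<open>A skew matrix against an expression symmetric in \<open>s\<close> and
      \<open>t\<close>.\<close>
    also have "(\<Sum>s\<in>UNIV. \<Sum>t\<in>UNIV. a s t * (?g s y z * ?g t v w + ?g t y z * ?g s v w)) = 0"
    proof -
      let ?S = "\<Sum>s\<in>UNIV. \<Sum>t\<in>UNIV. a s t * (?g s y z * ?g t v w + ?g t y z * ?g s v w)"
      have "?S = (\<Sum>s\<in>UNIV. \<Sum>t\<in>UNIV. a t s * (?g t y z * ?g s v w + ?g s y z * ?g t v w))"
        by (rule sum.swap)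
      also have "\<dots> = - ?S"
        by (subst a_skew) (simp add: sum_negf add.commute)
      finally show ?thesis by simp
    qed
    finally show ?thesis by simp
  qed
  \<comment> \<open>Near \<open>p\<close> the pointwise chosen bases are replaced by the smooth one,
    which makes the coefficients of the 4-form differentiable.\<close>
  have form: "fundamental_4form (g q) (Q q) (?e y q) (?e z q) (?e v q) (?e w q)
      = 2 * (?O y z v w q + - ?O y v z w q + ?O y w z v q)" if "q \<in> W" for q
    using quat8.fundamental_4form_eq[OF quat[OF that]] quat8.omega2_def[OF quat[OF that]] by simp
  have "dir_deriv \<A> p x (\<lambda>q. fundamental_4form (g q) (Q q) (?e y q) (?e z q) (?e v q) (?e w q))
    = dir_deriv \<A> p x (\<lambda>q. 2 * (?O y z v w q + - ?O y v z w q + ?O y w z v q))"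
    by (rule dir_deriv_cong[OF W(1,2) form])
  also have "\<dots> = 2 * (dir_deriv \<A> p x (?O y z v w) - dir_deriv \<A> p x (?O y v z w)
      + dir_deriv \<A> p x (?O y w z v))"
    using dir_deriv_mult[OF W(1,2) smooth_fun_const[of W 2]
        smooth_fun_add[OF W(1) smooth_fun_add[OF W(1) sO smooth_fun_minus[OF W(1) sO]] sO], of x y
            z v w y v z w y w z v]
      dir_deriv_add[OF W(1,2) smooth_fun_add[OF W(1) sO smooth_fun_minus[OF W(1) sO]] sO, of x y z
          v w y v z w y w z v]
      dir_deriv_add[OF W(1,2) sO smooth_fun_minus[OF W(1) sO], of x y z v w y v z w]
      dir_deriv_minus[OF W(1,2) sO, of x y v z w]
    by (simp only: dir_deriv_const mult_zero_left add_0_right add_uminus_conv_diff)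
  finally show ?thesis
    unfolding cov_deriv4_def l_def[symmetric] q.fundamental_4form_eq dO by simp
qed

end

theorem proposition5p3:
  fixes \<A> :: "'m::{t2_space,second_countable_topology} chart set"
    and g :: "'m \<Rightarrow> vec \<Rightarrow> vec \<Rightarrow> real"
    and Q :: "'m \<Rightarrow> endo set"
    and K :: "'m \<Rightarrow> vec \<Rightarrow> vec \<Rightarrow> vec \<Rightarrow> vec \<Rightarrow> real"
    and D :: "'m connection"
    and d :: "'m \<Rightarrow> vec \<Rightarrow> vec \<Rightarrow> vec \<Rightarrow> real"
  assumes "smooth_atlas \<A>"
    and "almost_quaternion_hermitian \<A> g Q"
    and "cubic_discriminant \<A> g Q K"
    and "linear_connection \<A> D"
    and holonomy: "holonomy_in_SO4_ir \<A> g Q K D"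
    and d_tensor: "tensor3_field \<A> d"
    and d_skew: "\<And>p x y z. d p x y z = - d p x z y"
    and torsion_d: "\<And>U X Y Z p. open U \<Longrightarrow> smooth_field \<A> U X \<Longrightarrow> smooth_field \<A> U Y \<Longrightarrow>
        smooth_field \<A> U Z \<Longrightarrow> p \<in> U \<Longrightarrow>
        g p (torsion \<A> D X Y p) (Z p) = d p (X p) (Y p) (Z p) - d p (Y p) (X p) (Z p)"
    and d_quaternionic: "\<And>p I s x y z. quaternionic_basis (g p) (Q p) I \<Longrightarrow>
        d p x y z = d p x (I s *v y) (I s *v z)"
    and d_orthogonal: "\<And>p E s h x. sp1_generators (g p) (Q p) (K p) E \<Longrightarrow> orthonormal_frame (g p) h \<Longrightarrow>
        (\<Sum>a\<in>UNIV. d p x (h a) (E s *v h a)) = 0"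
  shows "quaternion_kaehler \<A> g Q \<and>
    same_connection \<A> D (canonical_connection \<A> g K) \<and>
    d = t_tensor \<A> g K"
proof -
  have riem: "riemannian_metric \<A> g" using assms(2) by (simp add: almost_quaternion_hermitian_def)
  interpret discriminant_manifold \<A> g Q K D d
  proof (intro discriminant_manifold.intro metric_manifold.intro smooth_manifold.intro
        metric_manifold_axioms.intro discriminant_manifold_axioms.intro)
  qed (fact assms riem)+
  show ?thesis
    unfolding quaternion_kaehler_def same_connection_def
    using assms(2) fundamental_form_parallel D_eq_canonical d_eq_t by (auto intro!: ext)
qed

end
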